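(* Let $F=\{\sigma_1,\dots,\sigma_n\}\subset\partial\mathbb{D}$ consist of pairwise distinct points, let $\Lambda=(\lambda_1,\dots,\lambda_n)\in(-\infty,0)^n$, and let $\tau\in\mathbb{D}\setminus\{0\}$. Put $\alpha_k:=|\tau-\sigma_k|^2/(2|\lambda_k|)$ and $$Z:=\Big\{\zeta\in\mathbb{C}:\Big|\Big(2\tau^{-1}\sum_{k=1}^n\alpha_k\Big)\zeta-1\Big|\le1\Big\}.$$ For $\zeta\in Z\setminus\{0\}$ put $$\ell_\zeta:=\frac{\tau}{\zeta}-\sum_{k=1}^n\alpha_k,\qquad a_\zeta:=\frac{1+|\tau|^2}{1-|\tau|^2}\mathrm{Re}\,\ell_\zeta+i\,\mathrm{Im}\,\ell_\zeta+p_0(\tau;F,\Lambda),$$ $$\Omega_\zeta:=\Big\{\omega\in\mathbb{C}:\Big|\frac{1-|\tau|^2}{\omega}-a_\zeta\Big|\le\frac{2|\tau|}{1-|\tau|^2}\mathrm{Re}\,\ell_\zeta\Big\},$$ a closed disk which degenerates to a point when $\zeta\in\partial Z$. Put $\Omega_0:=\{0\}$. Then the value region $$V_\tau(F,\Lambda):=\{(G(0),\lambda(G)):G\in\mathsf{Gen}_\tau(F,\Lambda)\}$$ coincides with $\{(\zeta,\omega)\in\mathbb{C}^2:\zeta\in Z,\ \omega\in\Omega_\zeta\}$. Moreover, each boundary point of $V_\tau(F,\Lambda)$ is delivered by a unique $G\in\mathsf{Gen}_\tau(F,\Lambda)$, which is of one of the following forms: - $G(z)=\dfrac{(\tau-z)(1-\overline\tau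 z)}{\frac{\sigma+z}{\sigma-z}\mathrm{Re}\,\ell_\zeta+i\,\mathrm{Im}\,\ell_\zeta+p_0(z;F,\Lambda)}$ with $\zeta$ in the interior of $Z$ and $\sigma\in\partial\mathbb{D}$; - $G(z)=\dfrac{(\tau-z)(1-\overline\tau z)}{i\,\mathrm{Im}\,\ell_\zeta+p_0(z;F,\Lambda)}$ with $\zeta\in\partial Z\setminus\{0\}$; - $G\equiv0$.
   Context: $\mathbb{D}$ is the open unit disk. A one-parameter semigroup $(\phi_t)_{t\ge0}$ of holomorphic self-maps of $\mathbb{D}$ satisfies $\phi_0=\mathrm{id}$, $\phi_s\circ\phi_t=\phi_{s+t}$, and $\phi_t\to\mathrm{id}$ pointwise as $t\to0^+$. Its infinitesimal generator $G$ satisfies $\frac{d}{dt}\phi_t(z)=G(\phi_t(z))$. $\mathsf{Gen}_\tau$ is the set of generators of semigroups with Denjoy–Wolff point $\tau$, together with $G\equiv0$. For $G\in\mathsf{Gen}_\tau$, $\lambda(G)$ denotes the spectral value at the Denjoy–Wolff point, i.e. $\phi_t'(\tau)=e^{-\lambda(G)t}$; for $\tau\in\mathbb{D}$ this means $\lambda(G)=-G'(\tau)$. A point $\sigma\in\partial\mathbb{D}$ is a boundary regular fixed point (BRFP) if each $\phi_t$ has angular limit $\sigma$ and a finite angular derivative at $\sigma$. The spectral value $\lambda'$ at $\sigma$ is given by $\phi_t'(\sigma)=e^{-\lambda' t}$, equivalently $\lambda'=\angle\lim_{z\to\sigma}G(z)/(\sigma-z)$. $\mathsf{Gen}_\tau(F,\Lambda)$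 is the set of $G\in\mathsf{Gen}_\tau$ whose semigroup has BRFPs at all $\sigma_k$ with spectral values $\lambda'_k\in[\lambda_k,0]$ (including $G\equiv0$). $p_0(z;F,\Lambda):=\sum_{k=1}^n\alpha_k\frac{\sigma_k+z}{\sigma_k-z}$. *)

theory Defs
  imports "HOL-Analysis.Analysis"
begin

text \<open>The unit disk is ball 0 1. A semigroup is a family phi :: real => complex => complex,
  only its values for t >= 0 and z in the disk matter.\<close>

definition is_semigroup :: "(real \<Rightarrow> complex \<Rightarrow> complex) \<Rightarrow> bool" where
  "is_semigroup \<phi> \<longleftrightarrow>
     (\<forall>t\<ge>0. \<phi> t holomorphic_on ball 0 1 \<and> \<phi> t ` ball 0 1 \<subseteq> ball 0 1) \<and>
     (\<forall>z\<in>ball 0 1. \<phi> 0 z = z) \<and>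
     (\<forall>s\<ge>0. \<forall>t\<ge>0. \<forall>z\<in>ball 0 1. \<phi> s (\<phi> t z) = \<phi> (s + t) z) \<and>
     (\<forall>z\<in>ball 0 1. ((\<lambda>t. \<phi> t z) \<longlongrightarrow> z) (at_right 0))"

definition is_generator :: "(real \<Rightarrow> complex \<Rightarrow> complex) \<Rightarrow> (complex \<Rightarrow> complex) \<Rightarrow> bool" where
  "is_generator \<phi> G \<longleftrightarrow> G holomorphic_on ball 0 1 \<and>
     (\<forall>z\<in>ball 0 1. \<forall>t\<ge>0.
        ((\<lambda>s. \<phi> s z) has_vector_derivative G (\<phi> t z)) (at t within {0..}))"

text \<open>Interior Denjoy--Wolff point tau of a non-trivial semigroup: the common fixed point
  in the disk of all phi_t (this includes groups of elliptic automorphisms).\<close>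

definition DW_interior :: "(real \<Rightarrow> complex \<Rightarrow> complex) \<Rightarrow> complex \<Rightarrow> bool" where
  "DW_interior \<phi> \<tau> \<longleftrightarrow> \<tau> \<in> ball 0 1 \<and> (\<forall>t\<ge>0. \<phi> t \<tau> = \<tau>) \<and>
     \<not> (\<forall>t\<ge>0. \<forall>z\<in>ball 0 1. \<phi> t z = z)"

definition stolz_angle :: "complex \<Rightarrow> real \<Rightarrow> complex set" where
  "stolz_angle \<sigma> M = {z. cmod z < 1 \<and> cmod (\<sigma> - z) < M * (1 - cmod z)}"

definition angular_limit :: "(complex \<Rightarrow> complex) \<Rightarrow> complex \<Rightarrow> complex \<Rightarrow> bool" where
  "angular_limit f \<sigma> L \<longleftrightarrow> (\<forall>M>1. (f \<longlongrightarrow> L) (at \<sigma> within stolz_angle \<sigma> M))"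

definition BRFP_spectral :: "(real \<Rightarrow> complex \<Rightarrow> complex) \<Rightarrow> complex \<Rightarrow> real \<Rightarrow> bool" where
  "BRFP_spectral \<phi> \<sigma> l \<longleftrightarrow>
     (\<forall>t\<ge>0. angular_limit (\<phi> t) \<sigma> \<sigma> \<and>
             angular_limit (\<lambda>z. (\<phi> t z - \<sigma>) / (z - \<sigma>)) \<sigma> (of_real (exp (- l * t))))"

definition Gen :: "complex \<Rightarrow> (complex \<Rightarrow> complex) set" where
  "Gen \<tau> = {G. (\<forall>z\<in>ball 0 1. G z = 0) \<or>
               (\<exists>\<phi>. is_semigroup \<phi> \<and> is_generator \<phi> G \<and> DW_interior \<phi> \<tau>)}"

definition GenFL :: "complex \<Rightarrow> nat \<Rightarrow> (nat \<Rightarrow> complex) \<Rightarrow> (nat \<Rightarrow> real) \<Rightarrow> (complex \<Rightarrow> complex) set" where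
  "GenFL \<tau> n \<sigma> lam = {G. (\<forall>z\<in>ball 0 1. G z = 0) \<or>
     (\<exists>\<phi>. is_semigroup \<phi> \<and> is_generator \<phi> G \<and> DW_interior \<phi> \<tau> \<and>
          (\<forall>k\<in>{1..n}. \<exists>l. lam k \<le> l \<and> l \<le> 0 \<and> BRFP_spectral \<phi> (\<sigma> k) l))}"

definition spec_val :: "complex \<Rightarrow> (complex \<Rightarrow> complex) \<Rightarrow> complex" where
  "spec_val \<tau> G = - deriv G \<tau>"

definition value_region :: "complex \<Rightarrow> nat \<Rightarrow> (nat \<Rightarrow> complex) \<Rightarrow> (nat \<Rightarrow> real) \<Rightarrow> (complex \<times> complex) set" where
  "value_region \<tau> n \<sigma> lam = (\<lambda>G. (G 0, spec_val \<tau> G)) ` GenFL \<tau> n \<sigma> lam"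

definition alpha :: "complex \<Rightarrow> (nat \<Rightarrow> complex) \<Rightarrow> (nat \<Rightarrow> real) \<Rightarrow> nat \<Rightarrow> real" where
  "alpha \<tau> \<sigma> lam k = (cmod (\<tau> - \<sigma> k))\<^sup>2 / (2 * \<bar>lam k\<bar>)"

definition p0 :: "complex \<Rightarrow> nat \<Rightarrow> (nat \<Rightarrow> complex) \<Rightarrow> (nat \<Rightarrow> real) \<Rightarrow> complex \<Rightarrow> complex" where
  "p0 \<tau> n \<sigma> lam z = (\<Sum>k=1..n. of_real (alpha \<tau> \<sigma> lam k) * ((\<sigma> k + z) / (\<sigma> k - z)))"

definition Zset :: "complex \<Rightarrow> nat \<Rightarrow> (nat \<Rightarrow> complex) \<Rightarrow> (nat \<Rightarrow> real) \<Rightarrow> complex set" where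
  "Zset \<tau> n \<sigma> lam =
     {\<zeta>. cmod ((2 / \<tau> * of_real (\<Sum>k=1..n. alpha \<tau> \<sigma> lam k)) * \<zeta> - 1) \<le> 1}"

definition ell :: "complex \<Rightarrow> nat \<Rightarrow> (nat \<Rightarrow> complex) \<Rightarrow> (nat \<Rightarrow> real) \<Rightarrow> complex \<Rightarrow> complex" where
  "ell \<tau> n \<sigma> lam \<zeta> = \<tau> / \<zeta> - of_real (\<Sum>k=1..n. alpha \<tau> \<sigma> lam k)"

definition acen :: "complex \<Rightarrow> nat \<Rightarrow> (nat \<Rightarrow> complex) \<Rightarrow> (nat \<Rightarrow> real) \<Rightarrow> complex \<Rightarrow> complex" where
  "acen \<tau> n \<sigma> lam \<zeta> =
     of_real ((1 + (cmod \<tau>)\<^sup>2) / (1 - (cmod \<tau>)\<^sup>2) * Re (ell \<tau> n \<sigma> lam \<zeta>))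
     + \<i> * of_real (Im (ell \<tau> n \<sigma> lam \<zeta>)) + p0 \<tau> n \<sigma> lam \<tau>"

text \<open>Omega_zeta for zeta ~= 0 (omega ranges over nonzero complex numbers, since 1/omega
  must be defined), and Omega_0 = {0}.\<close>

definition Omega :: "complex \<Rightarrow> nat \<Rightarrow> (nat \<Rightarrow> complex) \<Rightarrow> (nat \<Rightarrow> real) \<Rightarrow> complex \<Rightarrow> complex set" where
  "Omega \<tau> n \<sigma> lam \<zeta> =
     (if \<zeta> = 0 then {0}
      else {\<omega>. \<omega> \<noteq> 0 \<and>
             cmod (of_real (1 - (cmod \<tau>)\<^sup>2) / \<omega> - acen \<tau> n \<sigma> lam \<zeta>)
               \<le> 2 * cmod \<tau> / (1 - (cmod \<tau>)\<^sup>2) * Re (ell \<tau> n \<sigma> lam \<zeta>)})"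

end

theory Submission
  imports Defs "HOL-Complex_Analysis.Complex_Analysis"
begin

text \<open>By the Berkson--Porta formula a generator with interior fixed point \<open>\<tau>\<close> is
  \<open>G z = (\<tau> - z) (1 - cnj \<tau> z) / f z\<close> with \<open>Re f \<ge> 0\<close>. Differentiating Julia's inequality for
  \<open>\<phi>\<^sub>t\<close> at \<open>t = 0\<close> shows that the bound \<open>\<lambda>\<^sub>k\<close> on the spectral value at \<open>\<sigma>\<^sub>k\<close> forces a simple pole of \<open>f\<close> there
  with mass at least \<open>\<alpha>\<^sub>k\<close>, so that \<open>f = p\<^sub>0 + q\<close> with \<open>Re q \<ge> 0\<close>. Then \<open>\<tau> / G(0) = \<Sum>\<^sub>k \<alpha>\<^sub>k + q(0)\<close> and
  \<open>(1 - |\<tau>|\<^sup>2) / \<lambda>(G) = p\<^sub>0(\<tau>) + q(\<tau>)\<close>, and the region is the Schwarz--Pick disk of values \<open>q(\<tau>)\<close> for given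
  \<open>q(0)\<close>; boundary values force the extremal functions \<open>q\<close>. Conversely, every point of the region is attained
  by a rational \<open>q\<close>, for which the semigroup is obtained by solving \<open>u' = G u\<close>; a limit of \<open>G w / (w - \<sigma>)\<close> at
  a boundary point \<open>\<sigma>\<close> gives the multiplier of the flow there.\<close>

section \<open>Schwarz--Pick and Julia inequalities in the half-plane\<close>

text \<open>Most estimates come from one source, the two-point Pick inequality for functions with
  nonnegative real part. With one point sent radially to the circle it becomes Julia's inequality
  and detects poles; with one point at 0 it gives Harnack bounds and the disk of values; where its
  right side vanishes it gives rigidity. It takes the place of a Herglotz measure: the mass of a
  pole is only ever encoded as a lower bound of a real part by a multiple of a Poisson kernel. For
  attainment, remainders whose Cayley transform, normalised at 0, is \<open>c z\<close> with
  \<open>|c| \<le> 1\<close> realise every admissible pair \<open>(q 0, q \<tau>)\<close>. The flow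
  of such a field lives for all time because pseudo-hyperbolic disks about \<open>\<tau>\<close> are
  invariant. The delicate point of the region is \<open>(0, 0)\<close>: \<open>Omega\<close> is
  described through \<open>1 / \<omega>\<close> and \<open>ell\<close> through
  \<open>1 / \<zeta>\<close>, so the defining inequalities say nothing there. A Harnack bound of the
  spectral value by \<open>(6 / |\<tau>|) |G 0|\<close> controls this corner and makes the region
  closed, so that its boundary points are attained at all.\<close>

lemma cmod_one_minus_cnj_mult:
  "(cmod (1 - cnj a * b))\<^sup>2 = (cmod (a - b))\<^sup>2 + (1 - (cmod a)\<^sup>2) * (1 - (cmod b)\<^sup>2)"
  by (simp add: cmod_power2) algebra

lemma one_minus_cnj_mult_nonzero:
  assumes "cmod a < 1" "cmod b \<le> 1"
  shows "1 - cnj a * b \<noteq> 0"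
proof
  assume "1 - cnj a * b = 0"
  then have "cmod (cnj a * b) = 1" by (simp add: algebra_simps)
  moreover have "cmod a * cmod b \<le> cmod a * 1"
    using assms by (intro mult_left_mono) auto
  ultimately show False using assms by (simp add: norm_mult)
qed

lemma cmod_square_less_one: "cmod z < 1 \<Longrightarrow> (cmod z)\<^sup>2 < 1"
  by (simp add: power_less_one_iff)

text \<open>Composing with the disk automorphisms that move \<open>w\<close> and \<open>f w\<close>
  to 0 reduces this to the Schwarz lemma.\<close>

lemma Schwarz_Pick:
  assumes holf: "f holomorphic_on ball 0 1" and im: "f ` ball 0 1 \<subseteq> ball 0 1"
    and z: "cmod z < 1" and w: "cmod w < 1"
  shows "cmod (Moebius_function 0 (f w) (f z)) \<le> cmod (Moebius_function 0 w z)"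
proof -
  have fin: "cmod (f u) < 1" if "cmod u < 1" for u
    using im that by (auto simp: image_subset_iff)
  define g where "g = Moebius_function 0 (f w) \<circ> (f \<circ> Moebius_function 0 (-w))"
  have Min: "cmod (Moebius_function 0 (-w) u) < 1" if "cmod u < 1" for u
    using that w by (intro Moebius_function_norm_lt_1) auto
  have holM: "Moebius_function 0 (-w) holomorphic_on ball 0 1"
    using w by (intro Moebius_function_holomorphic) auto
  have hol1: "f \<circ> Moebius_function 0 (-w) holomorphic_on ball 0 1"
    by (rule holomorphic_on_compose_gen[OF holM holf]) (use Min in auto)
  have holg: "g holomorphic_on ball 0 1"
    unfolding g_def
    by (rule holomorphic_on_compose_gen[OF hol1 Moebius_function_holomorphic])
       (use Min fin w in auto)
  have M0: "Moebius_function 0 (-w) 0 = w"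
    by (simp add: Moebius_function_of_zero)
  have g0: "g 0 = 0"
    by (simp add: g_def M0 Moebius_function_eq_zero)
  have gin: "cmod (g u) < 1" if "cmod u < 1" for u
    unfolding g_def o_def
    by (intro Moebius_function_norm_lt_1 fin Min w that)
  define u where "u = Moebius_function 0 w z"
  have u: "cmod u < 1"
    unfolding u_def using w z by (intro Moebius_function_norm_lt_1)
  have "Moebius_function 0 (-w) u = z"
    unfolding u_def using w z by (intro Moebius_function_compose) auto
  then have "g u = Moebius_function 0 (f w) (f z)"
    by (simp add: g_def)
  then show ?thesis
    using Schwarz_Lemma(1)[OF holg g0 gin u] by (simp add: u_def)
qed

lemma one_minus_Moebius_square:
  assumes "cmod w < 1" "cmod z < 1"
  shows "1 - (cmod (Moebius_function 0 w z))\<^sup>2 =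
    (1 - (cmod w)\<^sup>2) * (1 - (cmod z)\<^sup>2) / (cmod (1 - cnj w * z))\<^sup>2"
proof -
  have "cmod (1 - cnj w * z) \<noteq> 0"
    using one_minus_cnj_mult_nonzero[of w z] assms by auto
  then have "1 - (cmod (Moebius_function 0 w z))\<^sup>2 =
      ((cmod (1 - cnj w * z))\<^sup>2 - (cmod (z - w))\<^sup>2) / (cmod (1 - cnj w * z))\<^sup>2"
    unfolding Moebius_function_simple norm_divide power_divide by (simp add: diff_divide_distrib)
  then show ?thesis
    by (simp add: cmod_one_minus_cnj_mult norm_minus_commute[of z w])
qed

text \<open>Cleared of denominators, so that \<open>w\<close> can be sent to the circle: both sides
  then tend to 0 and are compared after division by \<open>1 - |w|\<close>.\<close>

lemma Schwarz_Pick_mult: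
  assumes holf: "f holomorphic_on ball 0 1" and im: "f ` ball 0 1 \<subseteq> ball 0 1"
    and z: "cmod z < 1" and w: "cmod w < 1"
  shows "(1 - (cmod w)\<^sup>2) * (1 - (cmod z)\<^sup>2) * (cmod (1 - cnj (f w) * f z))\<^sup>2 \<le>
         (1 - (cmod (f w))\<^sup>2) * (1 - (cmod (f z))\<^sup>2) * (cmod (1 - cnj w * z))\<^sup>2"
proof -
  have fin: "cmod (f z) < 1" "cmod (f w) < 1"
    using im z w by (auto simp: image_subset_iff)
  have pos: "0 < (cmod (1 - cnj (f w) * f z))\<^sup>2" "0 < (cmod (1 - cnj w * z))\<^sup>2"
    using one_minus_cnj_mult_nonzero fin z w by auto
  have "(cmod (Moebius_function 0 (f w) (f z)))\<^sup>2 \<le> (cmod (Moebius_function 0 w z))\<^sup>2"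
    using Schwarz_Pick[OF assms] by (intro power_mono) auto
  then have "1 - (cmod (Moebius_function 0 w z))\<^sup>2 \<le> 1 - (cmod (Moebius_function 0 (f w) (f z)))\<^sup>2"
    by simp
  then have "(1 - (cmod w)\<^sup>2) * (1 - (cmod z)\<^sup>2) / (cmod (1 - cnj w * z))\<^sup>2 \<le>
      (1 - (cmod (f w))\<^sup>2) * (1 - (cmod (f z))\<^sup>2) / (cmod (1 - cnj (f w) * f z))\<^sup>2"
    using fin z w by (simp only: one_minus_Moebius_square)
  then show ?thesis
    using pos by (simp add: divide_simps)
qed

text \<open>This is the nonnegativity of the determinant of the 2 x 2 Pick matrix with entries
  \<open>(p u + cnj (p v)) / (1 - cnj v * u)\<close>. It is Schwarz--Pick for the Cayley transform
  \<open>f\<close> of \<open>p\<close>: \<open>key\<close> and \<open>cross\<close> translate the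
  terms, and the factors \<open>|p + 1|^2\<close> cancel.\<close>

lemma Pick_half_plane_strict:
  assumes holp: "p holomorphic_on ball 0 1" and pos: "\<And>z. cmod z < 1 \<Longrightarrow> 0 < Re (p z)"
    and z: "cmod z < 1" and w: "cmod w < 1"
  shows "(1 - (cmod w)\<^sup>2) * (1 - (cmod z)\<^sup>2) * (cmod (p z + cnj (p w)))\<^sup>2 \<le>
         4 * Re (p w) * Re (p z) * (cmod (1 - cnj w * z))\<^sup>2"
proof -
  define f where "f = (\<lambda>u. (p u - 1) / (p u + 1))"
  have nz: "p u + 1 \<noteq> 0" if "cmod u < 1" for u
    using pos[OF that] by (metis add.commute add_eq_0_iff less_numeral_extra(1) minus_complex.sel(1) 
        not_less_iff_gr_or_eq one_complex.sel(1) order.strict_trans uminus_complex.sel(1) neg_0_less_iff_less)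
  have key: "1 - (cmod (f u))\<^sup>2 = 4 * Re (p u) / (cmod (p u + 1))\<^sup>2" if "cmod u < 1" for u
  proof -
    have "(cmod (p u + 1))\<^sup>2 \<noteq> 0" using nz[OF that] by auto
    moreover have "(cmod (p u + 1))\<^sup>2 - (cmod (p u - 1))\<^sup>2 = 4 * Re (p u)"
      by (simp add: cmod_power2) algebra
    ultimately show ?thesis
      by (simp add: f_def norm_divide power_divide divide_simps)
  qed
  have fin: "cmod (f u) < 1" if "cmod u < 1" for u
  proof -
    have "0 < 1 - (cmod (f u))\<^sup>2"
      unfolding key[OF that] using pos[OF that] nz[OF that] by auto
    then show ?thesis by (simp add: power_less_one_iff)
  qed
  have holf: "f holomorphic_on ball 0 1"
    unfolding f_def using nz by (intro holomorphic_intros holp) auto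
  have cross: "1 - cnj (f w) * f z = 2 * (p z + cnj (p w)) / (cnj (p w + 1) * (p z + 1))"
  proof -
    have "cnj (p w) + 1 \<noteq> 0" using nz[OF w] by (metis complex_cnj_add complex_cnj_one complex_cnj_zero_iff)
    then show ?thesis using nz[OF z]
      by (simp add: f_def divide_simps) (simp add: algebra_simps)
  qed
  have "(1 - (cmod w)\<^sup>2) * (1 - (cmod z)\<^sup>2) * (cmod (1 - cnj (f w) * f z))\<^sup>2 \<le>
         (1 - (cmod (f w))\<^sup>2) * (1 - (cmod (f z))\<^sup>2) * (cmod (1 - cnj w * z))\<^sup>2"
    by (rule Schwarz_Pick_mult[OF holf _ z w]) (use fin in auto)
  moreover have "(cmod (1 - cnj (f w) * f z))\<^sup>2 =
      4 * (cmod (p z + cnj (p w)))\<^sup>2 / ((cmod (p w + 1))\<^sup>2 * (cmod (p z + 1))\<^sup>2)"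
    unfolding cross norm_divide norm_mult power_divide power_mult_distrib complex_mod_cnj by simp
  moreover have "0 < (cmod (p w + 1))\<^sup>2 * (cmod (p z + 1))\<^sup>2"
    using nz z w by auto
  moreover have "A * X \<le> 4 * a * b * D"
    if "A * (4 * X / (P * Q)) \<le> 4 * a / P * (4 * b / Q) * D" "0 < P * Q" for A X P Q a b D :: real
  proof -
    have "4 * (A * X) / (P * Q) \<le> 4 * (4 * a * b * D) / (P * Q)"
      using that(1) by (simp add: mult_ac)
    then show ?thesis
      using that(2) by (simp add: divide_le_cancel mult_ac)
  qed
  ultimately show ?thesis
    using z w by (simp only: key)
qed

text \<open>Adding a small \<open>e > 0\<close> restores strict positivity. Remainders need the
  closed version, since over the boundary circle of \<open>Zset\<close> they are imaginary
  constants.\<close>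

lemma Pick_half_plane:
  assumes holp: "p holomorphic_on ball 0 1" and pos: "\<And>z. cmod z < 1 \<Longrightarrow> 0 \<le> Re (p z)"
    and z: "cmod z < 1" and w: "cmod w < 1"
  shows "(1 - (cmod w)\<^sup>2) * (1 - (cmod z)\<^sup>2) * (cmod (p z + cnj (p w)))\<^sup>2 \<le>
         4 * Re (p w) * Re (p z) * (cmod (1 - cnj w * z))\<^sup>2"
proof -
  let ?L = "\<lambda>e. (1 - (cmod w)\<^sup>2) * (1 - (cmod z)\<^sup>2) * (cmod ((p z + complex_of_real e) + cnj (p w + of_real e)))\<^sup>2"
  let ?R = "\<lambda>e. 4 * Re (p w + complex_of_real e) * Re (p z + of_real e) * (cmod (1 - cnj w * z))\<^sup>2"
  have le: "?L e \<le> ?R e" if "e > 0" for e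
    by (rule Pick_half_plane_strict[of "\<lambda>u. p u + of_real e"])
       (use that pos z w in \<open>auto intro!: holomorphic_intros holp add_nonneg_pos\<close>)
  have "(?L \<longlongrightarrow> ?L 0) (at_right 0)" "(?R \<longlongrightarrow> ?R 0) (at_right 0)"
    by (intro tendsto_intros)+
  moreover have "\<forall>\<^sub>F e in at_right 0. ?L e \<le> ?R e"
    using eventually_at_right_less[of 0] by eventually_elim (rule le)
  ultimately have "?L 0 \<le> ?R 0"
    by (intro tendsto_le[OF trivial_limit_at_right_real])
  then show ?thesis by simp
qed

lemma pos_mult_cmod_square_le_0:
  "0 < d \<Longrightarrow> d * (cmod a)\<^sup>2 \<le> 0 \<Longrightarrow> a = 0"
  by (simp add: mult_le_0_iff)

text \<open>At a zero \<open>w\<close> the right side of the Pick inequality vanishes, hence so does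
  the left; this does the work of the open mapping theorem.\<close>

lemma half_plane_zero_imp_zero:
  assumes "p holomorphic_on ball 0 1" "\<And>z. cmod z < 1 \<Longrightarrow> 0 \<le> Re (p z)"
    and w: "cmod w < 1" "p w = 0" and z: "cmod z < 1"
  shows "p z = 0"
proof -
  have "(1 - (cmod w)\<^sup>2) * (1 - (cmod z)\<^sup>2) * (cmod (p z))\<^sup>2 \<le> 0"
    using Pick_half_plane[OF assms(1,2) z w(1)] w by simp
  moreover have "0 < (1 - (cmod w)\<^sup>2) * (1 - (cmod z)\<^sup>2)"
    using cmod_square_less_one w z by simp
  ultimately show ?thesis
    by (intro pos_mult_cmod_square_le_0)
qed

lemma half_plane_Re_pos:
  assumes "p holomorphic_on ball 0 1" "\<And>z. cmod z < 1 \<Longrightarrow> 0 \<le> Re (p z)"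
    and w: "cmod w < 1" "0 < Re (p w)" and z: "cmod z < 1"
  shows "0 < Re (p z)"
proof (rule ccontr)
  assume "\<not> 0 < Re (p z)"
  then have 0: "Re (p z) = 0" using assms(2)[OF z] by simp
  have "(1 - (cmod w)\<^sup>2) * (1 - (cmod z)\<^sup>2) * (cmod (p z + cnj (p w)))\<^sup>2 \<le> 0"
    using Pick_half_plane[OF assms(1,2) z w(1)] 0 by simp
  moreover have "0 < (1 - (cmod w)\<^sup>2) * (1 - (cmod z)\<^sup>2)"
    using cmod_square_less_one w z by simp
  ultimately have "p z + cnj (p w) = 0"
    by (intro pos_mult_cmod_square_le_0)
  then have "Re (p z + cnj (p w)) = 0" by simp
  then have "Re (p z) + Re (p w) = 0" by simp
  then show False using 0 w by simp
qed

text \<open>The constant 6 improves itself: if \<open>6 |b| < |a| d\<close>, then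
  \<open>|a| - |b| \<ge> (5/6) |a|\<close>, and the hypothesis yields
  \<open>|a| d \<le> (144/25) |b|\<close>, which is at most \<open>6 |b|\<close>.\<close>

lemma Harnack_arith:
  fixes a b :: complex and d :: real
  assumes "d * (cmod (a + cnj b))\<^sup>2 \<le> 4 * Re b * Re a" "0 < d" "d \<le> 1" "0 \<le> Re a" "0 \<le> Re b"
  shows "cmod a * d \<le> 6 * cmod b"
proof -
  have tri: "cmod a \<le> cmod (a + cnj b) + cmod b"
    using norm_triangle_ineq4[of "a + cnj b" "cnj b"] by simp
  have "4 * Re b * Re a \<le> 4 * cmod b * cmod a"
    using assms complex_Re_le_cmod by (intro mult_mono) auto
  with assms(1) have le: "d * (cmod (a + cnj b))\<^sup>2 \<le> 4 * cmod b * cmod a" by linarith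
  show ?thesis
  proof (rule ccontr)
    assume "\<not> ?thesis"
    then have gt: "6 * cmod b < cmod a * d" by simp
    have ad: "cmod a * d \<le> cmod a" using assms(2,3) by (intro mult_left_le) auto
    define X where "X = cmod a" define Y where "Y = cmod b"
    have XY: "0 \<le> Y" "6 * Y < X * d" "X * d \<le> X"
      using gt ad by (auto simp: X_def Y_def)
    have "X - Y \<le> cmod (a + cnj b)" using tri by (simp add: X_def Y_def)
    then have "(X - Y)\<^sup>2 \<le> (cmod (a + cnj b))\<^sup>2"
      using XY by (intro power_mono) auto
    then have "d * (X - Y)\<^sup>2 \<le> d * (cmod (a + cnj b))\<^sup>2"
      using assms by (intro mult_left_mono) auto
    then have 1: "d * (X - Y)\<^sup>2 \<le> 4 * Y * X" using le by (simp add: X_def Y_def)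
    have "5/6 * X \<le> X - Y" using XY by simp
    then have "(5/6 * X)\<^sup>2 \<le> (X - Y)\<^sup>2" using XY by (intro power_mono) auto
    then have "d * (5/6 * X)\<^sup>2 \<le> d * (X - Y)\<^sup>2"
      using assms by (intro mult_left_mono) auto
    with 1 have "X * (25/36 * (X * d)) \<le> X * (4 * Y)"
      by (simp add: power2_eq_square algebra_simps)
    moreover have "0 < X" using XY by linarith
    ultimately have "25/36 * (X * d) \<le> 4 * Y" by simp
    then show False using XY by linarith
  qed
qed

text \<open>Pick's inequality with one point at 0, used both ways: the first bound limits growth
  towards the circle, the second limits decay.\<close>

lemma Harnack_half_plane:
  assumes "p holomorphic_on ball 0 1" "\<And>z. cmod z < 1 \<Longrightarrow> 0 \<le> Re (p z)" and z: "cmod z < 1"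
  shows "cmod (p z) * (1 - (cmod z)\<^sup>2) \<le> 6 * cmod (p 0)"
    and "cmod (p 0) * (1 - (cmod z)\<^sup>2) \<le> 6 * cmod (p z)"
proof -
  have d: "0 < 1 - (cmod z)\<^sup>2" "1 - (cmod z)\<^sup>2 \<le> 1"
    using cmod_square_less_one[OF z] by auto
  show "cmod (p z) * (1 - (cmod z)\<^sup>2) \<le> 6 * cmod (p 0)"
    using Pick_half_plane[OF assms(1,2) z, of 0] d assms
    by (intro Harnack_arith) auto
  show "cmod (p 0) * (1 - (cmod z)\<^sup>2) \<le> 6 * cmod (p z)"
    using Pick_half_plane[OF assms(1,2) _ z, of 0] d assms
    by (intro Harnack_arith) auto
qed

lemma cmod_one_minus_cnj_unit:
  assumes "cmod s = 1" shows "cmod (1 - cnj s * z) = cmod (s - z)"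
proof -
  have "s * (1 - cnj s * z) = s - z"
    using assms complex_norm_square[of s] by (simp add: algebra_simps)
  then show ?thesis using assms by (metis mult_1 norm_mult)
qed

lemma tendsto_radius: "((\<lambda>r. complex_of_real r * s) \<longlongrightarrow> s) (at_left 1)"
proof -
  have "((\<lambda>r. complex_of_real r * s) \<longlongrightarrow> complex_of_real 1 * s) (at_left 1)"
    by (intro tendsto_intros)
  then show ?thesis by simp
qed

lemma minus_radius: "s - complex_of_real r * s = of_real (1 - r) * s"
  by (simp add: algebra_simps)

text \<open>Pick's inequality at \<open>w = r s\<close>, divided by \<open>1 - r\<close>: the factor
  \<open>1 - r^2\<close> on the left and the assumed bound on \<open>Re p\<close> on the right each
  supply one such factor. The bound is a convergent \<open>c r\<close> instead of a constant so that
  it can absorb the lower-order errors of the later estimates.\<close>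

lemma Julia_half_plane:
  assumes holp: "p holomorphic_on ball 0 1" and pos: "\<And>z. cmod z < 1 \<Longrightarrow> 0 \<le> Re (p z)"
    and s: "cmod s = 1"
    and lim: "((\<lambda>r. p (of_real r * s)) \<longlongrightarrow> 0) (at_left 1)"
    and c: "(c \<longlongrightarrow> c0) (at_left 1)"
    and le: "\<forall>\<^sub>F r in at_left 1. Re (p (of_real r * s)) \<le> (1 - r) * c r"
    and z: "cmod z < 1"
  shows "(1 - (cmod z)\<^sup>2) * (cmod (p z))\<^sup>2 \<le> 2 * c0 * Re (p z) * (cmod (s - z))\<^sup>2"
proof -
  let ?w = "\<lambda>r. of_real r * s"
  let ?L = "\<lambda>r. (1 + r) * (1 - (cmod z)\<^sup>2) * (cmod (p z + cnj (p (?w r))))\<^sup>2"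
  let ?R = "\<lambda>r. 4 * c r * Re (p z) * (cmod (1 - cnj (?w r) * z))\<^sup>2"
  have "\<forall>\<^sub>F r in at_left (1::real). r \<in> {0<..<1}"
    by (rule eventually_at_leftI[of 0]) auto
  then have ev: "\<forall>\<^sub>F r in at_left 1. ?L r \<le> ?R r"
    using le
  proof eventually_elim
    case (elim r)
    have w: "cmod (?w r) < 1" "(cmod (?w r))\<^sup>2 = r\<^sup>2"
      using elim s by (auto simp: norm_mult power_mult_distrib)
    have "(1 - r) * ?L r \<le> 4 * Re (p (?w r)) * Re (p z) * (cmod (1 - cnj (?w r) * z))\<^sup>2"
      using Pick_half_plane[OF holp pos z w(1)] unfolding w(2)
      by (simp add: power2_eq_square algebra_simps)
    also have "\<dots> \<le> 4 * ((1 - r) * c r) * Re (p z) * (cmod (1 - cnj (?w r) * z))\<^sup>2"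
      using elim pos[OF z] by (intro mult_right_mono) auto
    also have "\<dots> = (1 - r) * ?R r" by simp
    finally show ?case using elim by simp
  qed
  have "(?L \<longlongrightarrow> (1 + 1) * (1 - (cmod z)\<^sup>2) * (cmod (p z + cnj 0))\<^sup>2) (at_left 1)"
    by (intro tendsto_intros lim)
  moreover have "(?R \<longlongrightarrow> 4 * c0 * Re (p z) * (cmod (1 - cnj (of_real 1 * s) * z))\<^sup>2) (at_left 1)"
    by (intro tendsto_intros c)
  ultimately have "(1 + 1) * (1 - (cmod z)\<^sup>2) * (cmod (p z + cnj 0))\<^sup>2 \<le>
      4 * c0 * Re (p z) * (cmod (1 - cnj (of_real 1 * s) * z))\<^sup>2"
    by (intro tendsto_le[OF _ _ _ ev]) auto
  then show ?thesis
    by (simp add: cmod_one_minus_cnj_unit[OF s]) (simp add: algebra_simps)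
qed

section \<open>Inequalities for generators\<close>

lemma right_derivative_nonpos:
  assumes "(f has_real_derivative D) (at a within {a..})" and "\<And>t. a \<le> t \<Longrightarrow> f t \<le> f a"
  shows "D \<le> 0"
proof (rule tendsto_upperbound)
  show "((\<lambda>t. (f t - f a) / (t - a)) \<longlongrightarrow> D) (at a within {a..})"
    using assms(1) by (simp add: has_field_derivative_iff)
  show "\<forall>\<^sub>F t in at a within {a..}. (f t - f a) / (t - a) \<le> 0"
    using assms(2) by (auto simp: eventually_at_filter intro!: always_eventually divide_nonpos_nonneg)
  show "at a within {a..} \<noteq> bot"
    by (simp add: at_within_Ici_at_right)
qed

lemma Re_of_real_mult: "Re (of_real a * z) = a * Re z"
  by simp

lemma has_real_derivative_Re:
  "(f has_vector_derivative f') F \<Longrightarrow> ((\<lambda>t. Re (f t)) has_real_derivative Re f') F"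
  unfolding has_real_derivative_iff_has_vector_derivative
  by (rule bounded_linear.has_vector_derivative[OF bounded_linear_Re])

lemma has_real_derivative_Im:
  "(f has_vector_derivative f') F \<Longrightarrow> ((\<lambda>t. Im (f t)) has_real_derivative Im f') F"
  unfolding has_real_derivative_iff_has_vector_derivative
  by (rule bounded_linear.has_vector_derivative[OF bounded_linear_Im])

lemma has_real_derivative_cmod_square:
  assumes "(f has_vector_derivative f') (at t within S)"
  shows "((\<lambda>t. (cmod (f t))\<^sup>2) has_real_derivative 2 * Re (cnj (f t) * f')) (at t within S)"
  unfolding cmod_power2
  by (rule derivative_eq_intros has_real_derivative_Re[OF assms] has_real_derivative_Im[OF assms] refl)+ simp

lemma Moebius_function_has_derivative:
  assumes "cmod w < 1" "cmod z < 1"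
  shows "(Moebius_function 0 w has_field_derivative
    of_real (1 - (cmod w)\<^sup>2) / (1 - cnj w * z)\<^sup>2) (at z within S)"
proof -
  have nz: "1 - cnj w * z \<noteq> 0"
    using one_minus_cnj_mult_nonzero[of w z] assms by auto
  have eq: "(1 - cnj w * z) - (z - w) * (- cnj w) = of_real (1 - (cmod w)\<^sup>2)"
    unfolding of_real_diff complex_norm_square by (simp add: algebra_simps)
  show ?thesis
    unfolding Moebius_function_simple[abs_def]
    by (rule derivative_eq_intros refl nz)+
       (use eq in \<open>simp add: power2_eq_square\<close>)
qed

text \<open>For a trajectory in Berkson--Porta form, the sign of \<open>Re P\<close> decides whether
  the pseudo-hyperbolic distance to \<open>w\<close> decreases. It is read in both directions:
  monotonicity gives the sign for a given semigroup, and the sign gives monotonicity when the flow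
  is constructed.\<close>

lemma has_derivative_cmod_Moebius_square:
  assumes u: "(u has_vector_derivative (w - u t) * (1 - cnj w * u t) * P) (at t within S)"
    and w: "cmod w < 1" and ut: "cmod (u t) < 1"
  shows "((\<lambda>s. (cmod (Moebius_function 0 w (u s)))\<^sup>2) has_real_derivative
      - 2 * (1 - (cmod w)\<^sup>2) * (cmod (Moebius_function 0 w (u t)))\<^sup>2 * Re P) (at t within S)"
proof -
  define d where "d = 1 - cnj w * u t"
  define T where "T = Moebius_function 0 w (u t)"
  have nz: "d \<noteq> 0"
    using one_minus_cnj_mult_nonzero[of w "u t"] w ut by (auto simp: d_def)
  let ?D = "((w - u t) * (1 - cnj w * u t) * P) * (of_real (1 - (cmod w)\<^sup>2) / (1 - cnj w * u t)\<^sup>2)"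
  have D: "((Moebius_function 0 w \<circ> u) has_vector_derivative ?D) (at t within S)"
    by (rule field_vector_diff_chain_within[OF u Moebius_function_has_derivative[OF w ut]])
  have "?D = - of_real (1 - (cmod w)\<^sup>2) * T * P"
    using nz by (simp add: T_def Moebius_function_simple d_def[symmetric] power2_eq_square field_simps)
  moreover have "cnj T * (- of_real (1 - (cmod w)\<^sup>2) * T * P) = of_real (- (1 - (cmod w)\<^sup>2) * (cmod T)\<^sup>2) * P"
    by (simp only: of_real_mult of_real_minus complex_norm_square mult_ac)
  ultimately have "Re (cnj T * ?D) = - (1 - (cmod w)\<^sup>2) * (cmod T)\<^sup>2 * Re P"
    by (simp only: Re_of_real_mult)
  then have "2 * Re (cnj ((Moebius_function 0 w \<circ> u) t) * ?D) = - 2 * (1 - (cmod w)\<^sup>2) * (cmod T)\<^sup>2 * Re P"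
    unfolding o_apply T_def[symmetric] by linarith
  with has_real_derivative_cmod_square[OF D] show ?thesis
    by (simp only: T_def o_apply)
qed

lemma generator_initial_derivative:
  assumes "is_semigroup \<phi>" "is_generator \<phi> G" "cmod z < 1"
  shows "((\<lambda>s. \<phi> s z) has_vector_derivative G z) (at 0 within {0..})"
  using assms unfolding is_semigroup_def is_generator_def by force

lemma semigroup_in_ball:
  "is_semigroup \<phi> \<Longrightarrow> 0 \<le> t \<Longrightarrow> cmod z < 1 \<Longrightarrow> cmod (\<phi> t z) < 1"
  unfolding is_semigroup_def by (auto simp: image_subset_iff)

text \<open>By Schwarz--Pick the pseudo-hyperbolic distance from \<open>\<phi> t z\<close> to the
  fixed point never exceeds its initial value, so the right derivative of its square at
  \<open>t = 0\<close> is nonpositive; for \<open>z \<noteq> \<tau>\<close> that derivative is a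
  negative multiple of \<open>Re (p z)\<close>. This \<open>p\<close> is the reciprocal of the
  \<open>f\<close> of the overview.\<close>

lemma Berkson_Porta_interior:
  assumes sg: "is_semigroup \<phi>" and gen: "is_generator \<phi> G"
    and fx: "\<And>t. 0 \<le> t \<Longrightarrow> \<phi> t \<tau> = \<tau>" and \<tau>: "cmod \<tau> < 1"
  obtains p where "p holomorphic_on ball 0 1" "\<And>z. cmod z < 1 \<Longrightarrow> 0 \<le> Re (p z)"
    "\<And>z. cmod z < 1 \<Longrightarrow> G z = (\<tau> - z) * (1 - cnj \<tau> * z) * p z"
proof -
  have \<phi>0: "\<phi> 0 z = z" if "cmod z < 1" for z
    using sg that by (auto simp: is_semigroup_def)
  have holG: "G holomorphic_on ball 0 1"
    using gen by (simp add: is_generator_def)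
  have G\<tau>: "G \<tau> = 0"
  proof (rule vector_derivative_unique_within)
    show "at (0::real) within {0..} \<noteq> bot"
      by (simp add: at_within_Ici_at_right)
    show "((\<lambda>s. \<phi> s \<tau>) has_vector_derivative G \<tau>) (at 0 within {0..})"
      by (rule generator_initial_derivative[OF sg gen \<tau>])
    show "((\<lambda>s. \<phi> s \<tau>) has_vector_derivative 0) (at 0 within {0..})"
      by (rule has_vector_derivative_transform[OF _ _ has_vector_derivative_const[of \<tau>]])
         (use fx in auto)
  qed
  define g where "g = (\<lambda>z. if z = \<tau> then deriv G \<tau> else G z / (z - \<tau>))"
  have holg: "g holomorphic_on ball 0 1"
    by (rule pole_theorem_open_0[OF holG open_ball, of \<tau>]) (auto simp: g_def G\<tau>)
  define p where "p = (\<lambda>z. - g z / (1 - cnj \<tau> * z))"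
  have nz: "1 - cnj \<tau> * z \<noteq> 0" if "cmod z < 1" for z
    using one_minus_cnj_mult_nonzero[of \<tau> z] \<tau> that by auto
  have holp: "p holomorphic_on ball 0 1"
    unfolding p_def using nz by (intro holomorphic_intros holg) auto
  have eq: "G z = (\<tau> - z) * (1 - cnj \<tau> * z) * p z" if "cmod z < 1" for z
    using nz[OF that] G\<tau> by (auto simp: p_def g_def divide_simps) (auto simp: algebra_simps)
  have pos: "0 \<le> Re (p z)" if z: "cmod z < 1" "z \<noteq> \<tau>" for z
  proof -
    let ?W = "\<lambda>s. (cmod (Moebius_function 0 \<tau> (\<phi> s z)))\<^sup>2"
    have "((\<lambda>s. \<phi> s z) has_vector_derivative (\<tau> - \<phi> 0 z) * (1 - cnj \<tau> * \<phi> 0 z) * p z) (at 0 within {0..})"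
      using generator_initial_derivative[OF sg gen z(1)] eq[OF z(1)] \<phi>0[OF z(1)] by simp
    then have "(?W has_real_derivative
        - 2 * (1 - (cmod \<tau>)\<^sup>2) * ?W 0 * Re (p z)) (at 0 within {0..})"
      by (rule has_derivative_cmod_Moebius_square) (use \<tau> \<phi>0 z in auto)
    moreover have "?W t \<le> ?W 0" if "0 \<le> t" for t
    proof (rule power_mono)
      show "cmod (Moebius_function 0 \<tau> (\<phi> t z)) \<le> cmod (Moebius_function 0 \<tau> (\<phi> 0 z))"
        using Schwarz_Pick[of "\<phi> t" z \<tau>] sg that z \<tau> fx[OF that] \<phi>0[OF z(1)]
        by (simp add: is_semigroup_def)
    qed auto
    ultimately have "- 2 * (1 - (cmod \<tau>)\<^sup>2) * ?W 0 * Re (p z) \<le> 0"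
      by (rule right_derivative_nonpos)
    moreover have "0 < 2 * (1 - (cmod \<tau>)\<^sup>2) * ?W 0"
      using z \<tau> nz[OF z(1)] cmod_square_less_one[OF \<tau>] \<phi>0[OF z(1)]
      by (auto simp: Moebius_function_simple)
    moreover have "0 \<le> x" if "- 2 * a * b * x \<le> 0" "0 < 2 * a * b" for a b x :: real
      using that mult_pos_neg[of "2 * a * b" x] by (intro leI notI) auto
    ultimately show ?thesis by blast
  qed
  \<comment> \<open>At \<open>\<tau>\<close> itself the distance is constantly 0 and carries no
    information, so the sign is inherited by continuity.\<close>
  have pos': "0 \<le> Re (p \<tau>)"
  proof (rule tendsto_lowerbound)
    have "isCont p \<tau>"
      using holp \<tau> by (metis centre_in_ball continuous_on_eq_continuous_at dist_0_norm
          holomorphic_on_imp_continuous_on mem_ball open_ball)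
    then show "((\<lambda>z. Re (p z)) \<longlongrightarrow> Re (p \<tau>)) (at \<tau>)"
      by (intro tendsto_Re) (simp add: isCont_def)
    have "\<forall>\<^sub>F z in at \<tau>. z \<in> ball 0 1"
      using \<tau> by (intro eventually_at_in_open') auto
    moreover have "\<forall>\<^sub>F z in at \<tau>. z \<noteq> \<tau>"
      by (simp add: eventually_at_filter)
    ultimately show "\<forall>\<^sub>F z in at \<tau>. 0 \<le> Re (p z)"
      by eventually_elim (use pos in auto)
  qed auto
  show ?thesis
    using that[OF holp _ eq] pos pos' by metis
qed

section \<open>Julia's inequality at a boundary fixed point\<close>

lemma Re_Cayley: "cmod s = 1 \<Longrightarrow> Re ((s + z) / (s - z)) = (1 - (cmod z)\<^sup>2) / (cmod (s - z))\<^sup>2"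
proof -
  assume s: "cmod s = 1"
  have "Re ((s + z) / (s - z)) = Re ((s + z) * cnj (s - z)) / (cmod (s - z))\<^sup>2"
    by (simp add: complex_div_cnj[of "s + z"] del: complex_cnj_diff)
  also have "Re ((s + z) * cnj (s - z)) = (cmod s)\<^sup>2 - (cmod z)\<^sup>2"
    by (simp add: cmod_power2) (simp add: power2_eq_square algebra_simps)
  finally show ?thesis using s by simp
qed

lemma eventually_at_left_1: "\<forall>\<^sub>F r in at_left (1::real). 0 < r \<and> r < 1"
  by (rule eventually_at_leftI[of 0]) auto

lemma angular_limit_imp_radial:
  assumes "angular_limit f s L" "cmod s = 1"
  shows "((\<lambda>r. f (of_real r * s)) \<longlongrightarrow> L) (at_left 1)"
proof (rule filterlim_compose[where g = f])
  \<comment> \<open>On the radius \<open>|s - z| = 1 - |z|\<close>, so the radius lies in every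
    Stolz angle with parameter above 1; 2 is one choice.\<close>
  show "(f \<longlongrightarrow> L) (at s within stolz_angle s 2)"
    using assms(1) by (simp add: angular_limit_def)
  show "filterlim (\<lambda>r. complex_of_real r * s) (at s within stolz_angle s 2) (at_left 1)"
    unfolding filterlim_at
  proof
    show "\<forall>\<^sub>F r in at_left 1. complex_of_real r * s \<in> stolz_angle s 2 \<and> complex_of_real r * s \<noteq> s"
      using eventually_at_left_1
    proof eventually_elim
      case (elim r)
      have "cmod (s - of_real r * s) = \<bar>1 - r\<bar> * cmod s"
        unfolding minus_radius norm_mult norm_of_real ..
      moreover have "s \<noteq> 0" using assms(2) by auto
      ultimately show ?case
        using elim assms(2) by (auto simp: stolz_angle_def norm_mult)
    qed
    show "((\<lambda>r. complex_of_real r * s) \<longlongrightarrow> s) (at_left 1)" by (rule tendsto_radius)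
  qed
qed

text \<open>In Schwarz--Pick at \<open>r s\<close> the defect \<open>1 - |f (r s)|^2\<close> is at
  most \<open>2 |f (r s) - s|\<close>, that is, \<open>2 (1 - r)\<close> times the modulus of the
  difference quotient. After division by \<open>1 - r\<close> the radial limit brings in the
  multiplier \<open>exp (- l * t)\<close>.\<close>

lemma BRFP_Julia:
  assumes sg: "is_semigroup \<phi>" and br: "BRFP_spectral \<phi> s l" and s: "cmod s = 1"
    and t: "0 \<le> t" and z: "cmod z < 1"
  shows "exp (l * t) * Re ((s + z) / (s - z)) \<le> Re ((s + \<phi> t z) / (s - \<phi> t z))"
proof -
  let ?f = "\<phi> t"
  let ?w = "\<lambda>r. complex_of_real r * s"
  have fin: "cmod (?f u) < 1" if "cmod u < 1" for u
    using semigroup_in_ball[OF sg t that] .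
  have lim1: "((\<lambda>r. ?f (?w r)) \<longlongrightarrow> s) (at_left 1)"
    using br t s by (intro angular_limit_imp_radial) (auto simp: BRFP_spectral_def)
  have lim2: "((\<lambda>r. (?f (?w r) - s) / (?w r - s)) \<longlongrightarrow> of_real (exp (- l * t))) (at_left 1)"
    using br t s
    by (intro angular_limit_imp_radial[of "\<lambda>z. (?f z - s) / (z - s)"]) (auto simp: BRFP_spectral_def)
  let ?L = "\<lambda>r. (1 + r) * (1 - (cmod z)\<^sup>2) * (cmod (1 - cnj (?f (?w r)) * ?f z))\<^sup>2"
  let ?R = "\<lambda>r. 2 * cmod ((?f (?w r) - s) / (?w r - s)) * (1 - (cmod (?f z))\<^sup>2) * (cmod (1 - cnj (?w r) * z))\<^sup>2"
  have ev: "\<forall>\<^sub>F r in at_left 1. ?L r \<le> ?R r"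
    using eventually_at_left_1
  proof eventually_elim
    case (elim r)
    have w: "cmod (?w r) < 1" "(cmod (?w r))\<^sup>2 = r\<^sup>2"
      using elim s by (auto simp: norm_mult power_mult_distrib)
    have "cmod (s - ?w r) = \<bar>1 - r\<bar> * cmod s"
      unfolding minus_radius norm_mult norm_of_real ..
    then have sw: "cmod (?w r - s) = 1 - r" using elim s by (simp add: norm_minus_commute)
    have "1 - (cmod (?f (?w r)))\<^sup>2 = (1 - cmod (?f (?w r))) * (1 + cmod (?f (?w r)))"
      by (simp add: power2_eq_square algebra_simps)
    also have "\<dots> \<le> (1 - cmod (?f (?w r))) * 2"
      using fin[OF w(1)] by (intro mult_left_mono) auto
    also have "\<dots> \<le> cmod (?f (?w r) - s) * 2"
      using norm_triangle_ineq2[of s "?f (?w r)"] s by (simp add: norm_minus_commute)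
    also have "\<dots> = (1 - r) * (2 * cmod ((?f (?w r) - s) / (?w r - s)))"
      using elim by (simp add: norm_divide sw)
    finally have le: "1 - (cmod (?f (?w r)))\<^sup>2 \<le> (1 - r) * (2 * cmod ((?f (?w r) - s) / (?w r - s)))" .
    have "(1 - r) * ?L r = (1 - (cmod (?w r))\<^sup>2) * (1 - (cmod z)\<^sup>2) * (cmod (1 - cnj (?f (?w r)) * ?f z))\<^sup>2"
      unfolding w(2) by (simp add: power2_eq_square algebra_simps)
    also have "\<dots> \<le> (1 - (cmod (?f (?w r)))\<^sup>2) * (1 - (cmod (?f z))\<^sup>2) * (cmod (1 - cnj (?w r) * z))\<^sup>2"
      using sg t w z by (intro Schwarz_Pick_mult) (auto simp: is_semigroup_def)
    also have "\<dots> \<le> (1 - r) * (2 * cmod ((?f (?w r) - s) / (?w r - s))) * (1 - (cmod (?f z))\<^sup>2) * (cmod (1 - cnj (?w r) * z))\<^sup>2"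
      using le cmod_square_less_one[OF fin[OF z]] by (intro mult_right_mono) auto
    also have "\<dots> = (1 - r) * ?R r" by simp
    finally show ?case using elim by simp
  qed
  have "(?L \<longlongrightarrow> (1 + 1) * (1 - (cmod z)\<^sup>2) * (cmod (1 - cnj s * ?f z))\<^sup>2) (at_left 1)"
    by (intro tendsto_intros lim1)
  moreover have "(?R \<longlongrightarrow> 2 * cmod (of_real (exp (- l * t))) * (1 - (cmod (?f z))\<^sup>2) *
      (cmod (1 - cnj (of_real 1 * s) * z))\<^sup>2) (at_left 1)"
    by (intro tendsto_intros lim2)
  ultimately have "(1 + 1) * (1 - (cmod z)\<^sup>2) * (cmod (1 - cnj s * ?f z))\<^sup>2 \<le>
      2 * cmod (of_real (exp (- l * t))) * (1 - (cmod (?f z))\<^sup>2) * (cmod (1 - cnj (of_real 1 * s) * z))\<^sup>2"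
    by (intro tendsto_le[OF _ _ _ ev]) auto
  then have main: "(1 - (cmod z)\<^sup>2) * (cmod (s - ?f z))\<^sup>2 \<le>
      exp (- l * t) * (1 - (cmod (?f z))\<^sup>2) * (cmod (s - z))\<^sup>2"
    by (simp add: cmod_one_minus_cnj_unit[OF s]) (simp add: algebra_simps)
  have "exp (l * t) * ((1 - (cmod z)\<^sup>2) * (cmod (s - ?f z))\<^sup>2) \<le>
      exp (l * t) * (exp (- l * t) * (1 - (cmod (?f z))\<^sup>2) * (cmod (s - z))\<^sup>2)"
    using main by (intro mult_left_mono) auto
  also have "\<dots> = (1 - (cmod (?f z))\<^sup>2) * (cmod (s - z))\<^sup>2"
    by (simp add: exp_minus)
  finally have "exp (l * t) * (1 - (cmod z)\<^sup>2) * (cmod (s - ?f z))\<^sup>2 \<le> (1 - (cmod (?f z))\<^sup>2) * (cmod (s - z))\<^sup>2"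
    by (simp add: mult.assoc)
  moreover have "0 < (cmod (s - ?f z))\<^sup>2" "0 < (cmod (s - z))\<^sup>2"
    using fin[OF z] z s by auto
  moreover have "e * (a / b) \<le> c / d" if "e * a * d \<le> c * b" "0 < d" "0 < b" for a b c d e :: real
    using that by (simp add: field_simps)
  ultimately show ?thesis
    unfolding Re_Cayley[OF s] by blast
qed

text \<open>Both sides of Julia's inequality agree at \<open>t = 0\<close>, so it passes to right
  derivatives; \<open>2 * s / (s - z)^2\<close> is the derivative of the Cayley kernel. Since the
  kernel has nonnegative real part, \<open>l\<close> may first be lowered to \<open>- m\<close>,
  which is how a bound on the spectral value replaces the value itself.\<close>

lemma generator_Julia:
  assumes sg: "is_semigroup \<phi>" and gen: "is_generator \<phi> G" and br: "BRFP_spectral \<phi> s l"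
    and s: "cmod s = 1" and m: "- m \<le> l" and z: "cmod z < 1"
  shows "0 \<le> Re (2 * s * G z / (s - z)\<^sup>2 + of_real m * ((s + z) / (s - z)))"
proof -
  have \<phi>0: "\<phi> 0 z = z"
    using sg z by (auto simp: is_semigroup_def)
  let ?C = "\<lambda>u. (s + u) / (s - u)"
  have sz: "s - z \<noteq> 0" using s z by auto
  have "(?C has_field_derivative ((s - z) - (s + z) * (- 1)) / ((s - z) * (s - z))) (at z within S)" for S
    by (rule derivative_eq_intros refl sz)+ simp
  then have dC: "(?C has_field_derivative 2 * s / (s - z)\<^sup>2) (at z within S)" for S
    by (simp add: power2_eq_square)
  have dphi: "((\<lambda>t. \<phi> t z) has_vector_derivative G z) (at 0 within {0..})"
    by (rule generator_initial_derivative[OF sg gen z])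
  have "((?C \<circ> (\<lambda>t. \<phi> t z)) has_vector_derivative G z * (2 * s / (s - z)\<^sup>2)) (at 0 within {0..})"
    by (rule field_vector_diff_chain_within[OF dphi]) (unfold \<phi>0, rule dC)
  note d1 = has_real_derivative_Re[OF this, unfolded o_def]
  have "((\<lambda>t. exp (- m * t) * Re (?C z) - Re (?C (\<phi> t z))) has_real_derivative
      - m * Re (?C z) - Re (G z * (2 * s / (s - z)\<^sup>2))) (at 0 within {0..})"
    by (rule derivative_eq_intros d1 refl)+ simp
  moreover have "exp (- m * t) * Re (?C z) - Re (?C (\<phi> t z)) \<le> exp (- m * 0) * Re (?C z) - Re (?C (\<phi> 0 z))"
    if t: "0 \<le> t" for t
  proof -
    have "0 \<le> Re (?C z)"
      unfolding Re_Cayley[OF s] using cmod_square_less_one[OF z] by simp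
    moreover have "- m * t \<le> l * t" using m t by (intro mult_right_mono) auto
    ultimately have "exp (- m * t) * Re (?C z) \<le> exp (l * t) * Re (?C z)"
      by (intro mult_right_mono) auto
    also have "\<dots> \<le> Re (?C (\<phi> t z))" by (rule BRFP_Julia[OF sg br s t z])
    finally show ?thesis by (simp add: \<phi>0)
  qed
  ultimately have "- m * Re (?C z) - Re (G z * (2 * s / (s - z)\<^sup>2)) \<le> 0"
    by (rule right_derivative_nonpos)
  moreover have "Re (G z * (2 * s / (s - z)\<^sup>2)) = Re (2 * s * G z / (s - z)\<^sup>2)" by (simp add: mult_ac)
  ultimately show ?thesis
    unfolding plus_complex.sel Re_of_real_mult by linarith
qed

section \<open>Subtracting boundary poles\<close>

lemma Cayley_radius:
  assumes "s \<noteq> 0" "r \<noteq> 1"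
  shows "(s + complex_of_real r * s) / (s - of_real r * s) = of_real ((1 + r) / (1 - r))"
proof -
  have "s + of_real r * s = of_real (1 + r) * s" by (simp add: algebra_simps)
  then show ?thesis unfolding minus_radius using assms by simp
qed

text \<open>Source of the factor \<open>|\<tau> - \<sigma> k|^2\<close> in \<open>alpha\<close>: it
  is the size of the quadratic factor of the field at the boundary point.\<close>

lemma moebius_factor_at_unit:
  assumes "cmod s = 1"
  shows "(\<tau> - s) * (1 - cnj \<tau> * s) = - s * of_real ((cmod (s - \<tau>))\<^sup>2)"
proof -
  have "1 - cnj \<tau> * s = s * cnj (s - \<tau>)"
    using assms complex_norm_square[of s] by (simp add: algebra_simps)
  then show ?thesis
    unfolding complex_norm_square by (simp add: algebra_simps)
qed

text \<open>Along the radius, \<open>J\<close> bounds \<open>Re (\<nu> p)\<close> by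
  \<open>(1 - r) (m / 2) (1 + r)\<close>, but \<open>\<nu>\<close> is real only in the limit.
  Harnack for \<open>R\<close> gives \<open>p = O(1 - r)\<close>, so replacing \<open>\<nu>\<close>
  by its limit costs \<open>o(1 - r)\<close> and Julia's inequality applies to \<open>p\<close>.
  Where \<open>p z \<noteq> 0\<close>, dividing the conclusion by \<open>|p z|^2\<close> bounds
  \<open>Re (1 / p z)\<close> below by a multiple of the Poisson kernel at \<open>s\<close>.\<close>

lemma pole_mass:
  assumes holp: "p holomorphic_on ball 0 1" and pos: "\<And>z. cmod z < 1 \<Longrightarrow> 0 \<le> Re (p z)"
    and G: "\<And>z. cmod z < 1 \<Longrightarrow> G z = (\<tau> - z) * (1 - cnj \<tau> * z) * p z"
    and \<tau>: "cmod \<tau> < 1" and s: "cmod s = 1" and m: "0 < m"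
    and J: "\<And>z. cmod z < 1 \<Longrightarrow> 0 \<le> Re (2 * s * G z / (s - z)\<^sup>2 + of_real m * ((s + z) / (s - z)))"
    and z: "cmod z < 1"
  shows "(1 - (cmod z)\<^sup>2) * (cmod (p z))\<^sup>2 \<le> 2 * (m / (cmod (s - \<tau>))\<^sup>2) * Re (p z) * (cmod (s - z))\<^sup>2"
proof -
  let ?w = "\<lambda>r. complex_of_real r * s"
  define R where "R = (\<lambda>z. 2 * s * G z / (s - z)\<^sup>2 + of_real m * ((s + z) / (s - z)))"
  have s0: "s \<noteq> 0" using s by auto
  have sz: "s - u \<noteq> 0" if "cmod u < 1" for u using s that by auto
  have "(\<lambda>z. (\<tau> - z) * (1 - cnj \<tau> * z) * p z) holomorphic_on ball 0 1"
    by (intro holomorphic_intros holp)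
  then have holG: "G holomorphic_on ball 0 1"
    by (rule holomorphic_transform) (use G in auto)
  have holR: "R holomorphic_on ball 0 1"
    unfolding R_def using sz by (intro holomorphic_intros holG) auto
  have posR: "0 \<le> Re (R u)" if "cmod u < 1" for u
    using J[OF that] by (simp add: R_def)
  define K where "K = 6 * cmod (R 0)"
  define N where "N = (\<lambda>u. (\<tau> - u) * (1 - cnj \<tau> * u))"
  \<comment> \<open>The factor \<open>- cnj s\<close> normalises the quadratic factor so that its
    limit \<open>\<nu>0\<close> is positive.\<close>
  define \<nu> where "\<nu> = (\<lambda>r. - cnj s * N (?w r))"
  define \<nu>0 where "\<nu>0 = (cmod (s - \<tau>))\<^sup>2"
  have \<nu>0: "0 < \<nu>0" using \<tau> s by (auto simp: \<nu>0_def)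
  have ss: "cnj s * s = 1"
    using s complex_norm_square[of s] by (simp add: mult.commute)
  have "(\<nu> \<longlongrightarrow> - cnj s * ((\<tau> - s) * (1 - cnj \<tau> * s))) (at_left 1)"
    unfolding \<nu>_def N_def by (intro tendsto_intros tendsto_radius)
  also have "- cnj s * ((\<tau> - s) * (1 - cnj \<tau> * s)) = (cnj s * s) * of_real \<nu>0"
    unfolding moebius_factor_at_unit[OF s] \<nu>0_def by simp
  finally have \<nu>: "(\<nu> \<longlongrightarrow> of_real \<nu>0) (at_left 1)" by (simp add: ss)
  have "((\<lambda>r. cmod (\<nu> r)) \<longlongrightarrow> cmod (of_real \<nu>0)) (at_left 1)"
    by (intro tendsto_norm \<nu>)
  then have c\<nu>: "((\<lambda>r. cmod (\<nu> r)) \<longlongrightarrow> \<nu>0) (at_left 1)" using \<nu>0 by simp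
  then have ev\<nu>: "\<forall>\<^sub>F r in at_left 1. 0 < cmod (\<nu> r)"
    using \<nu>0 by (rule order_tendstoD)
  have wr: "cmod (?w r) < 1" "(cmod (?w r))\<^sup>2 = r\<^sup>2" if "0 < r \<and> r < 1" for r
    using that s by (auto simp: norm_mult power_mult_distrib)
  have G_eq: "cnj s * G (?w r) = - \<nu> r * p (?w r)" if "0 < r \<and> r < 1" for r
    using G[OF wr(1)[OF that]] by (simp add: \<nu>_def N_def)
  have Rw: "R (?w r) = 2 * (cnj s * G (?w r)) / of_real ((1 - r)\<^sup>2) + of_real (m * ((1 + r) / (1 - r)))"
    if "0 < r \<and> r < 1" for r
  proof -
    have "2 * s * G (?w r) / (s - ?w r)\<^sup>2 = 2 * (cnj s * G (?w r)) / of_real ((1 - r)\<^sup>2)"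
      unfolding minus_radius
      using that s0 ss by (simp add: power_mult_distrib divide_simps)
        (simp add: power2_eq_square algebra_simps flip: mult.assoc)
    moreover have "(s + ?w r) / (s - ?w r) = of_real ((1 + r) / (1 - r))"
      using that s0 by (intro Cayley_radius) auto
    ultimately show ?thesis unfolding R_def by simp
  qed
  have pbound: "cmod (\<nu> r) * cmod (p (?w r)) \<le> (1 - r) * (K / 2 + m)" if r: "0 < r \<and> r < 1" for r
  proof -
    have "cmod (R (?w r)) * (1 - r\<^sup>2) \<le> K"
      using Harnack_half_plane(1)[OF holR posR wr(1)[OF r]] unfolding wr(2)[OF r] K_def by simp
    moreover have "1 - r \<le> 1 - r\<^sup>2" using r by (simp add: power2_eq_square)
    then have "cmod (R (?w r)) * (1 - r) \<le> cmod (R (?w r)) * (1 - r\<^sup>2)"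
      by (intro mult_left_mono) auto
    ultimately have RK: "cmod (R (?w r)) * (1 - r) \<le> K" by linarith
    have "2 * (cnj s * G (?w r)) = of_real ((1 - r)\<^sup>2) * (R (?w r) - of_real (m * ((1 + r) / (1 - r))))"
      using r unfolding Rw[OF r] by simp
    then have "cmod (2 * (cnj s * G (?w r))) = (1 - r)\<^sup>2 * cmod (R (?w r) - of_real (m * ((1 + r) / (1 - r))))"
      by (simp only: norm_mult norm_of_real abs_power2)
    also have "\<dots> \<le> (1 - r)\<^sup>2 * (cmod (R (?w r)) + cmod (complex_of_real (m * ((1 + r) / (1 - r)))))"
      by (intro mult_left_mono norm_triangle_ineq4) auto
    also have "cmod (complex_of_real (m * ((1 + r) / (1 - r)))) = m * ((1 + r) / (1 - r))"
      using r m by (simp only: norm_of_real) auto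
    also have "(1 - r)\<^sup>2 * (cmod (R (?w r)) + m * ((1 + r) / (1 - r))) =
        (1 - r) * (cmod (R (?w r)) * (1 - r) + m * (1 + r))"
      using r by (simp add: power2_eq_square field_simps)
    also have "\<dots> \<le> (1 - r) * (K + m * 2)"
      using r m RK by (intro mult_left_mono add_mono) auto
    finally have "2 * cmod (cnj s * G (?w r)) \<le> (1 - r) * (K + m * 2)"
      by (simp add: norm_mult)
    moreover have "(1 - r) * (K + m * 2) = 2 * ((1 - r) * (K / 2 + m))"
      by (simp add: field_simps)
    ultimately show ?thesis unfolding G_eq[OF r] by (simp add: norm_mult)
  qed
  \<comment> \<open>The first summand is the bound coming from \<open>J\<close>; the second is the
    error of replacing \<open>\<nu> r\<close> by \<open>\<nu>0\<close>, estimated with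
    \<open>pbound\<close>, and it vanishes in the limit.\<close>
  define c where "c = (\<lambda>r. (m / 2 * (1 + r) + cmod (\<nu> r - of_real \<nu>0) * ((K / 2 + m) / cmod (\<nu> r))) / \<nu>0)"
  have "(c \<longlongrightarrow> (m / 2 * (1 + 1) + cmod (of_real \<nu>0 - of_real \<nu>0 :: complex) * ((K / 2 + m) / \<nu>0)) / \<nu>0) (at_left 1)"
    unfolding c_def using \<nu>0 by (intro tendsto_intros \<nu> c\<nu>) auto
  then have c: "(c \<longlongrightarrow> m / \<nu>0) (at_left 1)" by simp
  have plim: "((\<lambda>r. p (?w r)) \<longlongrightarrow> 0) (at_left 1)"
  proof (rule Lim_null_comparison)
    have "((\<lambda>r. (1 - r) * ((K / 2 + m) / cmod (\<nu> r))) \<longlongrightarrow> (1 - 1) * ((K / 2 + m) / \<nu>0)) (at_left 1)"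
      using \<nu>0 by (intro tendsto_intros c\<nu>) auto
    then show "((\<lambda>r. (1 - r) * ((K / 2 + m) / cmod (\<nu> r))) \<longlongrightarrow> 0) (at_left 1)" by simp
    show "\<forall>\<^sub>F r in at_left 1. cmod (p (?w r)) \<le> (1 - r) * ((K / 2 + m) / cmod (\<nu> r))"
      using eventually_at_left_1 ev\<nu>
      by eventually_elim (use pbound in \<open>simp add: field_simps\<close>)
  qed
  have le: "\<forall>\<^sub>F r in at_left 1. Re (p (?w r)) \<le> (1 - r) * c r"
    using eventually_at_left_1 ev\<nu>
  proof eventually_elim
    case (elim r)
    note r = elim(1)
    have pb: "cmod (p (?w r)) \<le> (1 - r) * ((K / 2 + m) / cmod (\<nu> r))"
      using pbound[OF r] elim(2) by (simp add: field_simps)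
    have "0 \<le> Re (2 * (cnj s * G (?w r)) / of_real ((1 - r)\<^sup>2) + of_real (m * ((1 + r) / (1 - r))))"
      using posR[OF wr(1)[OF r]] unfolding Rw[OF r] .
    then have "0 \<le> 2 * Re (cnj s * G (?w r)) / (1 - r)\<^sup>2 + m * ((1 + r) / (1 - r))"
      unfolding plus_complex.sel Re_divide_of_real Re_complex_of_real by simp
    then have "0 \<le> (1 - r)\<^sup>2 * (2 * Re (cnj s * G (?w r)) / (1 - r)\<^sup>2 + m * ((1 + r) / (1 - r)))"
      by simp
    also have "\<dots> = 2 * Re (cnj s * G (?w r)) + (1 - r) * (m * (1 + r))"
    proof -
      have eq: "d\<^sup>2 * (2 * x / d\<^sup>2 + m * (e / d)) = 2 * x + d * (m * e)" if "d \<noteq> 0" for d x e :: real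
        using that by (simp add: field_simps power2_eq_square)
      show ?thesis by (rule eq) (use r in simp)
    qed
    finally have 1: "Re (\<nu> r * p (?w r)) \<le> (1 - r) * (m / 2 * (1 + r))"
      unfolding G_eq[OF r] by simp
    have "\<nu> r * p (?w r) = of_real \<nu>0 * p (?w r) + (\<nu> r - of_real \<nu>0) * p (?w r)"
      by (simp add: algebra_simps)
    then have "Re (\<nu> r * p (?w r)) = \<nu>0 * Re (p (?w r)) + Re ((\<nu> r - of_real \<nu>0) * p (?w r))"
      by (simp only: plus_complex.sel Re_of_real_mult)
    moreover have "- Re ((\<nu> r - of_real \<nu>0) * p (?w r)) \<le> cmod (\<nu> r - of_real \<nu>0) * cmod (p (?w r))"
      using abs_Re_le_cmod[of "(\<nu> r - of_real \<nu>0) * p (?w r)"] unfolding norm_mult by linarith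
    moreover have "cmod (\<nu> r - of_real \<nu>0) * cmod (p (?w r)) \<le>
        cmod (\<nu> r - of_real \<nu>0) * ((1 - r) * ((K / 2 + m) / cmod (\<nu> r)))"
      using pb by (intro mult_left_mono) auto
    ultimately have "\<nu>0 * Re (p (?w r)) \<le> (1 - r) * (m / 2 * (1 + r)) +
        cmod (\<nu> r - of_real \<nu>0) * ((1 - r) * ((K / 2 + m) / cmod (\<nu> r)))"
      using 1 by linarith
    also have "\<dots> = (1 - r) * (m / 2 * (1 + r) + cmod (\<nu> r - of_real \<nu>0) * ((K / 2 + m) / cmod (\<nu> r)))"
      by (simp only: distrib_left mult.left_commute)
    also have "\<dots> = \<nu>0 * ((1 - r) * c r)"
      using \<nu>0 by (simp add: c_def)
    finally show ?case using \<nu>0 by simp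
  qed
  show ?thesis
    using Julia_half_plane[OF holp pos s plim c le z] by (simp add: \<nu>0_def)
qed

lemma Re_inverse_half_plane: "Re (1 / z) = Re z / (cmod z)\<^sup>2"
  by (simp add: Re_divide cmod_power2)

text \<open>Julia's inequality for \<open>1 / f\<close>: on the radius \<open>Re (1 / f)\<close> is
  at most \<open>1 / Re f\<close>, hence at most \<open>(1 - r) * c r\<close> with
  \<open>c r\<close> tending to \<open>1 / (2 * b)\<close>. The bounded loss \<open>K\<close>
  disappears in this limit, so a radial estimate with an error becomes a global one without.\<close>

lemma half_plane_pole_lower_bound:
  assumes holf: "f holomorphic_on ball 0 1" and pos: "\<And>z. cmod z < 1 \<Longrightarrow> 0 \<le> Re (f z)"
    and s: "cmod s = 1" and b: "0 < b"
    and le: "\<forall>\<^sub>F r in at_left 1. b * ((1 + r) / (1 - r)) - K \<le> Re (f (of_real r * s))"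
    and z: "cmod z < 1"
  shows "b * Re ((s + z) / (s - z)) \<le> Re (f z)"
proof -
  let ?w = "\<lambda>r. complex_of_real r * s"
  define p where "p = (\<lambda>z. 1 / f z)"
  define c where "c = (\<lambda>r. 1 / (b * (1 + r) - K * (1 - r)))"
  have "((\<lambda>r. b * (1 + r) - K * (1 - r)) \<longlongrightarrow> b * (1 + 1) - K * (1 - 1)) (at_left 1)"
    by (intro tendsto_intros)
  then have den: "((\<lambda>r. b * (1 + r) - K * (1 - r)) \<longlongrightarrow> 2 * b) (at_left 1)" by (simp add: mult.commute)
  then have evden: "\<forall>\<^sub>F r in at_left 1. 0 < b * (1 + r) - K * (1 - r)"
    using b by (intro order_tendstoD(1)[OF den]) auto
  have c: "(c \<longlongrightarrow> 1 / (2 * b)) (at_left 1)"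
    unfolding c_def using b by (intro tendsto_intros den) auto
  have wr: "cmod (?w r) < 1" if "0 < r \<and> r < 1" for r
    using that s by (auto simp: norm_mult)
  have ev: "\<forall>\<^sub>F r in at_left 1. 0 < Re (f (?w r)) \<and> 1 / Re (f (?w r)) \<le> (1 - r) * c r \<and> cmod (?w r) < 1"
    using eventually_at_left_1 evden le
  proof eventually_elim
    case (elim r)
    have "b * ((1 + r) / (1 - r)) - K = (b * (1 + r) - K * (1 - r)) / (1 - r)"
      using elim by (simp add: field_simps)
    then have ge: "(b * (1 + r) - K * (1 - r)) / (1 - r) \<le> Re (f (?w r))" using elim by simp
    moreover have p: "0 < (b * (1 + r) - K * (1 - r)) / (1 - r)" using elim by simp
    ultimately have "1 / Re (f (?w r)) \<le> 1 / ((b * (1 + r) - K * (1 - r)) / (1 - r))"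
      by (intro frac_le) auto
    also have "\<dots> = (1 - r) * c r" by (simp add: c_def)
    finally show ?case using wr[OF elim(1)] less_le_trans[OF p ge] by simp
  qed
  \<comment> \<open>A single point with positive real part makes the real part positive on the whole
    disk, so \<open>f\<close> has no zeros and \<open>1 / f\<close> is holomorphic.\<close>
  obtain w where w: "cmod w < 1" "0 < Re (f w)"
    using eventually_happens'[OF _ ev] by (auto simp: trivial_limit_at_left_real)
  have posf: "0 < Re (f u)" if "cmod u < 1" for u
    by (rule half_plane_Re_pos[OF holf pos w that])
  have nz: "f u \<noteq> 0" if "cmod u < 1" for u
    using posf[OF that] by auto
  have holp: "p holomorphic_on ball 0 1"
    unfolding p_def using nz by (intro holomorphic_intros holf) auto
  have posp: "0 \<le> Re (p u)" if "cmod u < 1" for u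
    unfolding p_def Re_inverse_half_plane using pos[OF that] by simp
  have small: "cmod (p u) \<le> 1 / Re (f u)" if "cmod u < 1" for u
    using posf[OF that] complex_Re_le_cmod[of "f u"]
    by (simp add: p_def norm_divide frac_le)
  have lim0: "((\<lambda>r. (1 - r) * c r) \<longlongrightarrow> (1 - 1) * (1 / (2 * b))) (at_left 1)"
    by (intro tendsto_intros c)
  have plim: "((\<lambda>r. p (?w r)) \<longlongrightarrow> 0) (at_left 1)"
  proof (rule Lim_null_comparison)
    show "\<forall>\<^sub>F r in at_left 1. cmod (p (?w r)) \<le> (1 - r) * c r"
      using ev by eventually_elim (use small in force)
    show "((\<lambda>r. (1 - r) * c r) \<longlongrightarrow> 0) (at_left 1)" using lim0 by simp
  qed
  have "\<forall>\<^sub>F r in at_left 1. Re (p (?w r)) \<le> (1 - r) * c r"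
    using ev
  proof eventually_elim
    case (elim r)
    then show ?case
      using small[of "?w r"] complex_Re_le_cmod[of "p (?w r)"] by linarith
  qed
  from Julia_half_plane[OF holp posp s plim c this z]
  have "(1 - (cmod z)\<^sup>2) * (1 / cmod (f z))\<^sup>2 \<le> 1 / b * (Re (f z) / (cmod (f z))\<^sup>2) * (cmod (s - z))\<^sup>2"
    by (simp add: p_def Re_inverse_half_plane norm_divide)
  moreover have "0 < (cmod (f z))\<^sup>2" "0 < (cmod (s - z))\<^sup>2"
    using nz[OF z] z s by auto
  moreover have "b * (a / d) \<le> x" if "a * (1 / y)\<^sup>2 \<le> 1 / b * (x / y\<^sup>2) * d" "0 < y\<^sup>2" "0 < d" for a d x y
    using that b by (simp add: field_simps)
  ultimately show ?thesis
    unfolding Re_Cayley[OF s] by blast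
qed

text \<open>By the previous lemma the mass of \<open>q\<close> at a new pole \<open>\<sigma> k\<close> is not affected by subtracting
  Cayley kernels with other poles, since these are bounded near \<open>\<sigma> k\<close>.\<close>

lemma half_plane_subtract_poles:
  assumes "finite I" and inj: "inj_on \<sigma> I" and s: "\<And>k. k \<in> I \<Longrightarrow> cmod (\<sigma> k) = 1"
    and a: "\<And>k. k \<in> I \<Longrightarrow> 0 < a k"
    and holq: "q holomorphic_on ball 0 1" and pos: "\<And>z. cmod z < 1 \<Longrightarrow> 0 \<le> Re (q z)"
    and le: "\<And>k z. k \<in> I \<Longrightarrow> cmod z < 1 \<Longrightarrow> a k * Re ((\<sigma> k + z) / (\<sigma> k - z)) \<le> Re (q z)"
    and z: "cmod z < 1"
  shows "0 \<le> Re (q z - (\<Sum>k\<in>I. of_real (a k) * ((\<sigma> k + z) / (\<sigma> k - z))))"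
  using assms(1) inj s a le z
proof (induction I arbitrary: z rule: finite_induct)
  case empty
  then show ?case using pos by simp
next
  case (insert j I)
  let ?S = "\<lambda>z. \<Sum>k\<in>I. of_real (a k) * ((\<sigma> k + z) / (\<sigma> k - z))"
  let ?f = "\<lambda>z. q z - ?S z"
  have sz: "\<sigma> k - u \<noteq> 0" if "k \<in> insert j I" "cmod u < 1" for k u
    using insert.prems(2)[OF that(1)] that(2) by auto
  have "a j * Re ((\<sigma> j + z) / (\<sigma> j - z)) \<le> Re (?f z)"
  proof (rule half_plane_pole_lower_bound[where K = "Re (?S (\<sigma> j)) + 1"])
    show "?f holomorphic_on ball 0 1"
      using sz by (intro holomorphic_intros holq) auto
    show "0 \<le> Re (?f u)" if "cmod u < 1" for u
      using insert.prems that by (intro insert.IH) auto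
    have ne: "\<sigma> k - \<sigma> j \<noteq> 0" if "k \<in> I" for k
      using insert.prems(1) insert.hyps(2) that by (auto simp: inj_on_def)
    have "((\<lambda>r. Re (?S (of_real r * \<sigma> j))) \<longlongrightarrow> Re (?S (\<sigma> j))) (at_left 1)"
      using ne by (intro tendsto_intros tendsto_radius) auto
    then have "\<forall>\<^sub>F r in at_left 1. Re (?S (of_real r * \<sigma> j)) < Re (?S (\<sigma> j)) + 1"
      by (rule order_tendstoD) simp
    then show "\<forall>\<^sub>F r in at_left 1. a j * ((1 + r) / (1 - r)) - (Re (?S (\<sigma> j)) + 1) \<le> Re (?f (of_real r * \<sigma> j))"
      using eventually_at_left_1
    proof eventually_elim
      case (elim r)
      have sj: "cmod (\<sigma> j) = 1" using insert.prems by simp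
      have w: "cmod (of_real r * \<sigma> j) < 1" using elim sj by (simp add: norm_mult)
      have "\<sigma> j \<noteq> 0" using sj by auto
      then have "Re ((\<sigma> j + of_real r * \<sigma> j) / (\<sigma> j - of_real r * \<sigma> j)) = (1 + r) / (1 - r)"
        using elim by (subst Cayley_radius) auto
      then have "a j * ((1 + r) / (1 - r)) \<le> Re (q (of_real r * \<sigma> j))"
        using insert.prems(4)[of j, OF _ w] by simp
      then show ?case using elim by simp
    qed
  qed (use insert.prems in auto)
  moreover have "Re (of_real (a j) * ((\<sigma> j + z) / (\<sigma> j - z))) = a j * Re ((\<sigma> j + z) / (\<sigma> j - z))"
    by (rule Re_of_real_mult)
  ultimately show ?case
    unfolding sum.insert[OF insert.hyps(1,2)] minus_complex.sel plus_complex.sel by linarith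
qed

lemma alpha_pos:
  assumes "cmod \<tau> < 1" "cmod (\<sigma> k) = 1" "lam k < 0"
  shows "0 < alpha \<tau> \<sigma> lam k"
proof -
  have "0 < (cmod (\<tau> - \<sigma> k))\<^sup>2" using assms by auto
  then show ?thesis unfolding alpha_def using assms by (intro divide_pos_pos) auto
qed

lemma nontrivial_generator_imp_nontrivial_semigroup:
  assumes sg: "is_semigroup \<phi>" and gen: "is_generator \<phi> G" and nontriv: "\<exists>z\<in>ball 0 1. G z \<noteq> 0"
  shows "\<not> (\<forall>t\<ge>0. \<forall>z\<in>ball 0 1. \<phi> t z = z)"
proof
  assume id: "\<forall>t\<ge>0. \<forall>z\<in>ball 0 1. \<phi> t z = z"
  obtain z where z: "cmod z < 1" "G z \<noteq> 0" using nontriv by auto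
  have "G z = 0"
  proof (rule vector_derivative_unique_within)
    show "at (0::real) within {0..} \<noteq> bot"
      by (simp add: at_within_Ici_at_right)
    show "((\<lambda>s. \<phi> s z) has_vector_derivative G z) (at 0 within {0..})"
      by (rule generator_initial_derivative[OF sg gen z(1)])
    show "((\<lambda>s. \<phi> s z) has_vector_derivative 0) (at 0 within {0..})"
      by (rule has_vector_derivative_transform[OF _ _ has_vector_derivative_const[of z]])
         (use id z in auto)
  qed
  then show False using z by simp
qed

lemma GenFL_representation:
  assumes sigma_bd: "\<forall>k\<in>{1..n}. cmod (\<sigma> k) = 1"
    and sigma_inj: "inj_on \<sigma> {1..n}"
    and lam_neg: "\<forall>k\<in>{1..n}. lam k < 0"
    and \<tau>: "cmod \<tau> < 1"
    and G: "G \<in> GenFL \<tau> n \<sigma> lam" and nontriv: "\<exists>z\<in>ball 0 1. G z \<noteq> 0"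
  obtains q where "q holomorphic_on ball 0 1" "\<And>z. cmod z < 1 \<Longrightarrow> 0 \<le> Re (q z)"
    "\<And>z. cmod z < 1 \<Longrightarrow> p0 \<tau> n \<sigma> lam z + q z \<noteq> 0"
    "\<And>z. cmod z < 1 \<Longrightarrow> G z = (\<tau> - z) * (1 - cnj \<tau> * z) / (p0 \<tau> n \<sigma> lam z + q z)"
proof -
  obtain \<phi> where sg: "is_semigroup \<phi>" and gen: "is_generator \<phi> G" and DW: "DW_interior \<phi> \<tau>"
    and br: "\<And>k. k \<in> {1..n} \<Longrightarrow> \<exists>l. lam k \<le> l \<and> l \<le> 0 \<and> BRFP_spectral \<phi> (\<sigma> k) l"
    using G nontriv by (auto simp: GenFL_def)
  have fx: "\<phi> t \<tau> = \<tau>" if "0 \<le> t" for t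
    using DW that by (auto simp: DW_interior_def)
  obtain p where holp: "p holomorphic_on ball 0 1" and posp: "\<And>z. cmod z < 1 \<Longrightarrow> 0 \<le> Re (p z)"
    and Gp: "\<And>z. cmod z < 1 \<Longrightarrow> G z = (\<tau> - z) * (1 - cnj \<tau> * z) * p z"
    using Berkson_Porta_interior[OF sg gen fx \<tau>] by blast
  have nz: "p z \<noteq> 0" if "cmod z < 1" for z
    using half_plane_zero_imp_zero[OF holp posp that] nontriv Gp by auto
  define f where "f = (\<lambda>z. 1 / p z)"
  have holf: "f holomorphic_on ball 0 1"
    unfolding f_def using nz by (intro holomorphic_intros holp) auto
  have posf: "0 \<le> Re (f z)" if "cmod z < 1" for z
    unfolding f_def Re_inverse_half_plane using posp[OF that] by simp
  have mass: "alpha \<tau> \<sigma> lam k * Re ((\<sigma> k + z) / (\<sigma> k - z)) \<le> Re (f z)"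
    if k: "k \<in> {1..n}" and z: "cmod z < 1" for k z
  proof -
    have s: "cmod (\<sigma> k) = 1" and l: "lam k < 0" using sigma_bd lam_neg k by auto
    have \<nu>: "0 < (cmod (\<sigma> k - \<tau>))\<^sup>2" using s \<tau> by auto
    obtain l where l: "lam k \<le> l" "BRFP_spectral \<phi> (\<sigma> k) l" using br[OF k] by auto
    have J: "0 \<le> Re (2 * \<sigma> k * G u / (\<sigma> k - u)\<^sup>2 + of_real (- lam k) * ((\<sigma> k + u) / (\<sigma> k - u)))"
      if "cmod u < 1" for u
      using l that by (intro generator_Julia[OF sg gen _ s]) auto
    have "(1 - (cmod z)\<^sup>2) * (cmod (p z))\<^sup>2 \<le> 2 * (- lam k / (cmod (\<sigma> k - \<tau>))\<^sup>2) * Re (p z) * (cmod (\<sigma> k - z))\<^sup>2"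
      by (rule pole_mass[OF holp posp Gp \<tau> s _ J z]) (use lam_neg k in auto)
    moreover have "0 < (cmod (\<sigma> k - z))\<^sup>2" "0 < (cmod (p z))\<^sup>2" "0 < - lam k"
      using s z nz[OF z] lam_neg k by auto
    \<comment> \<open>Read with \<open>v = |\<sigma> k - \<tau>|^2\<close>,
      \<open>m = - lam k\<close>, \<open>x / y = Re (1 / p z)\<close> and \<open>a / d\<close> the
      Poisson kernel: then \<open>v / (2 * m)\<close> is exactly the mass
      \<open>alpha\<close>.\<close>
    moreover have "v / (2 * m) * (a / d) \<le> x / y"
      if "a * y \<le> 2 * (m / v) * x * d" "0 < d" "0 < y" "0 < m" "0 < v" for a d m v x y :: real
      using that by (simp add: field_simps)
    moreover have "alpha \<tau> \<sigma> lam k = (cmod (\<sigma> k - \<tau>))\<^sup>2 / (2 * (- lam k))"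
      using lam_neg k unfolding alpha_def by (subst abs_of_neg) (auto simp: norm_minus_commute)
    ultimately show ?thesis
      unfolding Re_Cayley[OF s] f_def Re_inverse_half_plane using \<nu> by metis
  qed
  define q where "q = (\<lambda>z. f z - p0 \<tau> n \<sigma> lam z)"
  have "0 \<le> Re (f z - (\<Sum>k\<in>{1..n}. of_real (alpha \<tau> \<sigma> lam k) * ((\<sigma> k + z) / (\<sigma> k - z))))" if "cmod z < 1" for z
    by (rule half_plane_subtract_poles[OF _ sigma_inj _ _ holf posf mass that])
       (use sigma_bd lam_neg \<tau> alpha_pos in auto)
  then have posq: "0 \<le> Re (q z)" if "cmod z < 1" for z
    using that by (simp add: q_def p0_def)
  have sz: "\<sigma> k - u \<noteq> 0" if "k \<in> {1..n}" "cmod u < 1" for k u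
    using sigma_bd that by auto
  have holq: "q holomorphic_on ball 0 1"
    unfolding q_def p0_def using sz by (intro holomorphic_intros holf) auto
  show ?thesis
    by (rule that[OF holq posq]) (use Gp nz in \<open>auto simp: q_def f_def\<close>)
qed

section \<open>Differential equations on the half-line\<close>

lemma integral_has_vector_derivative_Ici:
  fixes g :: "real \<Rightarrow> 'a::banach"
  assumes g: "continuous_on {0..} g" and t: "0 \<le> t"
  shows "((\<lambda>u. integral {0..u} g) has_vector_derivative g t) (at t within {0..})"
proof -
  have "((\<lambda>u. integral {0..u} g) has_vector_derivative g t) (at t within {0..t + 1})"
    using t by (intro integral_has_vector_derivative continuous_on_subset[OF g]) auto
  moreover have "at t within {0..t + 1} = at t within {0..}"
    by (rule at_within_nhd[of _ "{..<t + 1}"]) auto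
  ultimately show ?thesis by simp
qed

lemma continuous_on_has_vector_derivative_Ici:
  assumes "\<And>t::real. 0 \<le> t \<Longrightarrow> (u has_vector_derivative u' t) (at t within {0..})"
  shows "continuous_on {0..} u"
  using assms by (auto simp: continuous_on_eq_continuous_within intro: has_vector_derivative_continuous)

text \<open>Picard iteration is a contraction on the bounded functions \<open>v t = exp (- 2 L t) u t\<close>;
  the exponential weight gives a solution on the whole half-line at once.\<close>

lemma ODE_global_Lipschitz_exists:
  fixes F :: "'a::banach \<Rightarrow> 'a"
  assumes lip: "\<And>x y. norm (F x - F y) \<le> L * norm (x - y)" and L: "0 < L"
    and bnd: "\<And>x. norm (F x) \<le> M"
  obtains u where "u 0 = z" "\<And>t. 0 \<le> t \<Longrightarrow> (u has_vector_derivative F (u t)) (at t within {0..})"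
proof -
  have contF: "continuous_on UNIV F"
    by (rule lipschitz_on_continuous_on[where L = L])
       (use lip L in \<open>auto intro!: lipschitz_onI simp: dist_norm\<close>)
  have M: "0 \<le> M" using bnd[of undefined] norm_ge_zero order_trans by blast
  define g where "g = (\<lambda>(v :: real \<Rightarrow>\<^sub>C 'a) s. F (exp (2 * L * s) *\<^sub>R apply_bcontfun v s))"
  define I where "I = (\<lambda>v t. z + integral {0..t} (g v))"
  \<comment> \<open>Bounded continuous functions live on the whole line, so negative times are
    frozen at 0.\<close>
  define \<Phi> where "\<Phi> = (\<lambda>v t. exp (- 2 * L * max 0 t) *\<^sub>R I v (max 0 t))"
  have contg: "continuous_on A (g v)" for v A
    unfolding g_def
    by (rule continuous_on_compose2[OF contF]) (auto intro!: continuous_intros)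
  have I': "(I v has_vector_derivative g v t) (at t within {0..})" if "0 \<le> t" for v t
    unfolding I_def by (rule derivative_eq_intros integral_has_vector_derivative_Ici[OF contg that] refl)+ simp
  have contI: "continuous_on {0..} (I v)" for v
    by (rule continuous_on_has_vector_derivative_Ici) (rule I')
  have I_bound: "norm (I v t) \<le> norm z + M * t" if "0 \<le> t" for v t
  proof -
    have "norm (integral {0..t} (g v)) \<le> M * (t - 0)"
      by (rule integral_bound[OF that contg]) (simp add: g_def bnd)
    then show ?thesis unfolding I_def using norm_triangle_ineq[of z "integral {0..t} (g v)"] by simp
  qed
  have exp_lin: "exp (- (2 * L * t)) * t \<le> 1 / (2 * L)" for t
  proof -
    have "2 * L * t \<le> exp (2 * L * t)" using exp_ge_add_one_self[of "2 * L * t"] by linarith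
    then show ?thesis using L by (simp add: exp_minus field_simps)
  qed
  have \<Phi>_bcont: "\<Phi> v \<in> bcontfun" for v
  proof (rule bcontfun_normI)
    show "continuous_on UNIV (\<Phi> v)"
      unfolding \<Phi>_def
      by (intro continuous_intros continuous_on_compose2[OF contI[of v]]) auto
    show "norm (\<Phi> v t) \<le> norm z + M / (2 * L)" for t
    proof -
      let ?t = "max 0 t"
      have "norm (\<Phi> v t) = exp (- 2 * L * ?t) * norm (I v ?t)"
        by (simp add: \<Phi>_def)
      also have "\<dots> \<le> exp (- 2 * L * ?t) * (norm z + M * ?t)"
        by (intro mult_left_mono I_bound) auto
      also have "\<dots> = exp (- 2 * L * ?t) * norm z + M * (exp (- (2 * L * ?t)) * ?t)"
        by (simp add: algebra_simps)
      also have "\<dots> \<le> 1 * norm z + M * (1 / (2 * L))"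
        using L M by (intro add_mono mult_right_mono mult_left_mono exp_lin) auto
      finally show ?thesis by simp
    qed
  qed
  define T where "T = (\<lambda>v. Bcontfun (\<Phi> v))"
  have T: "apply_bcontfun (T v) = \<Phi> v" for v
    unfolding T_def using \<Phi>_bcont by (rule Bcontfun_inverse)
  have contr: "dist (T v) (T w) \<le> 1 / 2 * dist v w" for v w
  proof (rule dist_bound)
    fix t :: real
    let ?t = "max 0 t" let ?d = "dist v w"
    \<comment> \<open>The weight grows at the rate \<open>2 * L\<close>, twice the Lipschitz
      constant, so integrating \<open>L * exp (2 * L * s)\<close> produces the contraction factor
      \<open>1 / 2\<close>.\<close>
    have int: "((\<lambda>s. L * ?d * exp (2 * L * s)) has_integral (?d / 2 * exp (2 * L * ?t) - ?d / 2 * exp (2 * L * 0))) {0..?t}"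
      by (rule fundamental_theorem_of_calculus)
         (auto intro!: derivative_eq_intros simp flip: has_real_derivative_iff_has_vector_derivative)
    have "norm (I v ?t - I w ?t) = norm (integral {0..?t} (\<lambda>s. g v s - g w s))"
      unfolding I_def by (subst integral_diff) (auto intro: integrable_continuous_real contg)
    also have "\<dots> \<le> integral {0..?t} (\<lambda>s. L * ?d * exp (2 * L * s))"
    proof (rule integral_norm_bound_integral)
      show "(\<lambda>s. g v s - g w s) integrable_on {0..?t}"
        by (intro integrable_continuous_real continuous_intros contg)
      show "(\<lambda>s. L * ?d * exp (2 * L * s)) integrable_on {0..?t}"
        using int by (rule has_integral_integrable)
      fix s
      have "norm (g v s - g w s) \<le> L * norm (exp (2 * L * s) *\<^sub>R apply_bcontfun v s - exp (2 * L * s) *\<^sub>R apply_bcontfun w s)"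
        unfolding g_def by (rule lip)
      also have "\<dots> = L * (exp (2 * L * s) * norm (apply_bcontfun v s - apply_bcontfun w s))"
        by (simp flip: scaleR_diff_right)
      also have "\<dots> \<le> L * (exp (2 * L * s) * ?d)"
        using L dist_bounded[of v s w] by (intro mult_left_mono) (auto simp: dist_norm)
      finally show "norm (g v s - g w s) \<le> L * ?d * exp (2 * L * s)" by (simp add: mult_ac)
    qed
    also have "\<dots> = ?d / 2 * exp (2 * L * ?t) - ?d / 2 * exp (2 * L * 0)"
      using int by (rule integral_unique)
    also have "\<dots> \<le> ?d / 2 * exp (2 * L * ?t)" by simp
    finally have le: "norm (I v ?t - I w ?t) \<le> ?d / 2 * exp (2 * L * ?t)" .
    have "dist (\<Phi> v t) (\<Phi> w t) = exp (- 2 * L * ?t) * norm (I v ?t - I w ?t)"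
      by (simp add: \<Phi>_def dist_norm flip: scaleR_diff_right)
    also have "\<dots> \<le> exp (- 2 * L * ?t) * (?d / 2 * exp (2 * L * ?t))"
      by (intro mult_left_mono le) auto
    also have "\<dots> = 1 / 2 * ?d"
      by (simp add: exp_minus)
    finally show "dist (apply_bcontfun (T v) t) (apply_bcontfun (T w) t) \<le> 1 / 2 * ?d"
      by (simp add: T)
  qed
  obtain v where "T v = v"
    using banach_fix_type[of "1 / 2" T] contr by auto
  then have v: "apply_bcontfun v t = \<Phi> v t" for t using T[of v] by simp
  have fixp: "exp (2 * L * t) *\<^sub>R apply_bcontfun v t = I v t" if "0 \<le> t" for t
    unfolding v \<Phi>_def using that by (simp flip: exp_add)
  show ?thesis
  proof (rule that[of "I v"])
    show "I v 0 = z" by (simp add: I_def)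
    show "(I v has_vector_derivative F (I v t)) (at t within {0..})" if "0 \<le> t" for t
      using I'[OF that, of v] fixp[OF that] by (simp add: g_def)
  qed
qed

lemma nonincreasing_if_derivative_nonpos:
  fixes f :: "real \<Rightarrow> real"
  assumes "0 \<le> t" "continuous_on {0..t} f"
    and "\<And>s. 0 < s \<Longrightarrow> s < t \<Longrightarrow> \<exists>D. (f has_real_derivative D) (at s within {0..}) \<and> D \<le> 0"
  shows "f t \<le> f 0"
proof (rule DERIV_nonpos_imp_decreasing_open[where f = f])
  fix s assume s: "0 < s" "s < t"
  then have "at s within {0..} = at s" by (intro at_within_interior) simp
  then show "\<exists>y. DERIV f s :> y \<and> y \<le> 0" using assms(3)[OF s] by simp
qed (use assms in auto)

text \<open>The argument runs on \<open>|y|^2\<close>, which is differentiable even where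
  \<open>y\<close> vanishes. The lower bound is what keeps distinct trajectories apart.\<close>

lemma Gronwall:
  fixes y :: "real \<Rightarrow> complex"
  assumes t: "0 \<le> t" and cont: "continuous_on {0..t} y"
    and y': "\<And>s. 0 < s \<Longrightarrow> s < t \<Longrightarrow> \<exists>D. (y has_vector_derivative D) (at s within {0..}) \<and> cmod D \<le> L * cmod (y s)"
  shows Gronwall_upper: "cmod (y t) \<le> exp (L * t) * cmod (y 0)"
    and Gronwall_lower: "cmod (y 0) \<le> exp (L * t) * cmod (y t)"
proof -
  have cauchy: "\<bar>Re (cnj (y s) * D)\<bar> \<le> L * (cmod (y s))\<^sup>2" if "cmod D \<le> L * cmod (y s)" for s D
  proof -
    have "\<bar>Re (cnj (y s) * D)\<bar> \<le> cmod (y s) * cmod D"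
      using abs_Re_le_cmod[of "cnj (y s) * D"] by (simp add: norm_mult)
    also have "\<dots> \<le> cmod (y s) * (L * cmod (y s))"
      using that by (intro mult_left_mono) auto
    finally show ?thesis by (simp add: power2_eq_square mult_ac)
  qed
  have "exp (- 2 * L * t) * (cmod (y t))\<^sup>2 \<le> exp (- 2 * L * 0) * (cmod (y 0))\<^sup>2"
  proof (rule nonincreasing_if_derivative_nonpos[OF t])
    show "continuous_on {0..t} (\<lambda>t. exp (- 2 * L * t) * (cmod (y t))\<^sup>2)"
      by (intro continuous_intros cont)
    fix s assume s: "0 < s" "s < t"
    obtain D where D: "(y has_vector_derivative D) (at s within {0..})" "cmod D \<le> L * cmod (y s)"
      using y'[OF s] by blast
    have "((\<lambda>t. exp (- 2 * L * t) * (cmod (y t))\<^sup>2) has_real_derivative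
        exp (- 2 * L * s) * (2 * (Re (cnj (y s) * D) - L * (cmod (y s))\<^sup>2))) (at s within {0..})"
      by (rule derivative_eq_intros has_real_derivative_cmod_square[OF D(1)] refl)+ (simp add: algebra_simps)
    moreover have "exp (- 2 * L * s) * (2 * (Re (cnj (y s) * D) - L * (cmod (y s))\<^sup>2)) \<le> 0"
      using cauchy[OF D(2)] by (intro mult_nonneg_nonpos) auto
    ultimately show "\<exists>D. ((\<lambda>t. exp (- 2 * L * t) * (cmod (y t))\<^sup>2) has_real_derivative D) (at s within {0..}) \<and> D \<le> 0"
      by blast
  qed
  then have "exp (2 * L * t) * (exp (- 2 * L * t) * (cmod (y t))\<^sup>2) \<le> exp (2 * L * t) * (cmod (y 0))\<^sup>2"
    by (intro mult_left_mono) auto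
  then have "(cmod (y t))\<^sup>2 \<le> (exp (L * t) * cmod (y 0))\<^sup>2"
    by (simp add: power_mult_distrib exp_minus flip: exp_double mult.assoc)
  then show "cmod (y t) \<le> exp (L * t) * cmod (y 0)"
    by (rule power2_le_imp_le) simp
  have "- (exp (2 * L * t) * (cmod (y t))\<^sup>2) \<le> - (exp (2 * L * 0) * (cmod (y 0))\<^sup>2)"
  proof (rule nonincreasing_if_derivative_nonpos[OF t])
    show "continuous_on {0..t} (\<lambda>t. - (exp (2 * L * t) * (cmod (y t))\<^sup>2))"
      by (intro continuous_intros cont)
    fix s assume s: "0 < s" "s < t"
    obtain D where D: "(y has_vector_derivative D) (at s within {0..})" "cmod D \<le> L * cmod (y s)"
      using y'[OF s] by blast
    have "((\<lambda>t. - (exp (2 * L * t) * (cmod (y t))\<^sup>2)) has_real_derivative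
        exp (2 * L * s) * (2 * (- Re (cnj (y s) * D) - L * (cmod (y s))\<^sup>2))) (at s within {0..})"
      by (rule derivative_eq_intros has_real_derivative_cmod_square[OF D(1)] refl)+ (simp add: algebra_simps)
    moreover have "exp (2 * L * s) * (2 * (- Re (cnj (y s) * D) - L * (cmod (y s))\<^sup>2)) \<le> 0"
      using cauchy[OF D(2)] by (intro mult_nonneg_nonpos) auto
    ultimately show "\<exists>D. ((\<lambda>t. - (exp (2 * L * t) * (cmod (y t))\<^sup>2)) has_real_derivative D) (at s within {0..}) \<and> D \<le> 0"
      by blast
  qed
  then have "(cmod (y 0))\<^sup>2 \<le> (exp (L * t) * cmod (y t))\<^sup>2"
    by (simp add: power_mult_distrib flip: exp_double mult.assoc)
  then show "cmod (y 0) \<le> exp (L * t) * cmod (y t)"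
    by (rule power2_le_imp_le) simp
qed

lemma linear_ODE_solution:
  fixes y A :: "real \<Rightarrow> complex"
  assumes A: "continuous_on {0..} A"
    and y': "\<And>t. 0 \<le> t \<Longrightarrow> (y has_vector_derivative A t * y t) (at t within {0..})"
    and t: "0 \<le> t"
  shows "y t = y 0 * exp (integral {0..t} A)"
proof -
  let ?I = "\<lambda>t. integral {0..t} A"
  have "((\<lambda>t. y t * exp (- ?I t)) has_vector_derivative 0) (at s within {0..})" if s: "s \<in> {0..}" for s
  proof -
    have "((\<lambda>t. - ?I t) has_vector_derivative - A s) (at s within {0..})"
      using s by (intro has_vector_derivative_minus integral_has_vector_derivative_Ici[OF A]) auto
    then have "((exp \<circ> (\<lambda>t. - ?I t)) has_vector_derivative - A s * exp (- ?I s)) (at s within {0..})"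
      by (rule field_vector_diff_chain_within) (rule derivative_eq_intros refl | simp)+
    from has_vector_derivative_mult[OF y' this[unfolded o_def], of] s
    show ?thesis by (simp add: algebra_simps)
  qed
  from has_vector_derivative_zero_constant[OF convex_real_interval(1) this]
  obtain c where c: "\<And>s. s \<in> {0..} \<Longrightarrow> y s * exp (- ?I s) = c" by blast
  have "y t * exp (- ?I t) = y 0" using c[of t] c[of 0] t by simp
  then have "y t * (exp (- ?I t) * exp (?I t)) = y 0 * exp (?I t)" by (simp flip: mult.assoc)
  then show ?thesis by (simp flip: exp_add)
qed

lemma first_hitting_time:
  fixes g :: "real \<Rightarrow> real"
  assumes cont: "continuous_on {0..T} g" and g0: "g 0 < r" and T: "0 \<le> T" "r \<le> g T"
  obtains t where "0 < t" "t \<le> T" "g t = r" "\<And>s. 0 \<le> s \<Longrightarrow> s < t \<Longrightarrow> g s < r"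
proof -
  let ?S = "{s \<in> {0..T}. g s = r}"
  have "closed ?S"
    by (rule continuous_closed_preimage_constant[OF cont]) simp
  moreover have "bounded ?S"
    by (rule bounded_subset[of "{0..T}"]) auto
  ultimately have "compact ?S"
    by (simp add: compact_eq_bounded_closed)
  moreover have "?S \<noteq> {}"
    using IVT'[of g 0 r T] g0 T cont by force
  ultimately obtain t where t: "t \<in> ?S" "\<And>s. s \<in> ?S \<Longrightarrow> t \<le> s"
    using continuous_attains_inf[of ?S "\<lambda>s. s"] by auto
  show ?thesis
  proof (rule that[of t])
    show "0 < t" using t g0 by (cases "t = 0") auto
    show "t \<le> T" "g t = r" using t by auto
    show "g s < r" if s: "0 \<le> s" "s < t" for s
    proof (rule ccontr)
      assume "\<not> g s < r"
      then obtain x where "0 \<le> x" "x \<le> s" "g x = r"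
        using IVT'[of g 0 r s] g0 s t(1) continuous_on_subset[OF cont, of "{0..s}"] by force
      then show False using t(2)[of x] t(1) s by auto
    qed
  qed
qed

section \<open>The flow of a Berkson--Porta field\<close>

lemma holomorphic_Lipschitz_cball:
  assumes holf: "f holomorphic_on ball 0 1" and \<rho>: "\<rho> < 1"
  obtains L where "0 < L" "\<And>x y. cmod x \<le> \<rho> \<Longrightarrow> cmod y \<le> \<rho> \<Longrightarrow> cmod (f x - f y) \<le> L * cmod (x - y)"
proof -
  have sub: "cball 0 \<rho> \<subseteq> ball (0 :: complex) 1" using \<rho> by auto
  have "continuous_on (cball 0 \<rho>) (deriv f)"
    using holomorphic_deriv[OF holf] sub
    by (intro continuous_on_subset[OF holomorphic_on_imp_continuous_on]) auto
  then have "bounded (deriv f ` cball 0 \<rho>)"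
    by (intro compact_imp_bounded compact_continuous_image) auto
  then obtain B where B: "0 < B" "\<And>x. x \<in> cball 0 \<rho> \<Longrightarrow> cmod (deriv f x) \<le> B"
    unfolding bounded_pos by auto
  show ?thesis
  proof (rule that[OF B(1)])
    fix x y :: complex assume "cmod x \<le> \<rho>" "cmod y \<le> \<rho>"
    then show "cmod (f x - f y) \<le> B * cmod (x - y)"
      using holomorphic_derivI[OF holf] B(2) sub
      by (intro field_differentiable_bound[of "cball 0 \<rho>" f "deriv f"]) auto
  qed
qed

text \<open>Pseudo-hyperbolic disks about \<open>\<tau>\<close> are relatively compact in the unit
  disk. The number \<open>e\<close> comes from solving the identity for \<open>1 - |M|^2\<close>,
  with \<open>M\<close> the Moebius value, for \<open>1 - |w|^2\<close> and using
  \<open>|1 - cnj \<tau> * w| \<ge> 1 - |\<tau>|\<close>.\<close>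

lemma Moebius_sublevel_bounded:
  assumes \<tau>: "cmod \<tau> < 1" and c: "0 \<le> c" "c < 1"
  obtains \<rho> where "0 < \<rho>" "\<rho> < 1"
    "\<And>w. cmod w < 1 \<Longrightarrow> cmod (Moebius_function 0 \<tau> w) \<le> c \<Longrightarrow> cmod w < \<rho>"
proof -
  define e where "e = (1 - c\<^sup>2) * (1 - cmod \<tau>)\<^sup>2 / (1 - (cmod \<tau>)\<^sup>2)"
  have c2: "0 < 1 - c\<^sup>2" "1 - c\<^sup>2 \<le> 1" using c by (auto simp: power_less_one_iff)
  have t2: "0 < 1 - (cmod \<tau>)\<^sup>2" using cmod_square_less_one[OF \<tau>] by simp
  have e: "0 < e" unfolding e_def using c2 t2 \<tau> by auto
  have est: "(cmod w)\<^sup>2 \<le> 1 - e" if w: "cmod w < 1" "cmod (Moebius_function 0 \<tau> w) \<le> c" for w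
  proof -
    have nz: "0 < (cmod (1 - cnj \<tau> * w))\<^sup>2"
      using one_minus_cnj_mult_nonzero[of \<tau> w] \<tau> w by auto
    have "cmod \<tau> * cmod w \<le> cmod \<tau> * 1" using w by (intro mult_left_mono) auto
    then have "1 - cmod \<tau> \<le> cmod (1 - cnj \<tau> * w)"
      using norm_triangle_ineq2[of 1 "cnj \<tau> * w"] by (simp add: norm_mult)
    then have "(1 - cmod \<tau>)\<^sup>2 \<le> (cmod (1 - cnj \<tau> * w))\<^sup>2"
      using \<tau> by (intro power_mono) auto
    then have 1: "(1 - c\<^sup>2) * (1 - cmod \<tau>)\<^sup>2 \<le> (1 - c\<^sup>2) * (cmod (1 - cnj \<tau> * w))\<^sup>2"
      using c2 by (intro mult_left_mono) auto
    have "(cmod (Moebius_function 0 \<tau> w))\<^sup>2 \<le> c\<^sup>2" using w by (intro power_mono) auto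
    then have "1 - c\<^sup>2 \<le> (1 - (cmod \<tau>)\<^sup>2) * (1 - (cmod w)\<^sup>2) / (cmod (1 - cnj \<tau> * w))\<^sup>2"
      using one_minus_Moebius_square[OF \<tau> w(1)] by linarith
    then have "(1 - c\<^sup>2) * (cmod (1 - cnj \<tau> * w))\<^sup>2 \<le> (1 - (cmod \<tau>)\<^sup>2) * (1 - (cmod w)\<^sup>2)"
      using nz by (simp add: pos_le_divide_eq)
    with 1 have "(1 - c\<^sup>2) * (1 - cmod \<tau>)\<^sup>2 \<le> (1 - (cmod \<tau>)\<^sup>2) * (1 - (cmod w)\<^sup>2)" by linarith
    then have "e \<le> 1 - (cmod w)\<^sup>2"
      using t2 by (simp add: e_def pos_divide_le_eq mult.commute)
    then show ?thesis by simp
  qed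
  have "cmod (Moebius_function 0 \<tau> \<tau>) \<le> c" using c by (simp add: Moebius_function_eq_zero)
  from est[OF \<tau> this] have "e \<le> 1" by (smt (verit) zero_le_power2)
  \<comment> \<open>Taking \<open>e / 2\<close> for \<open>e\<close> makes the bound strict, which
    is what contradicts a first hitting time; \<open>e \<le> 1\<close>, read off at the centre
    \<open>w = \<tau>\<close>, keeps the root positive.\<close>
  show ?thesis
  proof (rule that[of "sqrt (1 - e / 2)"])
    show "0 < sqrt (1 - e / 2)" "sqrt (1 - e / 2) < 1" using e \<open>e \<le> 1\<close> by auto
    fix w assume "cmod w < 1" "cmod (Moebius_function 0 \<tau> w) \<le> c"
    from est[OF this] have "(cmod w)\<^sup>2 < 1 - e / 2" using e by simp
    then show "cmod w < sqrt (1 - e / 2)" by (rule real_less_rsqrt)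
  qed
qed

lemma Moebius_function_continuous_on:
  assumes "cmod \<tau> < 1" shows "continuous_on (ball 0 1) (Moebius_function 0 \<tau>)"
  using Moebius_function_holomorphic[OF assms] by (rule holomorphic_on_imp_continuous_on)

locale Berkson_Porta_field =
  fixes \<tau> :: complex and p G :: "complex \<Rightarrow> complex"
  assumes \<tau>: "cmod \<tau> < 1"
    and holp: "p holomorphic_on ball 0 1"
    and posp: "\<And>z. cmod z < 1 \<Longrightarrow> 0 \<le> Re (p z)"
    and G_eq: "\<And>z. cmod z < 1 \<Longrightarrow> G z = (\<tau> - z) * (1 - cnj \<tau> * z) * p z"
begin

lemma holG: "G holomorphic_on ball 0 1"
proof -
  have "(\<lambda>z. (\<tau> - z) * (1 - cnj \<tau> * z) * p z) holomorphic_on ball 0 1"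
    by (intro holomorphic_intros holp)
  then show ?thesis by (rule holomorphic_transform) (use G_eq in auto)
qed

text \<open>Stated for an arbitrary curve on a finite interval because its first use is for a
  solution of a truncated equation, which follows \<open>G\<close> only up to a hypothetical exit
  time.\<close>

lemma trajectory_Moebius_decreasing:
  assumes t: "0 \<le> t" and u: "\<And>s. 0 \<le> s \<Longrightarrow> s \<le> t \<Longrightarrow> cmod (u s) < 1"
    and cont: "continuous_on {0..t} u"
    and u': "\<And>s. 0 < s \<Longrightarrow> s < t \<Longrightarrow> (u has_vector_derivative G (u s)) (at s within {0..})"
  shows "cmod (Moebius_function 0 \<tau> (u t)) \<le> cmod (Moebius_function 0 \<tau> (u 0))"
proof -
  let ?W = "\<lambda>s. (cmod (Moebius_function 0 \<tau> (u s)))\<^sup>2"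
  have "?W t \<le> ?W 0"
  proof (rule nonincreasing_if_derivative_nonpos[where f = ?W, OF t])
    show "continuous_on {0..t} ?W"
      by (intro continuous_intros continuous_on_compose2[OF Moebius_function_continuous_on[OF \<tau>] cont])
         (use u in auto)
    fix s assume s: "0 < s" "s < t"
    have us: "cmod (u s) < 1" using u s by simp
    have "(?W has_real_derivative - 2 * (1 - (cmod \<tau>)\<^sup>2) * ?W s * Re (p (u s))) (at s within {0..})"
      by (rule has_derivative_cmod_Moebius_square[where u = u and t = s and w = \<tau>, OF _ \<tau> us]) (use u'[OF s] G_eq[OF us] in simp)
    moreover have "0 \<le> (1 - (cmod \<tau>)\<^sup>2) * ?W s * Re (p (u s))"
      using cmod_square_less_one[OF \<tau>] posp[OF us] by (intro mult_nonneg_nonneg) auto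
    then have "- 2 * (1 - (cmod \<tau>)\<^sup>2) * ?W s * Re (p (u s)) \<le> 0" by linarith
    ultimately show "\<exists>D. (?W has_real_derivative D) (at s within {0..}) \<and> D \<le> 0" by blast
  qed
  then show ?thesis by (rule power2_le_imp_le) simp
qed

text \<open>\<open>G\<close> is Lipschitz only on compact parts of the disk. Precomposing it with
  the 1-Lipschitz projection onto a closed disk of radius \<open>\<rho>\<close> gives a bounded
  globally Lipschitz field \<open>F\<close>. Until its solution first reaches the circle of radius
  \<open>\<rho>\<close> it solves \<open>u' = G u\<close>, so its pseudo-hyperbolic distance to
  \<open>\<tau>\<close> stays at most the initial one, and that forces modulus strictly below
  \<open>\<rho>\<close>: the circle is never reached.\<close>

lemma trajectory_exists:
  assumes z: "cmod z < 1"
  shows "\<exists>u. u 0 = z \<and> (\<forall>t\<ge>0. cmod (u t) < 1 \<and> (u has_vector_derivative G (u t)) (at t within {0..}))"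
proof -
  define c where "c = cmod (Moebius_function 0 \<tau> z)"
  have c: "0 \<le> c" "c < 1"
    using Moebius_function_norm_lt_1[OF \<tau> z] by (auto simp: c_def)
  obtain \<rho> where \<rho>: "0 < \<rho>" "\<rho> < 1"
    and sub: "\<And>w. cmod w < 1 \<Longrightarrow> cmod (Moebius_function 0 \<tau> w) \<le> c \<Longrightarrow> cmod w < \<rho>"
    using Moebius_sublevel_bounded[OF \<tau> c] by blast
  obtain L where L: "0 < L" and lip: "\<And>x y. cmod x \<le> \<rho> \<Longrightarrow> cmod y \<le> \<rho> \<Longrightarrow> cmod (G x - G y) \<le> L * cmod (x - y)"
    using holomorphic_Lipschitz_cball[OF holG \<rho>(2)] by blast
  let ?K = "cball (0 :: complex) \<rho>"
  define F where "F = (\<lambda>w. G (closest_point ?K w))"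
  have cp: "closest_point ?K w \<in> ?K" for w
    using \<rho> by (intro closest_point_in_set) auto
  have "continuous_on ?K G"
    using \<rho> by (intro continuous_on_subset[OF holomorphic_on_imp_continuous_on[OF holG]]) auto
  then have "bounded (G ` ?K)"
    by (intro compact_imp_bounded compact_continuous_image) auto
  then obtain M where "\<forall>w\<in>?K. cmod (G w) \<le> M"
    unfolding bounded_iff by auto
  then have M: "cmod (G w) \<le> M" if "w \<in> ?K" for w using that by blast
  have lipF: "cmod (F x - F y) \<le> L * cmod (x - y)" for x y
  proof -
    have "cmod (F x - F y) \<le> L * dist (closest_point ?K x) (closest_point ?K y)"
      unfolding F_def dist_norm using cp by (intro lip) auto
    also have "\<dots> \<le> L * dist x y"
      using \<rho> L by (intro mult_left_mono closest_point_lipschitz) auto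
    finally show ?thesis by (simp add: dist_norm)
  qed
  have bF: "cmod (F x) \<le> M" for x unfolding F_def using cp by (rule M)
  obtain u where u0: "u 0 = z"
    and u': "\<And>t. 0 \<le> t \<Longrightarrow> (u has_vector_derivative F (u t)) (at t within {0..})"
    using ODE_global_Lipschitz_exists[OF lipF L bF, of z] by blast
  have FG: "F w = G w" if "cmod w \<le> \<rho>" for w
    using that by (simp add: F_def closest_point_self)
  have contu: "continuous_on {0..} u"
    using u' by (rule continuous_on_has_vector_derivative_Ici)
  have "cmod z < \<rho>" using sub[OF z] by (simp add: c_def)
  have in\<rho>: "cmod (u t) < \<rho>" if t: "0 \<le> t" for t
  proof (rule ccontr)
    assume "\<not> cmod (u t) < \<rho>"
    moreover have "continuous_on {0..t} (\<lambda>t. cmod (u t))"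
      by (intro continuous_on_norm continuous_on_subset[OF contu]) auto
    ultimately obtain t0 where t0: "0 < t0" "t0 \<le> t" "cmod (u t0) = \<rho>"
      "\<And>s. 0 \<le> s \<Longrightarrow> s < t0 \<Longrightarrow> cmod (u s) < \<rho>"
      using first_hitting_time[of t "\<lambda>t. cmod (u t)" \<rho>] t u0 \<open>cmod z < \<rho>\<close> by auto
    have le: "cmod (u s) \<le> \<rho>" if "0 \<le> s" "s \<le> t0" for s
      using t0(3) t0(4)[of s] that by (cases "s = t0") auto
    have "cmod (Moebius_function 0 \<tau> (u t0)) \<le> cmod (Moebius_function 0 \<tau> (u 0))"
    proof (rule trajectory_Moebius_decreasing)
      show "cmod (u s) < 1" if "0 \<le> s" "s \<le> t0" for s using le[OF that] \<rho> by simp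
      show "continuous_on {0..t0} u" by (intro continuous_on_subset[OF contu]) auto
      show "(u has_vector_derivative G (u s)) (at s within {0..})" if "0 < s" "s < t0" for s
        using u'[of s] FG[OF le[of s]] that by simp
    qed (use t0 in auto)
    then have "cmod (u t0) < \<rho>"
      using t0 \<rho> by (intro sub) (auto simp: c_def u0)
    with t0 show False by simp
  qed
  show ?thesis
  proof (intro exI[of _ u] conjI allI impI u0)
    fix t :: real assume t: "0 \<le> t"
    show "cmod (u t) < 1" using in\<rho>[OF t] \<rho> by simp
    show "(u has_vector_derivative G (u t)) (at t within {0..})"
      using u'[OF t] FG in\<rho>[OF t] by simp
  qed
qed

text \<open>The value matters only for \<open>z\<close> in the disk; outside, the choice is
  arbitrary, as \<open>is_semigroup\<close> allows.\<close>

definition flow :: "real \<Rightarrow> complex \<Rightarrow> complex" where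
  "flow t z = (SOME u. u 0 = z \<and> (\<forall>t\<ge>0. cmod (u t) < 1 \<and>
     (u has_vector_derivative G (u t)) (at t within {0..}))) t"

lemma flow:
  assumes "cmod z < 1"
  shows flow_0: "flow 0 z = z"
    and flow_in_ball: "0 \<le> t \<Longrightarrow> cmod (flow t z) < 1"
    and flow_derivative: "0 \<le> t \<Longrightarrow> ((\<lambda>t. flow t z) has_vector_derivative G (flow t z)) (at t within {0..})"
  using someI_ex[OF trajectory_exists[OF assms]] unfolding flow_def by auto

lemma flow_continuous: "cmod z < 1 \<Longrightarrow> continuous_on {0..} (\<lambda>t. flow t z)"
  by (rule continuous_on_has_vector_derivative_Ici) (rule flow_derivative)

lemma flow_Moebius_decreasing:
  assumes z: "cmod z < 1" and t: "0 \<le> t"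
  shows "cmod (Moebius_function 0 \<tau> (flow t z)) \<le> cmod (Moebius_function 0 \<tau> z)"
  using trajectory_Moebius_decreasing[OF t, of "\<lambda>t. flow t z"] z flow_in_ball flow_derivative
    continuous_on_subset[OF flow_continuous[OF z], of "{0..t}"] by (simp add: flow_0)

lemma Gronwall_trajectories:
  assumes lip: "\<And>x y. cmod x \<le> \<rho> \<Longrightarrow> cmod y \<le> \<rho> \<Longrightarrow> cmod (G x - G y) \<le> L * cmod (x - y)"
    and u': "\<And>s. 0 \<le> s \<Longrightarrow> (u has_vector_derivative G (u s)) (at s within {0..})"
    and v': "\<And>s. 0 \<le> s \<Longrightarrow> (v has_vector_derivative G (v s)) (at s within {0..})"
    and bu: "\<And>s. 0 \<le> s \<Longrightarrow> s \<le> t \<Longrightarrow> cmod (u s) \<le> \<rho>"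
    and bv: "\<And>s. 0 \<le> s \<Longrightarrow> s \<le> t \<Longrightarrow> cmod (v s) \<le> \<rho>"
    and t: "0 \<le> t"
  shows "cmod (u t - v t) \<le> exp (L * t) * cmod (u 0 - v 0)"
    and "cmod (u 0 - v 0) \<le> exp (L * t) * cmod (u t - v t)"
proof -
  let ?y = "\<lambda>s. u s - v s"
  have "continuous_on {0..} u"
    using u' by (rule continuous_on_has_vector_derivative_Ici)
  moreover have "continuous_on {0..} v"
    using v' by (rule continuous_on_has_vector_derivative_Ici)
  ultimately have cont: "continuous_on {0..t} ?y"
    by (intro continuous_on_diff) (auto intro: continuous_on_subset)
  have y': "\<exists>D. (?y has_vector_derivative D) (at s within {0..}) \<and> cmod D \<le> L * cmod (?y s)"
    if "0 < s" "s < t" for s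
    using that lip[OF bu[of s] bv[of s]]
    by (intro exI[of _ "G (u s) - G (v s)"] conjI has_vector_derivative_diff u' v') auto
  show "cmod (u t - v t) \<le> exp (L * t) * cmod (u 0 - v 0)"
    by (rule Gronwall_upper[OF t cont y'])
  show "cmod (u 0 - v 0) \<le> exp (L * t) * cmod (u t - v t)"
    by (rule Gronwall_lower[OF t cont y'])
qed

text \<open>Up to time \<open>t\<close> both trajectories stay in one compact disk, where
  \<open>G\<close> is Lipschitz and Gronwall applies.\<close>

lemma trajectory_unique:
  assumes u': "\<And>s. 0 \<le> s \<Longrightarrow> (u has_vector_derivative G (u s)) (at s within {0..})"
    and v': "\<And>s. 0 \<le> s \<Longrightarrow> (v has_vector_derivative G (v s)) (at s within {0..})"
    and bu: "\<And>s. 0 \<le> s \<Longrightarrow> cmod (u s) < 1"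
    and bv: "\<And>s. 0 \<le> s \<Longrightarrow> cmod (v s) < 1"
    and eq: "u 0 = v 0" and t: "0 \<le> t"
  shows "u t = v t"
proof -
  have bd: "\<exists>\<rho><1. \<forall>s\<in>{0..t}. cmod (w s) \<le> \<rho>"
    if w': "\<And>s. 0 \<le> s \<Longrightarrow> (w has_vector_derivative G (w s)) (at s within {0..})"
      and bw: "\<And>s. 0 \<le> s \<Longrightarrow> cmod (w s) < 1" for w
  proof -
    have "continuous_on {0..} w" using w' by (rule continuous_on_has_vector_derivative_Ici)
    then have "continuous_on {0..t} (\<lambda>s. cmod (w s))"
      by (intro continuous_on_norm) (auto intro: continuous_on_subset)
    then obtain x where "x \<in> {0..t}" "\<forall>s\<in>{0..t}. cmod (w s) \<le> cmod (w x)"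
      using continuous_attains_sup[of "{0..t}" "\<lambda>s. cmod (w s)"] t by auto
    then show ?thesis using bw by auto
  qed
  obtain \<rho>1 \<rho>2 where \<rho>1: "\<rho>1 < 1" "\<forall>s\<in>{0..t}. cmod (u s) \<le> \<rho>1"
    and \<rho>2: "\<rho>2 < 1" "\<forall>s\<in>{0..t}. cmod (v s) \<le> \<rho>2"
    using bd[OF u' bu] bd[OF v' bv] by blast
  define \<rho> where "\<rho> = max \<rho>1 \<rho>2"
  have "\<rho> < 1" using \<rho>1 \<rho>2 by (simp add: \<rho>_def)
  then obtain L where lip: "\<And>x y. cmod x \<le> \<rho> \<Longrightarrow> cmod y \<le> \<rho> \<Longrightarrow> cmod (G x - G y) \<le> L * cmod (x - y)"
    using holomorphic_Lipschitz_cball[OF holG] by blast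
  have "cmod (u t - v t) \<le> exp (L * t) * cmod (u 0 - v 0)"
    by (rule Gronwall_trajectories(1)[OF lip u' v' _ _ t]) (use \<rho>1 \<rho>2 in \<open>auto simp: \<rho>_def intro: max.coboundedI1 max.coboundedI2\<close>)
  then show ?thesis using eq by simp
qed

lemma flow_flow:
  assumes z: "cmod z < 1" and s: "0 \<le> s" and t: "0 \<le> t"
  shows "flow s (flow t z) = flow (s + t) z"
proof -
  have ft: "cmod (flow t z) < 1" using z t by (rule flow_in_ball)
  show ?thesis
  proof (rule trajectory_unique[where u = "\<lambda>s. flow s (flow t z)" and v = "\<lambda>s. flow (s + t) z"])
    show "((\<lambda>s. flow s (flow t z)) has_vector_derivative G (flow r (flow t z))) (at r within {0..})"
      if "0 \<le> r" for r using ft that by (rule flow_derivative)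
    show "((\<lambda>s. flow (s + t) z) has_vector_derivative G (flow (r + t) z)) (at r within {0..})"
      if "0 \<le> r" for r
    proof -
      have "((\<lambda>s. flow s z) has_vector_derivative G (flow (r + t) z)) (at (r + t) within (\<lambda>s. s + t) ` {0..})"
        by (rule has_vector_derivative_within_subset[OF flow_derivative[OF z]]) (use that t in auto)
      moreover have "((\<lambda>s. s + t) has_vector_derivative 1) (at r within {0..})"
        by (auto intro!: derivative_eq_intros)
      ultimately show ?thesis
        using vector_diff_chain_within[of "\<lambda>s. s + t" 1 r "{0..}" "\<lambda>s. flow s z"] by (simp add: o_def)
    qed
  qed (use ft z s t in \<open>auto simp: flow_0 intro: flow_in_ball\<close>)
qed

lemma flow_fixes: "0 \<le> t \<Longrightarrow> flow t \<tau> = \<tau>"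
  using flow_Moebius_decreasing[OF \<tau>, of t] flow_in_ball[OF \<tau>, of t]
    one_minus_cnj_mult_nonzero[OF \<tau>, of "flow t \<tau>"]
  by (simp add: Moebius_function_simple)

text \<open>The difference \<open>y z\<close> of two trajectories solves the scalar linear equation
  \<open>y' = A y\<close>, where \<open>A\<close> is the difference quotient of \<open>G\<close>
  along them. Hence the difference quotient of the flow is exactly \<open>exp (I z)\<close>, and
  since \<open>A z\<close> tends uniformly to \<open>deriv G\<close> along the trajectory of
  \<open>z0\<close>, the complex derivative exists and equals the exponential of the integral of
  \<open>B\<close>.\<close>

lemma flow_has_field_derivative:
  assumes z0: "cmod z0 < 1" and t: "0 \<le> t"
  shows "\<exists>D. (flow t has_field_derivative D) (at z0)"
proof -
  \<comment> \<open>Strictly between the initial pseudo-hyperbolic distance and 1, so that all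
    trajectories starting near \<open>z0\<close> share one compact disk.\<close>
  define c where "c = (1 + cmod (Moebius_function 0 \<tau> z0)) / 2"
  have M0: "cmod (Moebius_function 0 \<tau> z0) < c" and c: "0 \<le> c" "c < 1"
    using Moebius_function_norm_lt_1[OF \<tau> z0, of 0] by (auto simp: c_def)
  obtain \<rho> where \<rho>: "0 < \<rho>" "\<rho> < 1"
    and sub: "\<And>w. cmod w < 1 \<Longrightarrow> cmod (Moebius_function 0 \<tau> w) \<le> c \<Longrightarrow> cmod w < \<rho>"
    using Moebius_sublevel_bounded[OF \<tau> c] by blast
  obtain L where L: "0 < L" and lip: "\<And>x y. cmod x \<le> \<rho> \<Longrightarrow> cmod y \<le> \<rho> \<Longrightarrow> cmod (G x - G y) \<le> L * cmod (x - y)"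
    using holomorphic_Lipschitz_cball[OF holG \<rho>(2)] by blast
  have holG': "deriv G holomorphic_on ball 0 1"
    by (intro holomorphic_deriv holG) auto
  obtain C where C: "0 < C" and lip': "\<And>x y. cmod x \<le> \<rho> \<Longrightarrow> cmod y \<le> \<rho> \<Longrightarrow> cmod (deriv G x - deriv G y) \<le> C * cmod (x - y)"
    using holomorphic_Lipschitz_cball[OF holG' \<rho>(2)] by blast
  have taylor: "cmod (G b - G a - deriv G a * (b - a)) \<le> C * cmod (b - a) * cmod (b - a)"
    if ab: "cmod a \<le> \<rho>" "cmod b \<le> \<rho>" for a b
  proof -
    let ?h = "\<lambda>x. G x - deriv G a * x"
    have seg: "cmod x \<le> \<rho>" if "x \<in> closed_segment a b" for x
      using closed_segment_subset[of a "cball 0 \<rho>" b] ab that by auto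
    have "cmod (?h b - ?h a) \<le> (C * cmod (b - a)) * cmod (b - a)"
    proof (rule field_differentiable_bound[where f' = "\<lambda>x. deriv G x - deriv G a" and S = "closed_segment a b"])
      fix x assume x: "x \<in> closed_segment a b"
      have "(G has_field_derivative deriv G x) (at x within closed_segment a b)"
        using seg[OF x] \<rho> by (intro has_field_derivative_at_within[OF holomorphic_derivI[OF holG]]) auto
      then show "(?h has_field_derivative deriv G x - deriv G a) (at x within closed_segment a b)"
        by (auto intro!: derivative_eq_intros)
      have "cmod (x - a) \<le> cmod (b - a)"
        using segment_bound(1)[OF x] by (simp add: norm_minus_commute)
      then have "C * cmod (x - a) \<le> C * cmod (b - a)" using C by simp
      then show "cmod (deriv G x - deriv G a) \<le> C * cmod (b - a)"
        using lip'[OF seg[OF x] ab(1)] by linarith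
    qed auto
    then show ?thesis by (simp add: algebra_simps)
  qed
  define good where "good = (\<lambda>z. cmod z < 1 \<and> cmod (Moebius_function 0 \<tau> z) < c)"
  have good_traj: "cmod (flow s z) \<le> \<rho>" if "good z" "0 \<le> s" for s z
    using sub[OF flow_in_ball[of z s]] flow_Moebius_decreasing[of z s] that by (auto simp: good_def)
  have good0: "good z0" using z0 M0 by (simp add: good_def)
  have "isCont (Moebius_function 0 \<tau>) z0"
    using Moebius_function_continuous_on[OF \<tau>] z0 by (simp add: continuous_on_eq_continuous_at)
  then have "((\<lambda>z. cmod (Moebius_function 0 \<tau> z)) \<longlongrightarrow> cmod (Moebius_function 0 \<tau> z0)) (at z0)"
    by (intro tendsto_norm) (simp add: isCont_def)
  then have "\<forall>\<^sub>F z in at z0. cmod (Moebius_function 0 \<tau> z) < c"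
    using M0 by (rule order_tendstoD)
  moreover have "\<forall>\<^sub>F z in at z0. z \<in> ball 0 1"
    using z0 by (intro eventually_at_in_open') auto
  moreover have "\<forall>\<^sub>F z in at z0. z \<noteq> z0"
    by (simp add: eventually_at_filter)
  ultimately have ev: "\<forall>\<^sub>F z in at z0. good z \<and> z \<noteq> z0"
    by eventually_elim (auto simp: good_def)
  define y where "y = (\<lambda>z s. flow s z - flow s z0)"
  define A where "A = (\<lambda>z s. (G (flow s z) - G (flow s z0)) / y z s)"
  define B where "B = (\<lambda>s. deriv G (flow s z0))"
  define I where "I = (\<lambda>z. integral {0..t} (A z))"
  have contflow: "continuous_on {0..} (\<lambda>s. f (flow s z))" if "good z" "f holomorphic_on ball 0 1" for f z
    by (rule continuous_on_compose2[OF holomorphic_on_imp_continuous_on[OF that(2)] flow_continuous])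
       (use that flow_in_ball in \<open>auto simp: good_def\<close>)
  have contB: "continuous_on {0..} B"
    unfolding B_def by (rule contflow[OF good0 holG'])
  have main: "(flow t z - flow t z0) / (z - z0) = exp (I z)"
    "cmod (I z - integral {0..t} B) \<le> C * (exp (L * t) * cmod (z - z0)) * t"
    if z: "good z" "z \<noteq> z0" for z
  proof -
    have z1: "cmod z < 1" using z by (simp add: good_def)
    have up: "cmod (y z s) \<le> exp (L * s) * cmod (z - z0)"
      and low: "cmod (z - z0) \<le> exp (L * s) * cmod (y z s)" if s: "0 \<le> s" for s
      using Gronwall_trajectories[OF lip flow_derivative[OF z1] flow_derivative[OF z0] _ _ s]
        good_traj[OF z(1)] good_traj[OF good0] by (auto simp: y_def flow_0 z1 z0)
    \<comment> \<open>Distinct trajectories never meet, by the lower Gronwall bound, so the quotient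
      \<open>A\<close> has no vanishing denominator.\<close>
    have ynz: "y z s \<noteq> 0" if s: "0 \<le> s" for s
      using low[OF s] z(2) by auto
    have contA: "continuous_on {0..} (A z)"
      unfolding A_def y_def using ynz
      by (intro continuous_intros contflow[OF z(1) holG] contflow[OF good0 holG] flow_continuous z1 z0)
         (auto simp: y_def)
    have "(y z has_vector_derivative A z s * y z s) (at s within {0..})" if s: "0 \<le> s" for s
    proof -
      have "(y z has_vector_derivative G (flow s z) - G (flow s z0)) (at s within {0..})"
        unfolding y_def by (intro has_vector_derivative_diff flow_derivative z1 z0 s)
      then show ?thesis using ynz[OF s] by (simp add: A_def)
    qed
    from linear_ODE_solution[OF contA this t]
    have "y z t = (z - z0) * exp (I z)"
      by (simp add: y_def flow_0 z1 z0 I_def)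
    then show "(flow t z - flow t z0) / (z - z0) = exp (I z)"
      using z(2) by (simp add: y_def)
    have AB: "cmod (A z s - B s) \<le> C * (exp (L * t) * cmod (z - z0))" if s: "0 \<le> s" "s \<le> t" for s
    proof -
      have "A z s - B s = (G (flow s z) - G (flow s z0) - deriv G (flow s z0) * (flow s z - flow s z0)) / y z s"
        using ynz[OF s(1)] by (simp add: A_def B_def y_def diff_divide_distrib)
      then have "cmod (A z s - B s) = cmod (G (flow s z) - G (flow s z0) -
          deriv G (flow s z0) * (flow s z - flow s z0)) / cmod (y z s)"
        by (simp only: norm_divide)
      also have "\<dots> \<le> (C * cmod (y z s) * cmod (y z s)) / cmod (y z s)"
      proof (rule divide_right_mono)
        show "cmod (G (flow s z) - G (flow s z0) - deriv G (flow s z0) * (flow s z - flow s z0))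
            \<le> C * cmod (y z s) * cmod (y z s)"
          unfolding y_def by (rule taylor[OF good_traj[OF good0 s(1)] good_traj[OF z(1) s(1)]])
      qed simp
      also have "\<dots> = C * cmod (y z s)" using ynz[OF s(1)] by simp
      also have "\<dots> \<le> C * (exp (L * s) * cmod (z - z0))"
        using up[OF s(1)] C by (intro mult_left_mono) auto
      also have "\<dots> \<le> C * (exp (L * t) * cmod (z - z0))"
      proof -
        have "exp (L * s) \<le> exp (L * t)" using L s by simp
        then show ?thesis using C by (intro mult_left_mono mult_right_mono) simp_all
      qed
      finally show ?thesis .
    qed
    have cAB: "continuous_on {0..t} (A z)" "continuous_on {0..t} B"
      using contA contB by (auto elim: continuous_on_subset)
    have "I z - integral {0..t} B = integral {0..t} (\<lambda>s. A z s - B s)"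
      unfolding I_def using cAB by (simp add: integral_diff integrable_continuous_real)
    also have "cmod \<dots> \<le> C * (exp (L * t) * cmod (z - z0)) * (t - 0)"
    proof (rule integral_bound[OF t])
      show "continuous_on {0..t} (\<lambda>s. A z s - B s)"
        using cAB by (rule continuous_on_diff)
      show "cmod (A z s - B s) \<le> C * (exp (L * t) * cmod (z - z0))" if "s \<in> {0..t}" for s
        using AB[of s] that by simp
    qed
    finally show "cmod (I z - integral {0..t} B) \<le> C * (exp (L * t) * cmod (z - z0)) * t" by simp
  qed
  have "((\<lambda>z. I z - integral {0..t} B) \<longlongrightarrow> 0) (at z0)"
  proof (rule Lim_null_comparison)
    show "\<forall>\<^sub>F z in at z0. cmod (I z - integral {0..t} B) \<le> C * (exp (L * t) * cmod (z - z0)) * t"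
      using ev by eventually_elim (rule main(2); simp)
    have "((\<lambda>z. C * (exp (L * t) * cmod (z - z0)) * t) \<longlongrightarrow> C * (exp (L * t) * cmod (z0 - z0)) * t) (at z0)"
      by (intro tendsto_intros)
    then show "((\<lambda>z. C * (exp (L * t) * cmod (z - z0)) * t) \<longlongrightarrow> 0) (at z0)" by simp
  qed
  then have "(I \<longlongrightarrow> integral {0..t} B) (at z0)" by (rule Lim_null[THEN iffD2])
  then have "((\<lambda>z. exp (I z)) \<longlongrightarrow> exp (integral {0..t} B)) (at z0)" by (rule tendsto_exp)
  moreover have "\<forall>\<^sub>F z in at z0. exp (I z) = (flow t z - flow t z0) / (z - z0)"
    using ev by eventually_elim (rule main(1)[symmetric]; simp)
  ultimately have "((\<lambda>z. (flow t z - flow t z0) / (z - z0)) \<longlongrightarrow> exp (integral {0..t} B)) (at z0)"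
    by (rule Lim_transform_eventually)
  then show ?thesis by (auto simp: has_field_derivative_iff)
qed

lemma flow_semigroup: "is_semigroup flow"
  unfolding is_semigroup_def
proof (intro conjI allI impI ballI)
  show "flow t holomorphic_on ball 0 1" if "0 \<le> t" for t
    using flow_has_field_derivative[OF _ that] by (auto simp: holomorphic_on_open)
  show "flow t ` ball 0 1 \<subseteq> ball 0 1" if "0 \<le> t" for t
    using flow_in_ball that by auto
  show "flow 0 z = z" if "z \<in> ball 0 1" for z
    using that by (simp add: flow_0)
  show "flow s (flow t z) = flow (s + t) z" if "0 \<le> s" "0 \<le> t" "z \<in> ball 0 1" for s t z
    using that by (simp add: flow_flow)
  show "((\<lambda>t. flow t z) \<longlongrightarrow> z) (at_right 0)" if "z \<in> ball 0 1" for z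
  proof -
    have "continuous (at 0 within {0..}) (\<lambda>t. flow t z)"
      using flow_derivative[of z 0] that by (auto intro: has_vector_derivative_continuous)
    then show ?thesis
      using that by (simp add: continuous_within at_within_Ici_at_right flow_0)
  qed
qed

lemma flow_generator: "is_generator flow G"
  unfolding is_generator_def using holG flow_derivative by auto

end

text \<open>The displacement \<open>y s = \<phi>\<^sub>s(z) - \<sigma>\<close> solves \<open>y' = A y\<close> with \<open>A = G(\<phi>\<^sub>s(z)) / (\<phi>\<^sub>s(z) - \<sigma>)\<close> close to \<open>\<kappa>\<close>,
  uniformly on bounded time intervals, because a first-exit argument keeps the trajectory near \<open>\<sigma>\<close>.\<close>

lemma boundary_fixed_point_multiplier:
  assumes sg: "is_semigroup \<phi>" and gen: "is_generator \<phi> G" and \<sigma>: "cmod \<sigma> = 1"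
    and lim: "((\<lambda>w. G w / (w - \<sigma>)) \<longlongrightarrow> of_real \<kappa>) (at \<sigma> within ball 0 1)"
    and t: "0 \<le> t"
  shows "((\<lambda>z. (\<phi> t z - \<sigma>) / (z - \<sigma>)) \<longlongrightarrow> of_real (exp (\<kappa> * t))) (at \<sigma> within ball 0 1)"
proof -
  have holG: "G holomorphic_on ball 0 1" using gen by (simp add: is_generator_def)
  have in_ball: "cmod (\<phi> s z) < 1" if "cmod z < 1" "0 \<le> s" for s z
    using semigroup_in_ball[OF sg that(2,1)] .
  have \<phi>0: "\<phi> 0 z = z" if "cmod z < 1" for z
    using sg that by (auto simp: is_semigroup_def)
  have der: "((\<lambda>s. \<phi> s z) has_vector_derivative G (\<phi> s z)) (at s within {0..})"
    if "cmod z < 1" "0 \<le> s" for s z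
    using gen that by (auto simp: is_generator_def)
  have cont: "continuous_on {0..} (\<lambda>s. \<phi> s z)" if "cmod z < 1" for z
    by (rule continuous_on_has_vector_derivative_Ici) (rule der[OF that])
  have ne: "\<phi> s z - \<sigma> \<noteq> 0" if "cmod z < 1" "0 \<le> s" for s z
    using in_ball[OF that] \<sigma> by auto
  define A where "A = (\<lambda>z s. G (\<phi> s z) / (\<phi> s z - \<sigma>))"
  define I where "I = (\<lambda>z. integral {0..t} (A z))"
  have contA: "continuous_on {0..} (A z)" if z: "cmod z < 1" for z
    unfolding A_def
    by (intro continuous_on_divide continuous_on_diff continuous_on_const cont[OF z]
        continuous_on_compose2[OF holomorphic_on_imp_continuous_on[OF holG] cont[OF z]])
      (use in_ball ne z in auto)
  have quot: "(\<phi> t z - \<sigma>) / (z - \<sigma>) = exp (I z)" if z: "cmod z < 1" for z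
  proof -
    have "((\<lambda>s. \<phi> s z - \<sigma>) has_vector_derivative A z s * (\<phi> s z - \<sigma>)) (at s within {0..})" if "0 \<le> s" for s
      using has_vector_derivative_diff[OF der[OF z that] has_vector_derivative_const[of \<sigma>]] ne[OF z that]
      by (simp add: A_def)
    from linear_ODE_solution[OF contA[OF z] this t]
    have "\<phi> t z - \<sigma> = (z - \<sigma>) * exp (I z)" by (simp add: \<phi>0 z I_def)
    moreover have "z - \<sigma> \<noteq> 0" using z \<sigma> by auto
    ultimately show ?thesis by simp
  qed
  have "(I \<longlongrightarrow> of_real (\<kappa> * t)) (at \<sigma> within ball 0 1)"
  proof (rule tendstoI)
    fix e :: real assume e: "0 < e"
    define \<epsilon> where "\<epsilon> = e / (t + 1)"
    have \<epsilon>: "0 < \<epsilon>" "\<epsilon> * t < e" using e t by (auto simp: \<epsilon>_def field_simps)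
    from tendstoD[OF lim \<epsilon>(1)] obtain r where r: "0 < r"
      and A\<kappa>: "\<And>w. cmod w < 1 \<Longrightarrow> w \<noteq> \<sigma> \<Longrightarrow> dist w \<sigma> < r \<Longrightarrow> dist (G w / (w - \<sigma>)) (of_real \<kappa>) < \<epsilon>"
      unfolding eventually_at by auto
    \<comment> \<open>\<open>L\<close> bounds \<open>|A|\<close> within distance \<open>r\<close> of
      \<open>\<sigma>\<close>, so \<open>exp (L * t)\<close> is the largest factor by which the
      displacement can grow by time \<open>t\<close> while it stays there.\<close>
    define L where "L = \<bar>\<kappa>\<bar> + \<epsilon>"
    have est: "dist (I z) (of_real (\<kappa> * t)) < e"
      if z: "cmod z < 1" and zr: "exp (L * t) * cmod (z - \<sigma>) < r" for z
    proof -
      have AL: "cmod (G (\<phi> s z)) \<le> L * cmod (\<phi> s z - \<sigma>)" if "cmod (\<phi> s z - \<sigma>) < r" "0 \<le> s" for s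
      proof -
        have "cmod (A z s - of_real \<kappa>) < \<epsilon>"
          using A\<kappa>[OF in_ball[OF z that(2)]] ne[OF z that(2)] that(1) by (simp add: A_def dist_norm)
        then have "cmod (A z s) \<le> L"
          using norm_triangle_ineq2[of "A z s" "of_real \<kappa>"] by (simp add: L_def)
        then have "cmod (A z s) * cmod (\<phi> s z - \<sigma>) \<le> L * cmod (\<phi> s z - \<sigma>)"
          by (intro mult_right_mono) auto
        then show ?thesis using ne[OF z that(2)] by (simp add: A_def norm_divide)
      qed
      have near: "cmod (\<phi> s z - \<sigma>) < r" if s: "0 \<le> s" "s \<le> t" for s
      proof (rule ccontr)
        assume "\<not> cmod (\<phi> s z - \<sigma>) < r"
        moreover have "continuous_on {0..s} (\<lambda>s. cmod (\<phi> s z - \<sigma>))"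
          by (intro continuous_on_norm continuous_on_diff continuous_on_subset[OF cont[OF z]]) auto
        moreover have "1 * cmod (z - \<sigma>) \<le> exp (L * t) * cmod (z - \<sigma>)"
          using \<epsilon> t by (intro mult_right_mono) (auto simp: L_def)
        then have "cmod (\<phi> 0 z - \<sigma>) < r" using zr by (simp add: \<phi>0 z)
        ultimately obtain t0 where t0: "0 < t0" "t0 \<le> s" "cmod (\<phi> t0 z - \<sigma>) = r"
          "\<And>x. 0 \<le> x \<Longrightarrow> x < t0 \<Longrightarrow> cmod (\<phi> x z - \<sigma>) < r"
          using first_hitting_time[of s "\<lambda>s. cmod (\<phi> s z - \<sigma>)" r] s by auto
        have "cmod (\<phi> t0 z - \<sigma>) \<le> exp (L * t0) * cmod (\<phi> 0 z - \<sigma>)"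
        proof (rule Gronwall_upper[where y = "\<lambda>s. \<phi> s z - \<sigma>"])
          show "continuous_on {0..t0} (\<lambda>s. \<phi> s z - \<sigma>)"
            by (intro continuous_on_diff continuous_on_subset[OF cont[OF z]]) auto
          show "\<exists>D. ((\<lambda>s. \<phi> s z - \<sigma>) has_vector_derivative D) (at x within {0..}) \<and> cmod D \<le> L * cmod (\<phi> x z - \<sigma>)"
            if "0 < x" "x < t0" for x
            using has_vector_derivative_diff[OF der[OF z, of x] has_vector_derivative_const[of \<sigma>]] AL[of x] t0(4)[of x] that
            by (intro exI[of _ "G (\<phi> x z)"]) auto
        qed (use t0 in auto)
        also have "\<dots> \<le> exp (L * t) * cmod (\<phi> 0 z - \<sigma>)"
          using t0 s \<epsilon> by (intro mult_right_mono) (auto simp: L_def intro!: mult_left_mono)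
        also have "\<dots> < r" using zr by (simp add: \<phi>0 z)
        finally show False using t0 by simp
      qed
      have "I z - of_real (\<kappa> * t) = integral {0..t} (\<lambda>s. A z s - of_real \<kappa>)"
        unfolding I_def using t
        by (subst integral_diff)
           (auto intro!: integrable_continuous_real continuous_on_subset[OF contA[OF z]] simp: scaleR_conv_of_real)
      also have "cmod \<dots> \<le> \<epsilon> * (t - 0)"
      proof (rule integral_bound[OF t])
        show "continuous_on {0..t} (\<lambda>s. A z s - of_real \<kappa>)"
          by (intro continuous_on_diff continuous_on_subset[OF contA[OF z]]) auto
        show "cmod (A z s - of_real \<kappa>) \<le> \<epsilon>" if "s \<in> {0..t}" for s
          using A\<kappa>[OF in_ball[OF z, of s]] ne[OF z, of s] near[of s] that
          by (auto simp: A_def dist_norm intro: less_imp_le)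
      qed
      finally show ?thesis using \<epsilon> by (simp add: dist_norm)
    qed
    show "\<forall>\<^sub>F z in at \<sigma> within ball 0 1. dist (I z) (of_real (\<kappa> * t)) < e"
      unfolding eventually_at
    proof (intro exI[of _ "r / exp (L * t)"] conjI ballI impI)
      show "0 < r / exp (L * t)" using r by simp
      fix z assume "z \<in> ball 0 1" "z \<noteq> \<sigma> \<and> dist z \<sigma> < r / exp (L * t)"
      then show "dist (I z) (of_real (\<kappa> * t)) < e"
        by (intro est) (auto simp: dist_norm field_simps)
    qed
  qed
  then have "((\<lambda>z. exp (I z)) \<longlongrightarrow> exp (of_real (\<kappa> * t))) (at \<sigma> within ball 0 1)"
    by (rule tendsto_exp)
  moreover have "\<forall>\<^sub>F z in at \<sigma> within ball 0 1. exp (I z) = (\<phi> t z - \<sigma>) / (z - \<sigma>)"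
    using quot by (auto simp: eventually_at_filter)
  ultimately have "((\<lambda>z. (\<phi> t z - \<sigma>) / (z - \<sigma>)) \<longlongrightarrow> exp (of_real (\<kappa> * t))) (at \<sigma> within ball 0 1)"
    by (rule Lim_transform_eventually)
  then show ?thesis by (simp add: exp_of_real flip: of_real_mult)
qed

text \<open>An unrestricted limit within the disk contains all angular ones. The sign changes
  because the multiplier is \<open>exp (\<kappa> * t)\<close> while spectral values enter as
  \<open>exp (- l * t)\<close>.\<close>

lemma generator_limit_imp_BRFP:
  assumes sg: "is_semigroup \<phi>" and gen: "is_generator \<phi> G" and \<sigma>: "cmod \<sigma> = 1"
    and lim: "((\<lambda>w. G w / (w - \<sigma>)) \<longlongrightarrow> of_real \<kappa>) (at \<sigma> within ball 0 1)"
  shows "BRFP_spectral \<phi> \<sigma> (- \<kappa>)"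
  unfolding BRFP_spectral_def
proof (intro allI impI conjI)
  fix t :: real assume t: "0 \<le> t"
  note quot = boundary_fixed_point_multiplier[OF sg gen \<sigma> lim t]
  have ang: "angular_limit f \<sigma> l" if "(f \<longlongrightarrow> l) (at \<sigma> within ball 0 1)" for f l
    unfolding angular_limit_def
    by (intro allI impI tendsto_within_subset[OF that]) (auto simp: stolz_angle_def)
  show "angular_limit (\<lambda>z. (\<phi> t z - \<sigma>) / (z - \<sigma>)) \<sigma> (of_real (exp (- (- \<kappa>) * t)))"
    using quot by (intro ang) simp
  have "((\<lambda>z. \<sigma> + (\<phi> t z - \<sigma>) / (z - \<sigma>) * (z - \<sigma>)) \<longlongrightarrow> \<sigma> + of_real (exp (\<kappa> * t)) * (\<sigma> - \<sigma>)) (at \<sigma> within ball 0 1)"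
    by (intro tendsto_intros quot)
  moreover have "\<forall>\<^sub>F z in at \<sigma> within ball 0 1. \<sigma> + (\<phi> t z - \<sigma>) / (z - \<sigma>) * (z - \<sigma>) = \<phi> t z"
    by (auto simp: eventually_at_filter)
  ultimately have "(\<phi> t \<longlongrightarrow> \<sigma>) (at \<sigma> within ball 0 1)"
    by (auto intro: Lim_transform_eventually)
  then show "angular_limit (\<phi> t) \<sigma> \<sigma>" by (rule ang)
qed

section \<open>The value region\<close>

text \<open>One formula for all kernels that occur: \<open>c = 1 / \<sigma> j\<close> gives the
  Cayley kernel at \<open>\<sigma> j\<close>, other \<open>c\<close> the free remainder. Multiplying
  by \<open>w - s\<close> kills everything regular at \<open>s\<close> and extracts the residue at a
  pole.\<close>

lemma Cayley_pole_limit: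
  "((\<lambda>w. (w - s) * ((1 + c * w) / (1 - c * w))) \<longlongrightarrow> (if c * s = 1 then - 2 * s else 0)) (at s within S)"
    for c s :: complex
proof (cases "c * s = 1")
  case True
  then have c: "c \<noteq> 0" by auto
  have "((\<lambda>w. - (s + w)) \<longlongrightarrow> - (s + s)) (at s within S)"
    by (intro tendsto_intros)
  moreover have "- (s + w) = (w - s) * ((1 + c * w) / (1 - c * w))" if "w \<noteq> s" for w
  proof -
    have eq: "1 + c * w = c * (s + w)" "1 - c * w = c * (s - w)"
      using True by (simp_all add: algebra_simps)
    show ?thesis unfolding eq using c that by (simp add: field_simps)
  qed
  then have "\<forall>\<^sub>F w in at s within S. - (s + w) = (w - s) * ((1 + c * w) / (1 - c * w))"
    by (simp add: eventually_at_filter)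
  ultimately show ?thesis using True by (auto intro: Lim_transform_eventually)
next
  case False
  then have "((\<lambda>w. (w - s) * ((1 + c * w) / (1 - c * w))) \<longlongrightarrow> (s - s) * ((1 + c * s) / (1 - c * s))) (at s within S)"
    by (intro tendsto_intros) auto
  then show ?thesis using False by simp
qed

text \<open>The points with \<open>|v - x| = r |v + x|\<close> form an Apollonius circle with centre
  \<open>m * x\<close> and radius \<open>k * x\<close>, where \<open>m^2 - k^2 = 1\<close>. With
  \<open>r = |\<tau>|\<close> this explains the coefficients in \<open>acen\<close> and
  \<open>Omega\<close>.\<close>

lemma disk_identity:
  fixes x r :: real
  assumes "r\<^sup>2 \<noteq> 1"
  shows "(cmod (v - of_real x))\<^sup>2 - (r * cmod (v + of_real x))\<^sup>2 =
    (1 - r\<^sup>2) * ((cmod (v - of_real ((1 + r\<^sup>2) / (1 - r\<^sup>2) * x)))\<^sup>2 - (2 * r / (1 - r\<^sup>2) * x)\<^sup>2)"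
proof -
  define d where "d = 1 - r\<^sup>2"
  define m where "m = (1 + r\<^sup>2) / d"
  define k where "k = 2 * r / d"
  have d: "d \<noteq> 0" using assms by (simp add: d_def)
  have dm: "d * m = 1 + r\<^sup>2" using d by (simp add: m_def)
  have "m\<^sup>2 - k\<^sup>2 = ((1 + r\<^sup>2)\<^sup>2 - (2 * r)\<^sup>2) / d\<^sup>2"
    by (simp add: m_def k_def power_divide diff_divide_distrib)
  also have "(1 + r\<^sup>2)\<^sup>2 - (2 * r)\<^sup>2 = d\<^sup>2"
    by (simp add: d_def power2_eq_square algebra_simps)
  finally have mk: "m\<^sup>2 - k\<^sup>2 = 1" using d by simp
  have "(cmod (v - of_real (m * x)))\<^sup>2 - (k * x)\<^sup>2 = (cmod v)\<^sup>2 - 2 * m * x * Re v + (m\<^sup>2 - k\<^sup>2) * x\<^sup>2"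
    by (simp add: cmod_power2) (simp add: power2_eq_square algebra_simps)
  then have "d * ((cmod (v - of_real (m * x)))\<^sup>2 - (k * x)\<^sup>2) = d * ((cmod v)\<^sup>2 - 2 * m * x * Re v + 1 * x\<^sup>2)"
    by (simp only: mk)
  also have "\<dots> = d * (cmod v)\<^sup>2 - 2 * (d * m) * x * Re v + d * x\<^sup>2"
    by (simp add: algebra_simps)
  also have "\<dots> = (1 - r\<^sup>2) * (cmod v)\<^sup>2 - 2 * (1 + r\<^sup>2) * x * Re v + (1 - r\<^sup>2) * x\<^sup>2"
    unfolding dm by (simp add: d_def)
  also have "\<dots> = (cmod (v - of_real x))\<^sup>2 - (r * cmod (v + of_real x))\<^sup>2"
    unfolding cmod_power2 power_mult_distrib by (simp add: power2_eq_square algebra_simps)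
  finally show ?thesis by (simp add: m_def k_def d_def)
qed

lemma disk_iff:
  fixes x r :: real and v :: complex
  assumes r: "0 \<le> r" "r < 1" and x: "0 \<le> x"
  defines "C \<equiv> cmod (v - of_real ((1 + r\<^sup>2) / (1 - r\<^sup>2) * x))" and "R \<equiv> 2 * r / (1 - r\<^sup>2) * x"
  shows "C \<le> R \<longleftrightarrow> cmod (v - of_real x) \<le> r * cmod (v + of_real x)"
    and "C = R \<longleftrightarrow> cmod (v - of_real x) = r * cmod (v + of_real x)"
proof -
  have d: "0 < 1 - r\<^sup>2" using r by (simp add: power_less_one_iff abs_square_less_1)
  have id: "(cmod (v - of_real x))\<^sup>2 - (r * cmod (v + of_real x))\<^sup>2 = (1 - r\<^sup>2) * (C\<^sup>2 - R\<^sup>2)"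
    unfolding C_def R_def using d by (intro disk_identity) auto
  have nn: "0 \<le> C" "0 \<le> R" "0 \<le> cmod (v - of_real x)" "0 \<le> r * cmod (v + of_real x)"
    using r x d by (auto simp: C_def R_def)
  have "C \<le> R \<longleftrightarrow> C\<^sup>2 - R\<^sup>2 \<le> 0"
    using nn power_mono_iff[of C R 2] by auto
  also have "\<dots> \<longleftrightarrow> (1 - r\<^sup>2) * (C\<^sup>2 - R\<^sup>2) \<le> 0" using d by (simp add: mult_le_0_iff)
  also have "\<dots> \<longleftrightarrow> cmod (v - of_real x) \<le> r * cmod (v + of_real x)"
    using nn power_mono_iff[of "cmod (v - of_real x)" "r * cmod (v + of_real x)" 2] unfolding id[symmetric] by auto
  finally show "C \<le> R \<longleftrightarrow> cmod (v - of_real x) \<le> r * cmod (v + of_real x)" .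
  have "C = R \<longleftrightarrow> C\<^sup>2 - R\<^sup>2 = 0"
    using nn power2_eq_iff_nonneg[of C R] by auto
  also have "\<dots> \<longleftrightarrow> (1 - r\<^sup>2) * (C\<^sup>2 - R\<^sup>2) = 0" using d by auto
  also have "\<dots> \<longleftrightarrow> cmod (v - of_real x) = r * cmod (v + of_real x)"
    using nn power2_eq_iff_nonneg[of "cmod (v - of_real x)" "r * cmod (v + of_real x)"] unfolding id[symmetric] by auto
  finally show "C = R \<longleftrightarrow> cmod (v - of_real x) = r * cmod (v + of_real x)" .
qed

text \<open>Pick's inequality with the second point at 0, rewritten as the Schwarz lemma for the
  Cayley transform normalised at 0.\<close>

lemma half_plane_value_disk:
  assumes "q holomorphic_on ball 0 1" "\<And>z. cmod z < 1 \<Longrightarrow> 0 \<le> Re (q z)" and z: "cmod z < 1"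
  defines "v \<equiv> q z - \<i> * of_real (Im (q 0))"
  shows "cmod (v - of_real (Re (q 0))) \<le> cmod z * cmod (v + of_real (Re (q 0)))"
proof -
  have eq: "q z + cnj (q 0) = v + of_real (Re (q 0))"
    by (simp add: v_def complex_eq_iff)
  have "(1 - (cmod z)\<^sup>2) * (cmod (v + of_real (Re (q 0))))\<^sup>2 \<le> 4 * Re (q 0) * Re v"
    using Pick_half_plane[OF assms(1,2) z, of 0] by (simp add: eq) (simp add: v_def)
  moreover have "(cmod (v - of_real (Re (q 0))))\<^sup>2 = (cmod (v + of_real (Re (q 0))))\<^sup>2 - 4 * Re (q 0) * Re v"
    by (simp add: cmod_power2) (simp add: power2_eq_square algebra_simps)
  ultimately have "(cmod (v - of_real (Re (q 0))))\<^sup>2 \<le> (cmod z * cmod (v + of_real (Re (q 0))))\<^sup>2"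
    by (simp add: power_mult_distrib algebra_simps)
  then show ?thesis by (rule power2_le_imp_le) simp
qed

text \<open>Equality in the Schwarz lemma for the normalised Cayley transform \<open>f\<close> of
  \<open>q\<close> makes it a rotation, \<open>f z = \<alpha> z\<close>, and solving for
  \<open>q\<close> gives a Cayley kernel with pole at \<open>s = cnj \<alpha>\<close>. The pole is
  given by a formula in \<open>v\<close> instead of existentially, so that all extremal functions
  with the same values at 0 and \<open>w\<close> share it: this is the source of uniqueness.\<close>

lemma half_plane_extremal:
  assumes holq: "q holomorphic_on ball 0 1" and pos: "\<And>z. cmod z < 1 \<Longrightarrow> 0 \<le> Re (q z)"
    and x: "0 < Re (q 0)" and w: "cmod w < 1" "w \<noteq> 0"
    and v_def: "v = q w - \<i> * of_real (Im (q 0))"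
    and s_def: "s = cnj ((v - of_real (Re (q 0))) / ((v + of_real (Re (q 0))) * w))"
    and ext: "cmod (v - of_real (Re (q 0))) = cmod w * cmod (v + of_real (Re (q 0)))"
    and z: "cmod z < 1"
  shows "q z = (s + z) / (s - z) * of_real (Re (q 0)) + \<i> * of_real (Im (q 0))" and "cmod s = 1"
proof -
  let ?x = "complex_of_real (Re (q 0))"
  define h where "h = (\<lambda>z. q z - \<i> * of_real (Im (q 0)))"
  define f where "f = (\<lambda>z. (h z - ?x) / (h z + ?x))"
  have z0: "cmod (0 :: complex) < 1" by simp
  have posq: "0 < Re (q u)" if "cmod u < 1" for u
    by (rule half_plane_Re_pos[OF holq pos z0 x that])
  have nz: "h u + ?x \<noteq> 0" if "cmod u < 1" for u
    using posq[OF that] x by (auto simp: h_def complex_eq_iff)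
  have holf: "f holomorphic_on ball 0 1"
    unfolding f_def h_def using nz by (intro holomorphic_intros holq) (auto simp: h_def)
  have "h 0 = ?x" by (simp add: h_def complex_eq_iff)
  then have f0: "f 0 = 0" by (simp add: f_def)
  have fle: "cmod (f u) < 1" if "cmod u < 1" for u
  proof -
    have "(cmod (h u - ?x))\<^sup>2 < (cmod (h u + ?x))\<^sup>2"
      using posq[OF that] x unfolding cmod_power2 by (simp add: h_def power2_eq_square algebra_simps)
    then have "cmod (h u - ?x) < cmod (h u + ?x)"
      by (rule power2_less_imp_less) simp
    then show ?thesis using nz[OF that] by (simp add: f_def norm_divide)
  qed
  have vh: "v = h w" by (simp add: v_def h_def)
  have fw: "cmod (f w) = cmod w"
    using ext nz[OF w(1)] unfolding vh f_def norm_divide by simp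
  obtain \<alpha> where \<alpha>: "\<And>z. cmod z < 1 \<Longrightarrow> f z = \<alpha> * z" "cmod \<alpha> = 1"
    using Schwarz_Lemma(3)[OF holf f0 fle z] w fw by blast
  have "\<alpha> = f w / w" using \<alpha>(1)[OF w(1)] w(2) by simp
  then have s\<alpha>: "s = cnj \<alpha>" by (simp add: s_def f_def vh)
  then show s1: "cmod s = 1" using \<alpha>(2) by simp
  have "s * \<alpha> = 1" using \<alpha>(2) complex_norm_square[of \<alpha>] by (simp add: s\<alpha> mult.commute)
  have sz: "s - z \<noteq> 0" using s1 z by auto
  have "s * (h z - ?x) = s * (f z * (h z + ?x))"
    using nz[OF z] by (simp add: f_def)
  also have "\<dots> = (s * \<alpha>) * z * (h z + ?x)"
    by (simp add: \<alpha>(1)[OF z])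
  finally have "s * (h z - ?x) = z * (h z + ?x)" by (simp add: \<open>s * \<alpha> = 1\<close>)
  then have "h z * (s - z) = (s + z) * ?x" by (simp add: algebra_simps)
  then have "h z = (s + z) / (s - z) * ?x" using sz by (simp add: field_simps)
  then show "q z = (s + z) / (s - z) * ?x + \<i> * of_real (Im (q 0))"
    by (simp add: h_def algebra_simps)
qed

section \<open>The data of the problem and the fields that attain the region\<close>

locale BRFP_data =
  fixes \<tau> :: complex and n :: nat and \<sigma> :: "nat \<Rightarrow> complex" and lam :: "nat \<Rightarrow> real"
  assumes n_pos: "1 \<le> n"
    and sigma_bd: "\<forall>k\<in>{1..n}. cmod (\<sigma> k) = 1"
    and sigma_inj: "inj_on \<sigma> {1..n}"
    and lam_neg: "\<forall>k\<in>{1..n}. lam k < 0"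
    and tau_in: "cmod \<tau> < 1" and tau_nz: "\<tau> \<noteq> 0"
begin

abbreviation "\<alpha> \<equiv> alpha \<tau> \<sigma> lam"
abbreviation "P \<equiv> p0 \<tau> n \<sigma> lam"
abbreviation "A \<equiv> \<Sum>k=1..n. \<alpha> k"
abbreviation "el \<equiv> ell \<tau> n \<sigma> lam"
abbreviation "GF \<equiv> GenFL \<tau> n \<sigma> lam"
abbreviation "V \<equiv> value_region \<tau> n \<sigma> lam"

lemma sigma_nz: assumes "k \<in> {1..n}" shows "\<sigma> k \<noteq> 0"
proof -
  have "cmod (\<sigma> k) = 1" using sigma_bd assms by blast
  then show ?thesis by auto
qed

lemma alpha_gt_0: "k \<in> {1..n} \<Longrightarrow> 0 < \<alpha> k"
  using alpha_pos[OF tau_in] sigma_bd lam_neg by auto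

lemma A_pos: "0 < A"
  using n_pos alpha_gt_0 by (intro sum_pos) auto

lemma tau_sq: "0 < 1 - (cmod \<tau>)\<^sup>2"
  using cmod_square_less_one[OF tau_in] by simp

lemma P_holomorphic: "P holomorphic_on ball 0 1"
  unfolding p0_def using sigma_bd by (intro holomorphic_intros) auto

lemma Re_P_pos: assumes z: "cmod z < 1" shows "0 < Re (P z)"
proof -
  have "Re (P z) = (\<Sum>k=1..n. \<alpha> k * Re ((\<sigma> k + z) / (\<sigma> k - z)))"
    unfolding p0_def Re_sum Re_of_real_mult ..
  also have "0 < \<dots>"
  proof (rule sum_pos)
    fix k assume k: "k \<in> {1..n}"
    then have s: "cmod (\<sigma> k) = 1" using sigma_bd by auto
    then have "\<sigma> k - z \<noteq> 0" using z by auto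
    then have "0 < Re ((\<sigma> k + z) / (\<sigma> k - z))"
      unfolding Re_Cayley[OF s] using cmod_square_less_one[OF z] by simp
    then show "0 < \<alpha> k * Re ((\<sigma> k + z) / (\<sigma> k - z))"
      using alpha_gt_0[OF k] by simp
  qed (use n_pos in auto)
  finally show ?thesis .
qed

lemma P_0: "P 0 = of_real A"
proof -
  have "P 0 = (\<Sum>k=1..n. of_real (\<alpha> k))"
    unfolding p0_def using sigma_nz by (intro sum.cong) auto
  then show ?thesis by simp
qed

lemma values_of_field:
  assumes holq: "q holomorphic_on ball 0 1" and nz: "\<And>z. cmod z < 1 \<Longrightarrow> P z + q z \<noteq> 0"
    and G: "\<And>z. cmod z < 1 \<Longrightarrow> G z = (\<tau> - z) * (1 - cnj \<tau> * z) / (P z + q z)"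
  shows "G 0 = \<tau> / (of_real A + q 0)"
    and "spec_val \<tau> G = of_real (1 - (cmod \<tau>)\<^sup>2) / (P \<tau> + q \<tau>)"
proof -
  show "G 0 = \<tau> / (of_real A + q 0)" using G[of 0] P_0 by simp
  define h where "h = (\<lambda>z. (1 - cnj \<tau> * z) / (P z + q z))"
  have "h holomorphic_on ball 0 1"
    unfolding h_def using nz by (intro holomorphic_intros holq P_holomorphic) auto
  then have h: "(h has_field_derivative deriv h \<tau>) (at \<tau>)"
    using tau_in by (intro holomorphic_derivI) auto
  have "((\<lambda>z. (\<tau> - z) * h z) has_field_derivative - h \<tau>) (at \<tau>)"
    by (rule derivative_eq_intros h refl)+ simp
  then have "(G has_field_derivative - h \<tau>) (at \<tau>)"
    by (rule has_field_derivative_transform_within_open[where S = "ball 0 1"])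
       (use tau_in G in \<open>auto simp: h_def\<close>)
  then have "deriv G \<tau> = - h \<tau>" by (rule DERIV_imp_deriv)
  then show "spec_val \<tau> G = of_real (1 - (cmod \<tau>)\<^sup>2) / (P \<tau> + q \<tau>)"
    unfolding spec_val_def h_def of_real_diff complex_norm_square by (simp add: mult.commute)
qed

text \<open>The remainder has real part \<open>x\<close> and imaginary part \<open>y\<close> at 0,
  and its normalised Cayley transform is \<open>c z\<close>. As \<open>c\<close> runs over the
  closed unit disk, \<open>c \<tau>\<close> fills the disk allowed by the Schwarz lemma; for
  \<open>|c| = 1\<close> the remainder is a Cayley kernel with pole at \<open>1 / c\<close>.\<close>

definition field_of :: "complex \<Rightarrow> real \<Rightarrow> real \<Rightarrow> complex \<Rightarrow> complex" where
  "field_of c x y z = (\<tau> - z) * (1 - cnj \<tau> * z) /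
     (P z + (of_real x * ((1 + c * z) / (1 - c * z)) + \<i> * of_real y))"

lemma field_of_in_GenFL:
  fixes x y :: real
  assumes c: "cmod c \<le> 1" and x: "0 \<le> x"
  defines "q \<equiv> \<lambda>z. of_real x * ((1 + c * z) / (1 - c * z)) + \<i> * of_real y"
  shows "q holomorphic_on ball 0 1" and "\<And>z. cmod z < 1 \<Longrightarrow> 0 < Re (P z + q z)"
    and "field_of c x y \<in> GF"
proof -
  have c1: "1 - c * z \<noteq> 0" if "cmod z < 1" for z
    using one_minus_cnj_mult_nonzero[of "cnj z" c] c that by (simp add: mult.commute)
  show holq: "q holomorphic_on ball 0 1"
    unfolding q_def using c1 by (intro holomorphic_intros) auto
  have posq: "0 \<le> Re (q z)" if z: "cmod z < 1" for z
  proof -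
    have "cmod (c * z) \<le> 1 * 1" unfolding norm_mult using c z by (intro mult_mono) auto
    then have "0 \<le> Re ((1 + c * z) / (1 - c * z))"
      unfolding Re_Cayley[of 1 "c * z", OF norm_one] by (simp add: power_le_one)
    then have "0 \<le> Re (of_real x * ((1 + c * z) / (1 - c * z)))"
      unfolding Re_of_real_mult using x by simp
    then show ?thesis unfolding q_def by simp
  qed
  show pos: "0 < Re (P z + q z)" if "cmod z < 1" for z
    using Re_P_pos[OF that] posq[OF that] by simp
  define p where "p = (\<lambda>z. 1 / (P z + q z))"
  have nz: "P z + q z \<noteq> 0" if "cmod z < 1" for z
    using pos[OF that] by (metis less_irrefl zero_complex.sel(1))
  let ?G = "field_of c x y"
  have field_eq: "?G z = (\<tau> - z) * (1 - cnj \<tau> * z) / (P z + q z)" for z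
    by (simp add: field_of_def q_def)
  interpret Berkson_Porta_field \<tau> p ?G
  proof
    show "p holomorphic_on ball 0 1"
      unfolding p_def using nz by (intro holomorphic_intros P_holomorphic holq) auto
    show "0 \<le> Re (p z)" if "cmod z < 1" for z
      unfolding p_def Re_inverse_half_plane using pos[OF that] by simp
  qed (use tau_in in \<open>auto simp: field_eq p_def\<close>)
  have br: "\<exists>l. lam k \<le> l \<and> l \<le> 0 \<and> BRFP_spectral flow (\<sigma> k) l" if k: "k \<in> {1..n}" for k
  proof -
    define s where "s = \<sigma> k"
    have s: "cmod s = 1" "s \<noteq> 0" using sigma_bd sigma_nz[OF k] k unfolding s_def by blast+
    \<comment> \<open>The remainder has its own boundary pole when \<open>|c| = 1\<close> and
      \<open>x > 0\<close>; if that pole falls on \<open>\<sigma> k\<close>, its mass adds to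
      \<open>\<alpha> k\<close>.\<close>
    define \<beta> where "\<beta> = \<alpha> k + (if c * s = 1 then x else 0)"
    have \<beta>: "\<alpha> k \<le> \<beta>" "0 < \<beta>" using alpha_gt_0[OF k] x by (auto simp: \<beta>_def)
    let ?K = "\<lambda>c w. (w - s) * ((1 + c * w) / (1 - c * w))"
    let ?k = "\<lambda>c. if c * s = 1 then - 2 * s else 0"
    have lim_P: "((\<lambda>w. \<Sum>j=1..n. of_real (\<alpha> j) * ?K (1 / \<sigma> j) w) \<longlongrightarrow>
        (\<Sum>j=1..n. of_real (\<alpha> j) * ?k (1 / \<sigma> j))) (at s within ball 0 1)"
      by (rule tendsto_sum, rule tendsto_mult_left, rule Cayley_pole_limit)
    have lim_x: "((\<lambda>w. of_real x * ?K c w) \<longlongrightarrow> of_real x * ?k c) (at s within ball 0 1)"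
      by (rule tendsto_mult_left, rule Cayley_pole_limit)
    have lim_y: "((\<lambda>w. (w - s) * (\<i> * of_real y)) \<longlongrightarrow> (s - s) * (\<i> * of_real y)) (at s within ball 0 1)"
      by (intro tendsto_intros)
    have "(\<Sum>j=1..n. of_real (\<alpha> j) * ?k (1 / \<sigma> j)) = (\<Sum>j=1..n. if j = k then of_real (\<alpha> k) * (- 2 * s) else 0)"
    proof (rule sum.cong)
      fix j assume j: "j \<in> {1..n}"
      have iff: "1 / \<sigma> j * s = 1 \<longleftrightarrow> j = k"
        using sigma_nz[OF j] inj_on_eq_iff[OF sigma_inj k j] by (auto simp: s_def)
      show "of_real (\<alpha> j) * ?k (1 / \<sigma> j) = (if j = k then of_real (\<alpha> k) * (- 2 * s) else 0)"
        unfolding iff by (cases "j = k") simp_all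
    qed simp
    then have sum_k: "(\<Sum>j=1..n. of_real (\<alpha> j) * ?k (1 / \<sigma> j)) = of_real (\<alpha> k) * (- 2 * s)"
      using k by simp
    have val: "(\<Sum>j=1..n. of_real (\<alpha> j) * ?k (1 / \<sigma> j)) + of_real x * ?k c + (s - s) * (\<i> * of_real y) = - 2 * s * of_real \<beta>"
      unfolding sum_k by (simp add: \<beta>_def algebra_simps)
    note lim = tendsto_add[OF tendsto_add[OF lim_P lim_x] lim_y, unfolded val]
    have Q_eq: "(\<Sum>j=1..n. of_real (\<alpha> j) * ?K (1 / \<sigma> j) w) + of_real x * ?K c w + (w - s) * (\<i> * of_real y) = (w - s) * (P w + q w)" for w :: complex
    proof -
      have "of_real (\<alpha> j) * ((w - s) * ((1 + 1 / \<sigma> j * w) / (1 - 1 / \<sigma> j * w))) =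
          (w - s) * (of_real (\<alpha> j) * ((\<sigma> j + w) / (\<sigma> j - w)))" if "j \<in> {1..n}" for j
      proof -
        have sj: "\<sigma> j \<noteq> 0" using sigma_nz that by blast
        have "1 + 1 / \<sigma> j * w = (\<sigma> j + w) / \<sigma> j" "1 - 1 / \<sigma> j * w = (\<sigma> j - w) / \<sigma> j"
          using sj by (simp_all add: field_simps)
        then show ?thesis using sj by simp
      qed
      then have "(\<Sum>j=1..n. of_real (\<alpha> j) * ((w - s) * ((1 + 1 / \<sigma> j * w) / (1 - 1 / \<sigma> j * w)))) = (w - s) * P w"
        unfolding p0_def sum_distrib_left by (intro sum.cong) auto
      then show ?thesis by (simp add: q_def algebra_simps)
    qed
    have Q: "((\<lambda>w. (w - s) * (P w + q w)) \<longlongrightarrow> - 2 * s * of_real \<beta>) (at s within ball 0 1)"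
      using lim unfolding Q_eq .
    \<comment> \<open>The limit of \<open>G w / (w - s)\<close>. At
      \<open>\<beta> = \<alpha> k\<close> it would be exactly \<open>- lam k\<close>; a larger mass
      only moves the spectral value \<open>- \<kappa>\<close> closer to 0.\<close>
    define \<kappa> where "\<kappa> = (cmod (s - \<tau>))\<^sup>2 / (2 * \<beta>)"
    have "((\<lambda>w. (\<tau> - w) * (1 - cnj \<tau> * w) / ((w - s) * (P w + q w))) \<longlongrightarrow>
        (\<tau> - s) * (1 - cnj \<tau> * s) / (- 2 * s * of_real \<beta>)) (at s within ball 0 1)"
      using s \<beta> by (intro tendsto_intros Q) auto
    moreover have "(\<tau> - s) * (1 - cnj \<tau> * s) / (- 2 * s * of_real \<beta>) = of_real \<kappa>"
      unfolding moebius_factor_at_unit[OF s(1)] \<kappa>_def using s by simp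
    moreover have "(\<tau> - w) * (1 - cnj \<tau> * w) / ((w - s) * (P w + q w)) = ?G w / (w - s)" for w
      by (simp add: field_eq mult.commute)
    ultimately have "((\<lambda>w. ?G w / (w - s)) \<longlongrightarrow> of_real \<kappa>) (at s within ball 0 1)"
      by (simp only:)
    from generator_limit_imp_BRFP[OF flow_semigroup flow_generator s(1) this]
    have "BRFP_spectral flow (\<sigma> k) (- \<kappa>)" by (simp add: s_def)
    moreover have "- \<kappa> \<le> 0" using \<beta> by (simp add: \<kappa>_def)
    moreover have "lam k \<le> - \<kappa>"
    proof -
      have l: "lam k < 0" using lam_neg k by auto
      have "0 < (cmod (s - \<tau>))\<^sup>2" using s tau_in by auto
      then have "\<kappa> \<le> (cmod (s - \<tau>))\<^sup>2 / (2 * \<alpha> k)"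
        unfolding \<kappa>_def using \<beta> alpha_gt_0[OF k] by (intro divide_left_mono) auto
      also have "\<dots> = - lam k"
        using \<open>0 < (cmod (s - \<tau>))\<^sup>2\<close> l unfolding alpha_def s_def[symmetric]
        by (subst abs_of_neg) (auto simp: norm_minus_commute)
      finally show ?thesis by simp
    qed
    ultimately show ?thesis by blast
  qed
  have "?G 0 \<noteq> 0" using nz[of 0] tau_nz by (simp add: field_eq)
  then have nontriv: "\<exists>z\<in>ball 0 1. ?G z \<noteq> 0" by (intro bexI[of _ 0]) auto
  have "DW_interior flow \<tau>"
    unfolding DW_interior_def
    using tau_in flow_fixes nontrivial_generator_imp_nontrivial_semigroup[OF flow_semigroup flow_generator nontriv] by auto
  then show "?G \<in> GF"
    unfolding GenFL_def using flow_semigroup flow_generator br by blast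
qed

section \<open>The set of values at 0 as a half-plane and as a disk\<close>

lemma Zset_norm:
  assumes "\<zeta> \<noteq> 0"
  shows "cmod ((2 / \<tau> * of_real A) * \<zeta> - 1) = cmod (el \<zeta> - of_real A) / cmod (el \<zeta> + of_real A)"
proof -
  have "el \<zeta> + of_real A = \<tau> / \<zeta>" by (simp add: ell_def)
  moreover have "(2 / \<tau> * of_real A) * \<zeta> - 1 = - (el \<zeta> - of_real A) / (\<tau> / \<zeta>)"
    using assms tau_nz by (simp add: ell_def field_simps)
  ultimately show ?thesis by (metis norm_divide norm_minus_cancel)
qed

text \<open>Since \<open>el \<zeta> + A = \<tau> / \<zeta>\<close>, the map \<open>el\<close> turns
  the disk condition into \<open>|v - A| \<le> |v + A|\<close>, a right half-plane. This matches
  \<open>q 0 = el (G 0)\<close> with \<open>Re q \<ge> 0\<close>.\<close>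

lemma Zset_iff:
  assumes "\<zeta> \<noteq> 0"
  shows "\<zeta> \<in> Zset \<tau> n \<sigma> lam \<longleftrightarrow> 0 \<le> Re (el \<zeta>)"
    and "cmod ((2 / \<tau> * of_real A) * \<zeta> - 1) < 1 \<longleftrightarrow> 0 < Re (el \<zeta>)"
proof -
  let ?v = "el \<zeta>"
  have "?v + of_real A = \<tau> / \<zeta>" by (simp add: ell_def)
  then have pos: "0 < cmod (?v + of_real A)" using assms tau_nz by simp
  have id: "(cmod (?v + of_real A))\<^sup>2 - (cmod (?v - of_real A))\<^sup>2 = 4 * A * Re ?v"
    by (simp add: cmod_power2 del: of_real_sum) (simp add: power2_eq_square algebra_simps)
  have "\<zeta> \<in> Zset \<tau> n \<sigma> lam \<longleftrightarrow> cmod (?v - of_real A) \<le> cmod (?v + of_real A)"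
    unfolding Zset_def mem_Collect_eq Zset_norm[OF assms] using pos by (simp add: divide_le_eq)
  also have "\<dots> \<longleftrightarrow> (cmod (?v - of_real A))\<^sup>2 \<le> (cmod (?v + of_real A))\<^sup>2"
    by (simp only: power_mono_iff norm_ge_zero zero_less_numeral)
  also have "\<dots> \<longleftrightarrow> 0 \<le> A * Re ?v" using id by linarith
  finally show "\<zeta> \<in> Zset \<tau> n \<sigma> lam \<longleftrightarrow> 0 \<le> Re (el \<zeta>)" using A_pos by (simp add: zero_le_mult_iff)
  have "cmod ((2 / \<tau> * of_real A) * \<zeta> - 1) < 1 \<longleftrightarrow> cmod (?v - of_real A) < cmod (?v + of_real A)"
    unfolding Zset_norm[OF assms] using pos by (simp add: divide_less_eq)
  also have "\<dots> \<longleftrightarrow> (cmod (?v - of_real A))\<^sup>2 < (cmod (?v + of_real A))\<^sup>2"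
    by (metis norm_ge_zero power2_less_imp_less power_strict_mono zero_less_numeral)
  also have "\<dots> \<longleftrightarrow> 0 < A * Re ?v" using id by linarith
  finally show "cmod ((2 / \<tau> * of_real A) * \<zeta> - 1) < 1 \<longleftrightarrow> 0 < Re (el \<zeta>)"
    using A_pos by (simp add: zero_less_mult_iff)
qed

lemma Zset_norm_dist:
  "cmod ((2 / \<tau> * of_real A) * \<zeta> - 1) = 2 * A / cmod \<tau> * dist (\<tau> / (2 * of_real A)) \<zeta>"
proof -
  let ?m = "2 / \<tau> * complex_of_real A"
  have A0: "complex_of_real A \<noteq> 0" using A_pos by (simp del: of_real_sum)
  have "?m * \<zeta> - 1 = - (?m * (\<tau> / (2 * of_real A) - \<zeta>))"
    using tau_nz A0 by (simp add: field_simps del: of_real_sum)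
  then have "cmod (?m * \<zeta> - 1) = cmod ?m * dist (\<tau> / (2 * of_real A)) \<zeta>"
    by (metis norm_minus_cancel norm_mult dist_norm)
  moreover have "cmod ?m = 2 * A / cmod \<tau>"
    using A_pos by (simp add: norm_mult norm_divide del: of_real_sum)
  ultimately show ?thesis by simp
qed

lemma Zset_norm_iff:
  "cmod ((2 / \<tau> * of_real A) * \<zeta> - 1) \<le> 1 \<longleftrightarrow> dist (\<tau> / (2 * of_real A)) \<zeta> \<le> cmod \<tau> / (2 * A)"
  "cmod ((2 / \<tau> * of_real A) * \<zeta> - 1) < 1 \<longleftrightarrow> dist (\<tau> / (2 * of_real A)) \<zeta> < cmod \<tau> / (2 * A)"
  unfolding Zset_norm_dist using A_pos tau_nz by (simp_all add: field_simps del: of_real_sum)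

lemma Zset_cball: "Zset \<tau> n \<sigma> lam = cball (\<tau> / (2 * of_real A)) (cmod \<tau> / (2 * A))"
  unfolding Zset_def Zset_norm_iff by auto

lemma Zset_interior_frontier:
  assumes "\<zeta> \<noteq> 0"
  shows "0 < Re (el \<zeta>) \<Longrightarrow> \<zeta> \<in> interior (Zset \<tau> n \<sigma> lam)"
    and "Re (el \<zeta>) = 0 \<Longrightarrow> \<zeta> \<in> frontier (Zset \<tau> n \<sigma> lam)"
proof -
  show "\<zeta> \<in> interior (Zset \<tau> n \<sigma> lam)" if "0 < Re (el \<zeta>)"
    using that Zset_iff(2)[OF assms] unfolding Zset_cball interior_cball Zset_norm_iff mem_ball by blast
  show "\<zeta> \<in> frontier (Zset \<tau> n \<sigma> lam)" if "Re (el \<zeta>) = 0"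
  proof -
    have "0 < cmod \<tau> / (2 * A)" using A_pos tau_nz by simp
    then show ?thesis
      using that Zset_iff[OF assms] unfolding Zset_norm_iff Zset_cball
      by (auto simp: frontier_cball simp del: of_real_sum)
  qed
qed

section \<open>Necessity of the inequalities and attainment of every point\<close>

lemma representation:
  assumes "G \<in> GF" "\<exists>z\<in>ball 0 1. G z \<noteq> 0"
  shows "\<exists>q. q holomorphic_on ball 0 1 \<and> (\<forall>z. cmod z < 1 \<longrightarrow> 0 \<le> Re (q z)) \<and>
    (\<forall>z. cmod z < 1 \<longrightarrow> G z = (\<tau> - z) * (1 - cnj \<tau> * z) / (P z + q z)) \<and>
    G 0 = \<tau> / (of_real A + q 0) \<and> G 0 \<noteq> 0 \<and> q 0 = el (G 0) \<and>
    spec_val \<tau> G = of_real (1 - (cmod \<tau>)\<^sup>2) / (P \<tau> + q \<tau>) \<and> spec_val \<tau> G \<noteq> 0"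
proof -
  obtain q where q: "q holomorphic_on ball 0 1" "\<And>z. cmod z < 1 \<Longrightarrow> 0 \<le> Re (q z)"
    and nz: "\<And>z. cmod z < 1 \<Longrightarrow> P z + q z \<noteq> 0"
    and G: "\<And>z. cmod z < 1 \<Longrightarrow> G z = (\<tau> - z) * (1 - cnj \<tau> * z) / (P z + q z)"
    using GenFL_representation[OF sigma_bd sigma_inj lam_neg tau_in assms] by blast
  have vals: "G 0 = \<tau> / (of_real A + q 0)" "spec_val \<tau> G = of_real (1 - (cmod \<tau>)\<^sup>2) / (P \<tau> + q \<tau>)"
    using values_of_field[OF q(1), of G] nz G by blast+
  have Aq: "of_real A + q 0 \<noteq> 0" using nz[of 0] P_0 by (simp del: of_real_sum)
  then have "G 0 \<noteq> 0" using tau_nz by (simp add: vals del: of_real_sum)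
  moreover have "q 0 = el (G 0)"
    unfolding ell_def vals(1) using Aq tau_nz by (simp del: of_real_sum)
  moreover have "spec_val \<tau> G \<noteq> 0"
    unfolding vals(2) using nz[OF tau_in] tau_sq by (simp del: of_real_diff)
  ultimately show ?thesis using q G vals by blast
qed

lemma spec_val_trivial:
  assumes "\<forall>z\<in>ball 0 1. G z = 0"
  shows "G 0 = 0" "spec_val \<tau> G = 0"
proof -
  show "G 0 = 0" using assms by simp
  have "((\<lambda>_. 0) has_field_derivative 0) (at \<tau>)" by simp
  then have "(G has_field_derivative 0) (at \<tau>)"
    by (rule has_field_derivative_transform_within_open[where S = "ball 0 1"])
       (use tau_in assms in auto)
  then show "spec_val \<tau> G = 0" by (simp add: spec_val_def DERIV_imp_deriv)
qed

text \<open>\<open>disk_coord \<zeta> \<omega>\<close> is the value at \<open>\<tau>\<close>, freed from its imaginary constant, that the remainder \<open>q\<close> must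
  have in order that \<open>(\<tau> - z) (1 - cnj \<tau> z) / (P z + q z)\<close> has spectral value \<open>\<omega>\<close>.\<close>

definition disk_coord :: "complex \<Rightarrow> complex \<Rightarrow> complex" where
  "disk_coord \<zeta> \<omega> = of_real (1 - (cmod \<tau>)\<^sup>2) / \<omega> - P \<tau> - \<i> * of_real (Im (el \<zeta>))"

lemma acen_disk_coord:
  "of_real (1 - (cmod \<tau>)\<^sup>2) / \<omega> - acen \<tau> n \<sigma> lam \<zeta> =
    disk_coord \<zeta> \<omega> - of_real ((1 + (cmod \<tau>)\<^sup>2) / (1 - (cmod \<tau>)\<^sup>2) * Re (el \<zeta>))"
  by (simp add: acen_def disk_coord_def)

text \<open>In the coordinate \<open>disk_coord\<close> the set becomes the Apollonius disk, the
  form in which the Schwarz lemma bounds \<open>q \<tau>\<close>.\<close>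

lemma Omega_iff:
  assumes "\<zeta> \<noteq> 0" "0 \<le> Re (el \<zeta>)"
  shows "\<omega> \<in> Omega \<tau> n \<sigma> lam \<zeta> \<longleftrightarrow> \<omega> \<noteq> 0 \<and>
    cmod (disk_coord \<zeta> \<omega> - of_real (Re (el \<zeta>))) \<le> cmod \<tau> * cmod (disk_coord \<zeta> \<omega> + of_real (Re (el \<zeta>)))"
  unfolding Omega_def acen_disk_coord
  using assms disk_iff(1)[of "cmod \<tau>" "Re (el \<zeta>)" "disk_coord \<zeta> \<omega>"] tau_in by simp

text \<open>The third claim prepares closedness of the region at \<open>(0, 0)\<close>. It is
  Harnack's inequality for \<open>P + q\<close>, because \<open>G 0\<close> and the spectral value
  are, up to constant factors, the reciprocals of its values at 0 and \<open>\<tau>\<close>.\<close>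

lemma value_in_region:
  assumes "G \<in> GF"
  shows "G 0 \<in> Zset \<tau> n \<sigma> lam" "spec_val \<tau> G \<in> Omega \<tau> n \<sigma> lam (G 0)"
    "cmod (spec_val \<tau> G) \<le> 6 / cmod \<tau> * cmod (G 0)"
proof (atomize (full), cases "\<exists>z\<in>ball 0 1. G z \<noteq> 0")
  case False
  then show "G 0 \<in> Zset \<tau> n \<sigma> lam \<and> spec_val \<tau> G \<in> Omega \<tau> n \<sigma> lam (G 0) \<and>
      cmod (spec_val \<tau> G) \<le> 6 / cmod \<tau> * cmod (G 0)"
    using spec_val_trivial[of G] by (simp add: Zset_def Omega_def)
next
  case True
  obtain q where holq: "q holomorphic_on ball 0 1" and posq: "\<And>z. cmod z < 1 \<Longrightarrow> 0 \<le> Re (q z)"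
    and G0: "G 0 = \<tau> / (of_real A + q 0)" "G 0 \<noteq> 0" and q0: "q 0 = el (G 0)"
    and spec: "spec_val \<tau> G = of_real (1 - (cmod \<tau>)\<^sup>2) / (P \<tau> + q \<tau>)" "spec_val \<tau> G \<noteq> 0"
    using representation[OF assms True] by blast
  have l: "0 \<le> Re (el (G 0))" using posq[of 0] q0 by simp
  then have Z: "G 0 \<in> Zset \<tau> n \<sigma> lam" using Zset_iff(1)[OF G0(2)] by simp
  have "of_real (1 - (cmod \<tau>)\<^sup>2) / spec_val \<tau> G = P \<tau> + q \<tau>"
    unfolding spec(1) using tau_sq by (simp del: of_real_diff)
  then have "disk_coord (G 0) (spec_val \<tau> G) = q \<tau> - \<i> * of_real (Im (q 0))"
    unfolding disk_coord_def by (simp add: q0)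
  then have Om: "spec_val \<tau> G \<in> Omega \<tau> n \<sigma> lam (G 0)"
    using half_plane_value_disk[OF holq posq tau_in] spec(2) unfolding Omega_iff[OF G0(2) l] q0[symmetric] by simp
  let ?Q = "\<lambda>z. P z + q z"
  have harnack: "cmod (?Q 0) * (1 - (cmod \<tau>)\<^sup>2) \<le> 6 * cmod (?Q \<tau>)"
  proof (rule Harnack_half_plane(2)[OF _ _ tau_in])
    show "?Q holomorphic_on ball 0 1" by (intro holomorphic_intros holq P_holomorphic)
    show "0 \<le> Re (?Q z)" if "cmod z < 1" for z
      using posq[OF that] Re_P_pos[OF that] by simp
  qed
  have pos: "0 < cmod (?Q \<tau>)" "0 < cmod (?Q 0)" using spec G0 P_0 by auto
  have ineq: "d / Y \<le> 6 / t * (t / X)" if "X * d \<le> 6 * Y" "0 < Y" "0 < X" "0 < t" for d t X Y :: real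
    using that by (simp add: field_simps)
  have "cmod (spec_val \<tau> G) = (1 - (cmod \<tau>)\<^sup>2) / cmod (?Q \<tau>)"
    unfolding spec norm_divide norm_of_real using tau_sq by simp
  also have "\<dots> \<le> 6 / cmod \<tau> * (cmod \<tau> / cmod (?Q 0))"
    by (rule ineq[OF harnack pos]) (use tau_nz in simp)
  also have "cmod \<tau> / cmod (?Q 0) = cmod (G 0)"
    unfolding G0 norm_divide P_0 ..
  finally have "cmod (spec_val \<tau> G) \<le> 6 / cmod \<tau> * cmod (G 0)" .
  with Z Om show "G 0 \<in> Zset \<tau> n \<sigma> lam \<and> spec_val \<tau> G \<in> Omega \<tau> n \<sigma> lam (G 0) \<and>
      cmod (spec_val \<tau> G) \<le> 6 / cmod \<tau> * cmod (G 0)" by blast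
qed

lemma zero_in_GF: "(\<lambda>_. 0) \<in> GF"
  by (simp add: GenFL_def)

lemma region_attained:
  assumes Z: "\<zeta> \<in> Zset \<tau> n \<sigma> lam" and Om: "\<omega> \<in> Omega \<tau> n \<sigma> lam \<zeta>"
  shows "\<exists>G\<in>GF. G 0 = \<zeta> \<and> spec_val \<tau> G = \<omega>"
proof (cases "\<zeta> = 0")
  case True
  then show ?thesis
    using Om zero_in_GF spec_val_trivial[of "\<lambda>_. 0"] by (auto simp: Omega_def)
next
  case False
  define x where "x = Re (el \<zeta>)"
  define y where "y = Im (el \<zeta>)"
  define v where "v = disk_coord \<zeta> \<omega>"
  have x: "0 \<le> x" using Zset_iff(1)[OF False] Z by (simp add: x_def)
  have \<omega>: "\<omega> \<noteq> 0" and disk: "cmod (v - of_real x) \<le> cmod \<tau> * cmod (v + of_real x)"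
    using Om x unfolding x_def v_def by (auto simp: Omega_iff[OF False])
  \<comment> \<open>Inverts the value formula of the remainder at \<open>\<tau>\<close>. The
    denominator vanishes only if \<open>v = x = 0\<close>, and division by zero then yields
    \<open>c = 0\<close>, which is a correct choice.\<close>
  define c where "c = (v - of_real x) / ((v + of_real x) * \<tau>)"
  have c: "cmod c \<le> 1"
  proof (cases "v + of_real x = 0")
    case False
    then show ?thesis using disk tau_nz
      unfolding c_def norm_divide norm_mult by (simp add: divide_le_eq mult.commute)
  qed (simp add: c_def)
  have cv: "of_real x * ((1 + c * \<tau>) / (1 - c * \<tau>)) = v"
  proof (cases "x = 0")
    case True
    then have "cmod v * (1 - cmod \<tau>) \<le> 0" using disk by (simp add: algebra_simps)
    then have "v = 0" using tau_in by (simp add: mult_le_0_iff)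
    then show ?thesis using True by simp
  next
    case False
    have nz: "v + of_real x \<noteq> 0"
    proof
      assume eq: "v + of_real x = 0"
      then have "v = - of_real x" by (simp add: add_eq_0_iff2)
      then show False using disk False by simp
    qed
    have "c * \<tau> = (v - of_real x) / (v + of_real x)"
      using tau_nz by (simp add: c_def)
    then have "1 + c * \<tau> = 2 * v / (v + of_real x)" "1 - c * \<tau> = 2 * of_real x / (v + of_real x)"
      using nz by (simp_all add: field_simps)
    then show ?thesis using nz False by simp
  qed
  let ?q = "\<lambda>z. of_real x * ((1 + c * z) / (1 - c * z)) + \<i> * of_real y"
  note F = field_of_in_GenFL[where y = y, OF c x]
  have nz: "P z + ?q z \<noteq> 0" if "cmod z < 1" for z
    using F(2)[OF that] by (metis less_irrefl zero_complex.sel(1))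
  have "?q 0 = el \<zeta>" by (simp add: x_def y_def complex_eq_iff)
  then have "field_of c x y 0 = \<tau> / (of_real A + el \<zeta>)"
    using values_of_field(1)[OF F(1) nz, of "field_of c x y"] by (simp add: field_of_def)
  also have "\<dots> = \<zeta>" using False tau_nz by (simp add: ell_def)
  finally have 1: "field_of c x y 0 = \<zeta>" .
  have "spec_val \<tau> (field_of c x y) = of_real (1 - (cmod \<tau>)\<^sup>2) / (P \<tau> + ?q \<tau>)"
    by (rule values_of_field(2)[OF F(1) nz]) (simp_all add: field_of_def)
  also have "P \<tau> + ?q \<tau> = of_real (1 - (cmod \<tau>)\<^sup>2) / \<omega>"
    unfolding cv by (simp add: v_def disk_coord_def y_def)
  also have "of_real (1 - (cmod \<tau>)\<^sup>2) / (of_real (1 - (cmod \<tau>)\<^sup>2) / \<omega>) = \<omega>"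
    using tau_sq by (simp del: of_real_diff)
  finally show ?thesis using F(3) 1 by blast
qed

lemma value_region_eq:
  "V = {(\<zeta>, \<omega>). \<zeta> \<in> Zset \<tau> n \<sigma> lam \<and> \<omega> \<in> Omega \<tau> n \<sigma> lam \<zeta>}"
proof (intro set_eqI iffI)
  fix v assume "v \<in> V"
  then show "v \<in> {(\<zeta>, \<omega>). \<zeta> \<in> Zset \<tau> n \<sigma> lam \<and> \<omega> \<in> Omega \<tau> n \<sigma> lam \<zeta>}"
    unfolding value_region_def using value_in_region by auto
next
  fix v assume "v \<in> {(\<zeta>, \<omega>). \<zeta> \<in> Zset \<tau> n \<sigma> lam \<and> \<omega> \<in> Omega \<tau> n \<sigma> lam \<zeta>}"
  then obtain \<zeta> \<omega> where v: "v = (\<zeta>, \<omega>)" "\<zeta> \<in> Zset \<tau> n \<sigma> lam" "\<omega> \<in> Omega \<tau> n \<sigma> lam \<zeta>" by auto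
  then obtain G where "G \<in> GF" "G 0 = \<zeta>" "spec_val \<tau> G = \<omega>" using region_attained by blast
  then show "v \<in> V" unfolding value_region_def v by blast
qed

section \<open>Closedness, interior and frontier of the value region\<close>

text \<open>The defect in the inequality of \<open>Omega\<close>. It is continuous where both
  coordinates are nonzero, and there the region is cut out by \<open>gap \<le> 0\<close> and
  \<open>Re (el \<zeta>) \<ge> 0\<close>; its only other point is the origin.\<close>

abbreviation "gap \<equiv> \<lambda>(\<zeta>, \<omega>). cmod (of_real (1 - (cmod \<tau>)\<^sup>2) / \<omega> - acen \<tau> n \<sigma> lam \<zeta>) -
    2 * cmod \<tau> / (1 - (cmod \<tau>)\<^sup>2) * Re (el \<zeta>)"

abbreviation "nonzero_pairs \<equiv> (- {0 :: complex}) \<times> (- {0 :: complex})"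

lemma gap_continuous_on: "continuous_on nonzero_pairs gap"
  unfolding acen_def ell_def case_prod_beta
  using tau_sq by (intro continuous_intros) auto

lemma Re_el_continuous_on: "continuous_on nonzero_pairs (\<lambda>v. Re (el (fst v)))"
  unfolding ell_def by (intro continuous_intros) auto

lemma open_nonzero_pairs: "open nonzero_pairs"
  by (intro open_Times) auto

lemma V_iff_nonzero:
  assumes "v \<in> nonzero_pairs"
  shows "v \<in> V \<longleftrightarrow> 0 \<le> Re (el (fst v)) \<and> gap v \<le> 0"
  using assms Zset_iff(1)[of "fst v"] unfolding value_region_eq Omega_def by (cases v) auto

lemma V_zero: "v \<in> V \<Longrightarrow> v \<notin> nonzero_pairs \<Longrightarrow> v = (0, 0)"
  unfolding value_region_eq by (cases v) (auto simp: Omega_def split: if_splits)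

text \<open>Limits with \<open>\<zeta> = 0\<close> are forced to the origin by the linear bound on
  spectral values. For \<open>\<zeta> \<noteq> 0\<close> the inequalities pass to the limit once it
  is known that \<open>\<omega> \<noteq> 0\<close>.\<close>

lemma V_closed: "closed V"
  unfolding closed_sequential_limits
proof (intro allI impI, elim conjE)
  fix X l assume X: "\<forall>i. X i \<in> V" and lim: "X \<longlonglongrightarrow> l"
  obtain \<zeta> \<omega> where l: "l = (\<zeta>, \<omega>)" by (cases l)
  have fst: "(\<lambda>i. fst (X i)) \<longlonglongrightarrow> \<zeta>" and snd: "(\<lambda>i. snd (X i)) \<longlonglongrightarrow> \<omega>"
    using tendsto_fst[OF lim] tendsto_snd[OF lim] by (simp_all add: l)
  have bound: "cmod (snd v) \<le> 6 / cmod \<tau> * cmod (fst v)" if "v \<in> V" for v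
    using that value_in_region(3) by (auto simp: value_region_def)
  have "cmod \<omega> \<le> 6 / cmod \<tau> * cmod \<zeta>"
    by (rule LIMSEQ_le[OF tendsto_norm[OF snd] tendsto_mult_left[OF tendsto_norm[OF fst]]])
       (use X bound in blast)
  show "l \<in> V"
  proof (cases "\<zeta> = 0")
    case True
    then have "l = (0, 0)" using \<open>cmod \<omega> \<le> _\<close> l by simp
    then show ?thesis unfolding value_region_eq by (simp add: Zset_def Omega_def)
  next
    case False
    from tendsto_imp_eventually_ne[OF fst False]
    have ev: "\<forall>\<^sub>F i in sequentially. X i \<in> nonzero_pairs"
    proof eventually_elim
      case (elim i)
      then show ?case using V_zero[of "X i"] X by (metis fst_conv)
    qed
    \<comment> \<open>Multiplying through by \<open>|\<omega>|\<close> removes the singular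
      \<open>1 / \<omega>\<close> before passing to the limit; with \<open>\<omega> = 0\<close> the
      limit inequality would read \<open>1 - |\<tau>|^2 \<le> 0\<close>.\<close>
    have evV: "\<forall>\<^sub>F i in sequentially. 0 \<le> Re (el (fst (X i))) \<and> cmod (of_real (1 - (cmod \<tau>)\<^sup>2) - snd (X i) * acen \<tau> n \<sigma> lam (fst (X i))) \<le>
        cmod (snd (X i)) * (2 * cmod \<tau> / (1 - (cmod \<tau>)\<^sup>2) * Re (el (fst (X i))))"
      using ev
    proof eventually_elim
      case (elim i)
      obtain a b where ab: "X i = (a, b)" by (cases "X i")
      have b: "b \<noteq> 0" using elim ab by auto
      have "0 \<le> Re (el (fst (X i))) \<and> gap (X i) \<le> 0"
        using V_iff_nonzero[OF elim] X by blast
      then have "0 \<le> Re (el a)" "cmod (of_real (1 - (cmod \<tau>)\<^sup>2) / b - acen \<tau> n \<sigma> lam a) \<le> 2 * cmod \<tau> / (1 - (cmod \<tau>)\<^sup>2) * Re (el a)"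
        unfolding ab fst_conv prod.case diff_le_0_iff_le by blast+
      note rel = this
      have "of_real (1 - (cmod \<tau>)\<^sup>2) - b * acen \<tau> n \<sigma> lam a = b * (of_real (1 - (cmod \<tau>)\<^sup>2) / b - acen \<tau> n \<sigma> lam a)"
        using b by (simp add: field_simps)
      then have scaled: "cmod (of_real (1 - (cmod \<tau>)\<^sup>2) - b * acen \<tau> n \<sigma> lam a) = cmod b * cmod (of_real (1 - (cmod \<tau>)\<^sup>2) / b - acen \<tau> n \<sigma> lam a)"
        by (simp only: norm_mult)
      show ?case
        unfolding ab fst_conv snd_conv scaled using rel(1) mult_left_mono[OF rel(2) norm_ge_zero[of b]] by blast
    qed
    have elim: "(\<lambda>i. el (fst (X i))) \<longlonglongrightarrow> el \<zeta>"
      unfolding ell_def using False by (intro tendsto_intros fst) auto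
    have alim: "(\<lambda>i. acen \<tau> n \<sigma> lam (fst (X i))) \<longlonglongrightarrow> acen \<tau> n \<sigma> lam \<zeta>"
      unfolding acen_def by (intro tendsto_intros elim)
    have "0 \<le> Re (el \<zeta>)"
      by (rule tendsto_lowerbound[OF tendsto_Re[OF elim]]) (use evV in \<open>auto elim: eventually_mono\<close>)
    have main: "cmod (of_real (1 - (cmod \<tau>)\<^sup>2) - \<omega> * acen \<tau> n \<sigma> lam \<zeta>) \<le> cmod \<omega> * (2 * cmod \<tau> / (1 - (cmod \<tau>)\<^sup>2) * Re (el \<zeta>))"
    proof (rule tendsto_le)
      show "(\<lambda>i. cmod (snd (X i)) * (2 * cmod \<tau> / (1 - (cmod \<tau>)\<^sup>2) * Re (el (fst (X i))))) \<longlonglongrightarrow>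
          cmod \<omega> * (2 * cmod \<tau> / (1 - (cmod \<tau>)\<^sup>2) * Re (el \<zeta>))"
        by (intro tendsto_mult tendsto_norm snd tendsto_const tendsto_Re elim)
      show "(\<lambda>i. cmod (of_real (1 - (cmod \<tau>)\<^sup>2) - snd (X i) * acen \<tau> n \<sigma> lam (fst (X i)))) \<longlonglongrightarrow>
          cmod (of_real (1 - (cmod \<tau>)\<^sup>2) - \<omega> * acen \<tau> n \<sigma> lam \<zeta>)"
        by (intro tendsto_norm tendsto_diff tendsto_mult tendsto_const snd alim)
      show "\<forall>\<^sub>F i in sequentially. cmod (of_real (1 - (cmod \<tau>)\<^sup>2) - snd (X i) * acen \<tau> n \<sigma> lam (fst (X i))) \<le>
        cmod (snd (X i)) * (2 * cmod \<tau> / (1 - (cmod \<tau>)\<^sup>2) * Re (el (fst (X i))))"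
        using evV by (auto elim: eventually_mono)
    qed simp
    have \<omega>: "\<omega> \<noteq> 0"
    proof
      assume "\<omega> = 0"
      then have "cmod (of_real (1 - (cmod \<tau>)\<^sup>2)) \<le> 0" using main by simp
      then show False using tau_sq by (simp del: of_real_diff)
    qed
    have "of_real (1 - (cmod \<tau>)\<^sup>2) - \<omega> * acen \<tau> n \<sigma> lam \<zeta> = \<omega> * (of_real (1 - (cmod \<tau>)\<^sup>2) / \<omega> - acen \<tau> n \<sigma> lam \<zeta>)"
      using \<omega> by (simp add: field_simps)
    then have "cmod \<omega> * cmod (of_real (1 - (cmod \<tau>)\<^sup>2) / \<omega> - acen \<tau> n \<sigma> lam \<zeta>) \<le> cmod \<omega> * (2 * cmod \<tau> / (1 - (cmod \<tau>)\<^sup>2) * Re (el \<zeta>))"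
      using main by (simp only: norm_mult)
    then have "cmod (of_real (1 - (cmod \<tau>)\<^sup>2) / \<omega> - acen \<tau> n \<sigma> lam \<zeta>) \<le> 2 * cmod \<tau> / (1 - (cmod \<tau>)\<^sup>2) * Re (el \<zeta>)"
      by (rule mult_left_le_imp_le) (use \<omega> in simp)
    then have "gap l \<le> 0" unfolding l prod.case diff_le_0_iff_le .
    then show ?thesis
      using \<open>0 \<le> Re (el \<zeta>)\<close> V_iff_nonzero[of l] False \<omega> by (simp add: l)
  qed
qed

text \<open>Strict inequalities persist nearby. Hence a frontier point, which belongs to the region
  by closedness, is the origin or has equality in one of the two inequalities, and equality is where
  rigidity enters.\<close>

lemma V_interior:
  assumes v: "v \<in> nonzero_pairs" and "0 < Re (el (fst v))" "gap v < 0"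
  shows "v \<in> interior V"
proof (rule interiorI)
  let ?U = "(nonzero_pairs \<inter> gap -` {..<0}) \<inter> (nonzero_pairs \<inter> (\<lambda>v. Re (el (fst v))) -` {0<..})"
  show "open ?U"
    by (intro open_Int continuous_open_preimage gap_continuous_on Re_el_continuous_on open_nonzero_pairs) auto
  show "v \<in> ?U" using assms by auto
  show "?U \<subseteq> V"
  proof
    fix u assume u: "u \<in> ?U"
    then have "u \<in> nonzero_pairs" by blast
    then show "u \<in> V" using u V_iff_nonzero[of u] by (simp add: less_imp_le)
  qed
qed

text \<open>The three forms are three kinds of rigidity. At the origin \<open>G\<close> vanishes,
  since a nontrivial \<open>G\<close> has \<open>G 0 \<noteq> 0\<close>; if
  \<open>Re (el \<zeta>) = 0\<close>, the remainder is an imaginary constant; if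
  \<open>Re (el \<zeta>) > 0\<close>, then \<open>gap v = 0\<close> and the remainder is extremal in
  the Schwarz lemma. In each case the formula depends on \<open>v\<close> alone, so it gives
  uniqueness as well.\<close>

lemma boundary_point_unique:
  assumes v: "v \<in> frontier V"
  shows "\<exists>G\<in>GF. (G 0, spec_val \<tau> G) = v
          \<and> (\<forall>H\<in>GF. (H 0, spec_val \<tau> H) = v \<longrightarrow> (\<forall>z\<in>ball 0 1. H z = G z))
          \<and> ((\<exists>\<zeta>\<in>interior (Zset \<tau> n \<sigma> lam). \<exists>s. cmod s = 1 \<and>
                (\<forall>z\<in>ball 0 1. G z = (\<tau> - z) * (1 - cnj \<tau> * z) /
                   ((s + z) / (s - z) * of_real (Re (el \<zeta>))
                    + \<i> * of_real (Im (el \<zeta>)) + P z)))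
             \<or> (\<exists>\<zeta>\<in>frontier (Zset \<tau> n \<sigma> lam) - {0}.
                (\<forall>z\<in>ball 0 1. G z = (\<tau> - z) * (1 - cnj \<tau> * z) /
                   (\<i> * of_real (Im (el \<zeta>)) + P z)))
             \<or> (\<forall>z\<in>ball 0 1. G z = 0))"
proof -
  have vV: "v \<in> V" and nint: "v \<notin> interior V"
    using v V_closed by (auto simp: frontier_def)
  obtain G where G: "G \<in> GF" "(G 0, spec_val \<tau> G) = v"
    using vV unfolding value_region_def by auto
  show ?thesis
  proof (cases "v \<in> nonzero_pairs")
    case False
    then have v0: "v = (0, 0)" using V_zero vV by blast
    have triv: "\<forall>z\<in>ball 0 1. H z = 0" if H: "H \<in> GF" "(H 0, spec_val \<tau> H) = v" for H
    proof (rule ccontr)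
      assume "\<not> ?thesis"
      then have "\<exists>z\<in>ball 0 1. H z \<noteq> 0" by simp
      from representation[OF H(1) this] show False using H(2) v0 by blast
    qed
    have "\<forall>H\<in>GF. (H 0, spec_val \<tau> H) = v \<longrightarrow> (\<forall>z\<in>ball 0 1. H z = G z)"
    proof (intro ballI impI)
      fix H z assume "H \<in> GF" "(H 0, spec_val \<tau> H) = v" "z \<in> ball (0 :: complex) 1"
      then show "H z = G z" using triv[of H] triv[OF G] by simp
    qed
    then show ?thesis using G triv[OF G] by blast
  next
    case True
    obtain \<zeta> \<omega> where v': "v = (\<zeta>, \<omega>)" by (cases v)
    have \<zeta>: "\<zeta> \<noteq> 0" and \<omega>: "\<omega> \<noteq> 0" using True v' by auto
    have x: "0 \<le> Re (el \<zeta>)" and gap: "gap v \<le> 0"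
      using V_iff_nonzero[OF True] vV by (auto simp: v')
    have not_strict: "\<not> (0 < Re (el \<zeta>) \<and> gap v < 0)"
      using V_interior[OF True] nint by (auto simp: v')
    have rep: "\<exists>q. q holomorphic_on ball 0 1 \<and> (\<forall>z. cmod z < 1 \<longrightarrow> 0 \<le> Re (q z)) \<and> q 0 = el \<zeta> \<and>
        q \<tau> - \<i> * of_real (Im (q 0)) = disk_coord \<zeta> \<omega> \<and>
        (\<forall>z\<in>ball 0 1. H z = (\<tau> - z) * (1 - cnj \<tau> * z) / (q z + P z))"
      if H: "H \<in> GF" "(H 0, spec_val \<tau> H) = v" for H
    proof -
      have "\<exists>z\<in>ball 0 1. H z \<noteq> 0" using H(2) v' \<zeta> by (intro bexI[of _ 0]) auto
      then obtain q where q: "q holomorphic_on ball 0 1"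
        "\<And>z. cmod z < 1 \<Longrightarrow> 0 \<le> Re (q z)"
        "\<And>z. cmod z < 1 \<Longrightarrow> H z = (\<tau> - z) * (1 - cnj \<tau> * z) / (P z + q z)"
        "H 0 = \<tau> / (of_real A + q 0)" "H 0 \<noteq> 0"
        "q 0 = el (H 0)" "spec_val \<tau> H = of_real (1 - (cmod \<tau>)\<^sup>2) / (P \<tau> + q \<tau>)" "spec_val \<tau> H \<noteq> 0"
        using representation[OF H(1)] by blast
      have "\<omega> = spec_val \<tau> H" using H(2) v' by simp
      then have "of_real (1 - (cmod \<tau>)\<^sup>2) / \<omega> = P \<tau> + q \<tau>"
        unfolding q(7) using tau_sq by (simp del: of_real_diff)
      then have "q \<tau> - \<i> * of_real (Im (q 0)) = disk_coord \<zeta> \<omega>"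
        using q(6) H(2) v' by (simp add: disk_coord_def)
      moreover have "\<forall>z\<in>ball 0 1. H z = (\<tau> - z) * (1 - cnj \<tau> * z) / (q z + P z)"
        using q(3) by (simp add: add.commute)
      moreover have "q 0 = el \<zeta>" using q(6) H(2) v' by simp
      ultimately show ?thesis using q(1,2) by (intro exI[of _ q] conjI allI impI)
    qed
    show ?thesis
    proof (cases "Re (el \<zeta>) = 0")
      case True
      have form: "\<forall>z\<in>ball 0 1. H z = (\<tau> - z) * (1 - cnj \<tau> * z) / (\<i> * of_real (Im (el \<zeta>)) + P z)"
        if H: "H \<in> GF" "(H 0, spec_val \<tau> H) = v" for H
      proof
        fix z :: complex assume z: "z \<in> ball 0 1"
        obtain q where q: "q holomorphic_on ball 0 1" "\<And>z. cmod z < 1 \<Longrightarrow> 0 \<le> Re (q z)" "q 0 = el \<zeta>"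
          "\<forall>z\<in>ball 0 1. H z = (\<tau> - z) * (1 - cnj \<tau> * z) / (q z + P z)"
          using rep[OF H] by blast
        let ?y = "\<i> * complex_of_real (Im (el \<zeta>))"
        have "(\<lambda>z. q z - ?y) holomorphic_on ball 0 1" by (intro holomorphic_intros q(1))
        moreover have "0 \<le> Re (q u - ?y)" if "cmod u < 1" for u using q(2)[OF that] by simp
        moreover have "q 0 - ?y = 0" using True by (simp add: q(3) complex_eq_iff)
        ultimately have "q z - ?y = 0"
          using half_plane_zero_imp_zero[of "\<lambda>z. q z - ?y" 0 z] z by simp
        then have "q z = ?y" by simp
        then show "H z = (\<tau> - z) * (1 - cnj \<tau> * z) / (?y + P z)"
          using q(4) z by simp
      qed
      have "\<zeta> \<in> frontier (Zset \<tau> n \<sigma> lam) - {0}"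
        using Zset_interior_frontier(2)[OF \<zeta> True] \<zeta> by simp
      with form[OF G] have "\<exists>\<zeta>\<in>frontier (Zset \<tau> n \<sigma> lam) - {0}.
          \<forall>z\<in>ball 0 1. G z = (\<tau> - z) * (1 - cnj \<tau> * z) / (\<i> * of_real (Im (el \<zeta>)) + P z)"
        by (rule bexI)
      moreover have "\<forall>H\<in>GF. (H 0, spec_val \<tau> H) = v \<longrightarrow> (\<forall>z\<in>ball 0 1. H z = G z)"
      proof (intro ballI impI)
        fix H z assume "H \<in> GF" "(H 0, spec_val \<tau> H) = v" "z \<in> ball (0 :: complex) 1"
        then show "H z = G z" using form[of H] form[OF G] by simp
      qed
      ultimately show ?thesis
        using G by - (rule bexI[of _ G], rule conjI, assumption, rule conjI, assumption, rule disjI2, rule disjI1)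
    next
      case False
      then have x: "0 < Re (el \<zeta>)" using x by simp
      let ?v = "disk_coord \<zeta> \<omega>" and ?x = "complex_of_real (Re (el \<zeta>))"
      \<comment> \<open>Fixed by \<open>v\<close> before any generator is chosen, so every generator
        delivering \<open>v\<close> gets the same pole.\<close>
      define s where "s = cnj ((?v - ?x) / ((?v + ?x) * \<tau>))"
      have "gap v = 0" using not_strict gap x by simp
      then have "cmod (?v - of_real ((1 + (cmod \<tau>)\<^sup>2) / (1 - (cmod \<tau>)\<^sup>2) * Re (el \<zeta>))) =
          2 * cmod \<tau> / (1 - (cmod \<tau>)\<^sup>2) * Re (el \<zeta>)"
        unfolding v' acen_disk_coord[symmetric] by simp
      then have ext: "cmod (?v - ?x) = cmod \<tau> * cmod (?v + ?x)"
        using disk_iff(2)[of "cmod \<tau>" "Re (el \<zeta>)" ?v] tau_in x by simp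
      have form: "(\<forall>z\<in>ball 0 1. H z = (\<tau> - z) * (1 - cnj \<tau> * z) /
            ((s + z) / (s - z) * ?x + \<i> * of_real (Im (el \<zeta>)) + P z)) \<and> cmod s = 1"
        if H: "H \<in> GF" "(H 0, spec_val \<tau> H) = v" for H
      proof -
        obtain q where q: "q holomorphic_on ball 0 1" "\<And>z. cmod z < 1 \<Longrightarrow> 0 \<le> Re (q z)" "q 0 = el \<zeta>"
          "q \<tau> - \<i> * of_real (Im (q 0)) = ?v"
          "\<forall>z\<in>ball 0 1. H z = (\<tau> - z) * (1 - cnj \<tau> * z) / (q z + P z)"
          using rep[OF H] by blast
        have x0: "0 < Re (q 0)" using x q(3) by simp
        have s_eq: "s = cnj ((?v - of_real (Re (q 0))) / ((?v + of_real (Re (q 0))) * \<tau>))"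
          unfolding q(3) by (rule s_def)
        have ext_q: "cmod (?v - of_real (Re (q 0))) = cmod \<tau> * cmod (?v + of_real (Re (q 0)))"
          unfolding q(3) by (rule ext)
        note E = half_plane_extremal[OF q(1,2) x0 tau_in tau_nz q(4)[symmetric] s_eq ext_q]
        show ?thesis
        proof (intro conjI ballI)
          show "cmod s = 1" using E(2)[of 0] by simp
          fix z :: complex assume z: "z \<in> ball 0 1"
          have "q z = (s + z) / (s - z) * ?x + \<i> * of_real (Im (el \<zeta>))"
            using E(1)[of z] z unfolding q(3) by simp
          then show "H z = (\<tau> - z) * (1 - cnj \<tau> * z) /
            ((s + z) / (s - z) * ?x + \<i> * of_real (Im (el \<zeta>)) + P z)"
            using q(5) z by metis
        qed
      qed
      have "\<exists>s. cmod s = 1 \<and> (\<forall>z\<in>ball 0 1. G z = (\<tau> - z) * (1 - cnj \<tau> * z) /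
            ((s + z) / (s - z) * ?x + \<i> * of_real (Im (el \<zeta>)) + P z))"
        using conjunct2[OF form[OF G]] conjunct1[OF form[OF G]] by - (rule exI[of _ s], rule conjI)
      then have "\<exists>\<zeta>\<in>interior (Zset \<tau> n \<sigma> lam). \<exists>s. cmod s = 1 \<and> (\<forall>z\<in>ball 0 1. G z = (\<tau> - z) * (1 - cnj \<tau> * z) /
            ((s + z) / (s - z) * of_real (Re (el \<zeta>)) + \<i> * of_real (Im (el \<zeta>)) + P z))"
        by (rule bexI[of _ \<zeta>]) (rule Zset_interior_frontier(1)[OF \<zeta> x])
      moreover have "\<forall>H\<in>GF. (H 0, spec_val \<tau> H) = v \<longrightarrow> (\<forall>z\<in>ball 0 1. H z = G z)"
      proof (intro ballI impI)
        fix H z assume H: "H \<in> GF" "(H 0, spec_val \<tau> H) = v" and z: "z \<in> ball (0 :: complex) 1"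
        show "H z = G z" using conjunct1[OF form[OF H]] conjunct1[OF form[OF G]] z by simp
      qed
      ultimately show ?thesis
        using G by - (rule bexI[of _ G], rule conjI, assumption, rule conjI, assumption, rule disjI1)
    qed
  qed
qed

end

theorem theorem6p4:
  fixes \<tau> :: complex and n :: nat and \<sigma> :: "nat \<Rightarrow> complex" and lam :: "nat \<Rightarrow> real"
  assumes n_pos: "1 \<le> n"
    and sigma_bd: "\<forall>k\<in>{1..n}. cmod (\<sigma> k) = 1"
    and sigma_inj: "inj_on \<sigma> {1..n}"
    and lam_neg: "\<forall>k\<in>{1..n}. lam k < 0"
    and tau_in: "cmod \<tau> < 1" and tau_nz: "\<tau> \<noteq> 0"
  shows "value_region \<tau> n \<sigma> lam =
           {(\<zeta>, \<omega>). \<zeta> \<in> Zset \<tau> n \<sigma> lam \<and> \<omega> \<in> Omega \<tau> n \<sigma> lam \<zeta>}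
   \<and> (\<forall>v\<in>frontier (value_region \<tau> n \<sigma> lam).
        \<exists>G\<in>GenFL \<tau> n \<sigma> lam. (G 0, spec_val \<tau> G) = v
          \<and> (\<forall>H\<in>GenFL \<tau> n \<sigma> lam. (H 0, spec_val \<tau> H) = v \<longrightarrow> (\<forall>z\<in>ball 0 1. H z = G z))
          \<and> ((\<exists>\<zeta>\<in>interior (Zset \<tau> n \<sigma> lam). \<exists>s. cmod s = 1 \<and>
                (\<forall>z\<in>ball 0 1. G z = (\<tau> - z) * (1 - cnj \<tau> * z) /
                   ((s + z) / (s - z) * of_real (Re (ell \<tau> n \<sigma> lam \<zeta>))
                    + \<i> * of_real (Im (ell \<tau> n \<sigma> lam \<zeta>)) + p0 \<tau> n \<sigma> lam z)))
             \<or> (\<exists>\<zeta>\<in>frontier (Zset \<tau> n \<sigma> lam) - {0}.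
                (\<forall>z\<in>ball 0 1. G z = (\<tau> - z) * (1 - cnj \<tau> * z) /
                   (\<i> * of_real (Im (ell \<tau> n \<sigma> lam \<zeta>)) + p0 \<tau> n \<sigma> lam z)))
             \<or> (\<forall>z\<in>ball 0 1. G z = 0)))"
proof -
  interpret BRFP_data \<tau> n \<sigma> lam
    using assms by unfold_locales
  show ?thesis
    using value_region_eq boundary_point_unique by blast
qed

end
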